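(* Let $f_0,\dots,f_m$, $U$, $\Omega$, $T$ satisfy assumptions (A1), (A2), (A3) of the context, let $\mathcal{U}$ carry the weak topology of $L^2(0,T;\mathbb{R}^m)$, and let $k$ be a symmetric positive mollifier. Then the following hold. (i) Let $\mathbb{P}_\varepsilon\in\mathcal{P}(\Omega\times\mathcal{U})$ be a sequence, with $\varepsilon\downarrow 0$, such that each $\mathbb{P}_\varepsilon$ is a minimizer of $\mathcal{E}_\varepsilon$ over $\mathcal{P}(\Omega\times\mathcal{U})$ (problem $(\mathrm{ROT}_\varepsilon)$). Then there exists $\mathbb{P}\in\mathcal{P}(\Omega\times\mathcal{U})$ such that, up to a subsequence, $\mathbb{P}_\varepsilon\rightharpoonup\mathbb{P}$ narrowly, and $\mathbb{P}$ is a minimizer of $\mathcal{E}$ over $\mathcal{P}(\Omega\times\mathcal{U})$ (problem $(\mathrm{ROT})$). Furthermore, $E_{\#}\mathbb{P}_\varepsilon$ converges narrowly, as $\varepsilon\downarrow0$, to the uniform probability measure $m_R$ on the reachable set $\mathcal{R}^T_\Omega$. (ii) Fix $\varepsilon>0$ and let $\mathbb{P}_\delta\in\mathcal{P}(\Omega\times\mathcal{U})$ be a sequence, with $\delta\to0$, such that each $\mathbb{P}_\delta$ is a minimizer of $\mathcal{E}_{\varepsilon,\delta}$ over $\mathcal{P}(\Omega\times\mathcal{U})$ (problem $(\mathrm{ROT}_{\varepsilon,\delta})$). Then there exists $\mathbb{P}\in\mathcal{P}(\Omega\times\mathcal{U})$ such that, up to a subsequence, $\mathbb{P}_\delta\rightharpoonup\mathbb{P}$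 narrowly, and $\mathbb{P}$ is a minimizer of $\mathcal{E}_\varepsilon$ over $\mathcal{P}(\Omega\times\mathcal{U})$ (problem $(\mathrm{ROT}_\varepsilon)$). (iii) Fix $\varepsilon,\delta>0$ and, for each $N\in\mathbb{N}$, let $(\mathbf{x}_{N,0},\mathbf{u}_N)=\big((x_{N,0,1},u_{N,1}),\dots,(x_{N,0,N},u_{N,N})\big)$, with $x_{N,0,i}\in\Omega$ and $u_{N,i}\in\mathcal{U}$, be a solution (minimizer) of the $N$-particle problem $(\mathrm{ROT}_{\varepsilon,\delta,N})$. Then there exists $\mathbb{P}\in\mathcal{P}(\Omega\times\mathcal{U})$ such that, up to a subsequence, $\frac1N\sum_{i=1}^N\delta_{(x_{N,0,i},u_{N,i})}\rightharpoonup\mathbb{P}$ narrowly as $N\to\infty$, and $\mathbb{P}$ is a minimizer of $\mathcal{E}_{\varepsilon,\delta}$ over $\mathcal{P}(\Omega\times\mathcal{U})$ (problem $(\mathrm{ROT}_{\varepsilon,\delta})$).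
   Context: **Control system.** Let $T>0$, $f_0,\dots,f_m:\mathbb{R}^d\to\mathbb{R}^d$, $U\subset\mathbb{R}^m$, $\Omega\subset\mathbb{R}^d$. Consider $\dot x(t)=f(x(t),u(t)):=f_0(x(t))+\sum_{i=1}^m u_i(t)f_i(x(t))$ on $[0,T]$ (solutions are absolutely continuous and satisfy the equation for a.e. $t$). The control space is $\mathcal{U}=\{u\in L^2(0,T;\mathbb{R}^m): u(t)\in U \text{ for a.e. } t\in(0,T)\}$, equipped with the weak topology of $L^2(0,T;\mathbb{R}^m)$. The end-point map is $E(x_0,u)=x(T)$, where $x$ is the solution with control $u$ and $x(0)=x_0$. The reachable set is $\mathcal{R}^T_\Omega=\{E(x_0,u): x_0\in\Omega,\ u\in\mathcal{U}\}$. $\lambda$ denotes Lebesgue measure on $\mathbb{R}^d$. **Assumptions.** (A1) Each $f_i$ ($i=0,\dots,m$) is $C^1$, and there is $C>0$ with $|f_i(x)|\le C(1+|x|)$ for all $x\in\mathbb{R}^d$ and all $i$. (A2) $\Omega$ is nonempty and compact; $U$ is nonempty, compact and convex. (A3) $0<\lambda(\mathcal{R}^T_\Omega)<\infty$. **Measures.** $\mathcal{P}(X)$ is the set of Borel probability measures on $X$; narrow convergence $\mu_n\rightharpoonup\mu$ means $\int f\,d\mu_n\to\int f\,d\mu$ for all bounded continuous $f:X\to\mathbb{R}$. $E_{\#}\mathbb{P}$ is the push-forward of $\mathbb{P}$ under $E$, regarded as a measure on $\mathbb{R}^d$. Let $c=\lambda(\mathcal{R}^T_\Omega)$ and $m_R(A)=\frac1c\lambda(A\cap\mathcal{R}^T_\Omega)$.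 **Mollifier.** A symmetric positive mollifier is a smooth, nonnegative, even, compactly supported function $k:\mathbb{R}^d\to\mathbb{R}$ with $\int k=1$ (so $\delta^{-d}k(\cdot/\delta)$ tends to the Dirac mass at the origin as $\delta\to0$). Set $k_\delta(y)=\delta^{-d}k(y/\delta)$, $k_\delta*\mu(y)=\int k_\delta(y-x)\,d\mu(x)$, and $K_\delta(x-z)=\int_{\mathbb{R}^d}k_\delta(y-x)k_\delta(y-z)\,dy$. **Functionals and problems** (for $\varepsilon,\delta>0$). $\mathcal{G}(\mathbb{P})=\int_{\Omega\times\mathcal{U}}\int_0^T|u(t)|^2\,dt\,d\mathbb{P}(x_0,u)$. $\mathcal{F}(\mu)=0$ if $\mu=m_R$ and $+\infty$ otherwise. $\mathcal{F}_\varepsilon(\mu)=\frac1\varepsilon\int_{\mathbb{R}^d}\big(\frac{d\mu}{d\lambda}\big)^2dx$ if $\mu\ll\lambda$ and $+\infty$ otherwise. $\mathcal{F}_{\varepsilon,\delta}(\mu)=\frac1\varepsilon\int_{\mathbb{R}^d}|k_\delta*\mu(y)|^2dy$. - $(\mathrm{ROT})$: minimize $\mathcal{E}(\mathbb{P})=\mathcal{G}(\mathbb{P})+\mathcal{F}(E_{\#}\mathbb{P})$ over $\mathbb{P}\in\mathcal{P}(\Omega\times\mathcal{U})$. - $(\mathrm{ROT}_\varepsilon)$: minimize $\mathcal{E}_\varepsilon(\mathbb{P})=\mathcal{G}(\mathbb{P})+\mathcal{F}_\varepsilon(E_{\#}\mathbb{P})$ over $\mathbb{P}\in\mathcal{P}(\Omega\times\mathcal{U})$.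 - $(\mathrm{ROT}_{\varepsilon,\delta})$: minimize $\mathcal{E}_{\varepsilon,\delta}(\mathbb{P})=\mathcal{G}(\mathbb{P})+\mathcal{F}_{\varepsilon,\delta}(E_{\#}\mathbb{P})$ over $\mathbb{P}\in\mathcal{P}(\Omega\times\mathcal{U})$. - $(\mathrm{ROT}_{\varepsilon,\delta,N})$: minimize $\frac1N\sum_{i=1}^N\int_0^T|u_i(t)|^2dt+\frac{1}{\varepsilon N^2}\sum_{i,j=1}^N K_\delta\big(x_i(T)-x_j(T)\big)$ over $x_{i,0}\in\Omega$, $u_i\in\mathcal{U}$ ($i=1,\dots,N$), where $\dot x_i=f(x_i,u_i)$, $x_i(0)=x_{i,0}$, i.e. $x_i(T)=E(x_{i,0},u_i)$. **Convention.** A "sequence" indexed by $\varepsilon$ (resp. $\delta$) is indexed by an arbitrary sequence of positive numbers tending to $0$. *)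

theory Defs
  imports "HOL-Probability.Probability"
begin

section \<open>Regularity of maps and curves\<close>

text \<open>\<open>Ck n g\<close>: \<open>g\<close> is of class \<open>C^n\<close> on the whole space; \<open>frechet_derivative g (at x) b\<close> is
  the partial derivative in the direction of the basis vector \<open>b\<close>.\<close>

primrec Ck :: "nat \<Rightarrow> ('a::euclidean_space \<Rightarrow> 'b::real_normed_vector) \<Rightarrow> bool" where
  "Ck 0 g \<longleftrightarrow> continuous_on UNIV g"
| "Ck (Suc n) g \<longleftrightarrow> (\<forall>x. g differentiable (at x)) \<and>
     (\<forall>b\<in>Basis. Ck n (\<lambda>x. frechet_derivative g (at x) b))"

definition abs_cont_on :: "real \<Rightarrow> real \<Rightarrow> (real \<Rightarrow> 'a::real_normed_vector) \<Rightarrow> bool" where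
  "abs_cont_on a b x \<longleftrightarrow>
     (\<forall>e>0. \<exists>d>0. \<forall>(n::nat) s t.
        (\<forall>i<n. a \<le> s i \<and> s i \<le> t i \<and> t i \<le> b) \<and>
        disjoint_family_on (\<lambda>i. {s i<..<t i}) {..<n} \<and>
        (\<Sum>i<n. t i - s i) < d
        \<longrightarrow> (\<Sum>i<n. norm (x (t i) - x (s i))) < e)"

section \<open>The space \<open>L^2(0,T;R^m)\<close> with its weak topology\<close>

text \<open>Elements of \<open>L^2\<close> are classes of square integrable functions modulo equality almost
  everywhere on \<open>[0,T]\<close>; what a representative does outside \<open>[0,T]\<close> is irrelevant.\<close>

definition L2_fun :: "real \<Rightarrow> (real \<Rightarrow> 'b::euclidean_space) set" where
  "L2_fun T = {v \<in> borel_measurable (lebesgue_on {0..T}).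
                 integrable (lebesgue_on {0..T}) (\<lambda>t. (norm (v t))\<^sup>2)}"

definition L2_eq :: "real \<Rightarrow> ((real \<Rightarrow> 'b::euclidean_space) \<times> (real \<Rightarrow> 'b)) set" where
  "L2_eq T = {(v, w). v \<in> L2_fun T \<and> w \<in> L2_fun T \<and> (AE t in lebesgue_on {0..T}. v t = w t)}"

definition L2 :: "real \<Rightarrow> (real \<Rightarrow> 'b::euclidean_space) set set" where
  "L2 T = L2_fun T // L2_eq T"

text \<open>An arbitrary representative. Everything below depends only on the class.\<close>

definition rep :: "(real \<Rightarrow> 'b) set \<Rightarrow> real \<Rightarrow> 'b" where
  "rep \<phi> = (SOME v. v \<in> \<phi>)"

definition L2_inner :: "real \<Rightarrow> (real \<Rightarrow> 'b::euclidean_space) set \<Rightarrow> (real \<Rightarrow> 'b) set \<Rightarrow> real" where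
  "L2_inner T \<phi> \<gamma> = (\<integral>t. rep \<phi> t \<bullet> rep \<gamma> t \<partial>lebesgue_on {0..T})"

text \<open>The squared \<open>L^2\<close> norm.\<close>

definition energy :: "real \<Rightarrow> (real \<Rightarrow> 'b::euclidean_space) set \<Rightarrow> real" where
  "energy T \<phi> = (\<integral>t. (norm (rep \<phi> t))\<^sup>2 \<partial>lebesgue_on {0..T})"

text \<open>The coarsest topology on \<open>L^2\<close> for which all bounded linear functionals, that is
  (Riesz) all maps \<open>\<lambda>\<phi>. L2_inner T \<phi> \<gamma>\<close>, are continuous.\<close>

definition weak_L2 :: "real \<Rightarrow> (real \<Rightarrow> 'b::euclidean_space) set topology" where
  "weak_L2 T = topology_generated_by
     {{\<phi> \<in> L2 T. L2_inner T \<phi> \<gamma> \<in> S} | \<gamma> S. \<gamma> \<in> L2 T \<and> open S}"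

section \<open>Borel probability measures on a topological space\<close>

definition borel_of :: "'a topology \<Rightarrow> 'a measure" where
  "borel_of X = sigma (topspace X) {S. openin X S}"

definition prob_measures :: "'a topology \<Rightarrow> 'a measure set" where
  "prob_measures X = {M. prob_space M \<and> sets M = sets (borel_of X)}"

definition narrow_conv :: "'a topology \<Rightarrow> (nat \<Rightarrow> 'a measure) \<Rightarrow> 'a measure \<Rightarrow> bool" where
  "narrow_conv X \<mu> \<nu> \<longleftrightarrow>
     (\<forall>g. continuous_map X euclideanreal g \<and> bounded (g ` topspace X)
        \<longrightarrow> (\<lambda>n. \<integral>x. g x \<partial>\<mu> n) \<longlonglongrightarrow> (\<integral>x. g x \<partial>\<nu>))"

text \<open>The law of \<open>p i\<close> for uniformly distributed \<open>i\<close>, i.e. the average of the Dirac measures at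
  \<open>p 1, \<dots>, p N\<close> (see \<open>emeasure_empirical\<close> below).\<close>

definition empirical :: "'a topology \<Rightarrow> nat \<Rightarrow> (nat \<Rightarrow> 'a) \<Rightarrow> 'a measure" where
  "empirical X N p = distr (uniform_count_measure {1..N}) (borel_of X) p"

section \<open>The control system\<close>

definition controls :: "real \<Rightarrow> (real^'m) set \<Rightarrow> (real \<Rightarrow> real^'m) set set" where
  "controls T U = {\<phi> \<in> L2 T. AE t in lebesgue_on {0..T}. rep \<phi> t \<in> U}"

definition state_control_top ::
  "real \<Rightarrow> (real^'m) set \<Rightarrow> (real^'d) set \<Rightarrow> ((real^'d) \<times> (real \<Rightarrow> real^'m) set) topology" where
  "state_control_top T U \<Omega> =
     prod_topology (top_of_set \<Omega>) (subtopology (weak_L2 T) (controls T U))"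

definition is_solution ::
  "real \<Rightarrow> (real^'d \<Rightarrow> real^'d) \<Rightarrow> ('m::finite \<Rightarrow> real^'d \<Rightarrow> real^'d) \<Rightarrow>
   real^'d \<Rightarrow> (real \<Rightarrow> real^'m) set \<Rightarrow> (real \<Rightarrow> real^'d) \<Rightarrow> bool" where
  "is_solution T f0 f x0 \<phi> x \<longleftrightarrow>
     abs_cont_on 0 T x \<and> x 0 = x0 \<and>
     (AE t in lebesgue_on {0..T}.
        (x has_vector_derivative f0 (x t) + (\<Sum>i\<in>UNIV. (rep \<phi> t $ i) *\<^sub>R f i (x t)))
          (at t within {0..T}))"

definition endpoint ::
  "real \<Rightarrow> (real^'d \<Rightarrow> real^'d) \<Rightarrow> ('m::finite \<Rightarrow> real^'d \<Rightarrow> real^'d) \<Rightarrow>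
   (real^'d) \<times> (real \<Rightarrow> real^'m) set \<Rightarrow> real^'d" where
  "endpoint T f0 f = (\<lambda>(x0, \<phi>). THE y. \<exists>x. is_solution T f0 f x0 \<phi> x \<and> y = x T)"

definition reachable_set ::
  "real \<Rightarrow> (real^'d \<Rightarrow> real^'d) \<Rightarrow> ('m::finite \<Rightarrow> real^'d \<Rightarrow> real^'d) \<Rightarrow>
   (real^'m) set \<Rightarrow> (real^'d) set \<Rightarrow> (real^'d) set" where
  "reachable_set T f0 f U \<Omega> = {endpoint T f0 f (x0, \<phi>) | x0 \<phi>. x0 \<in> \<Omega> \<and> \<phi> \<in> controls T U}"

definition endpoint_law ::
  "real \<Rightarrow> (real^'d \<Rightarrow> real^'d) \<Rightarrow> ('m::finite \<Rightarrow> real^'d \<Rightarrow> real^'d) \<Rightarrow>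
   ((real^'d) \<times> (real \<Rightarrow> real^'m) set) measure \<Rightarrow> (real^'d) measure" where
  "endpoint_law T f0 f P = distr P borel (endpoint T f0 f)"

section \<open>Mollifiers\<close>

definition sym_pos_mollifier :: "(real^'d \<Rightarrow> real) \<Rightarrow> bool" where
  "sym_pos_mollifier k \<longleftrightarrow>
     (\<forall>n. Ck n k) \<and> (\<forall>y. 0 \<le> k y) \<and> (\<forall>y. k (- y) = k y) \<and>
     compact (closure {y. k y \<noteq> 0}) \<and> (\<integral>y. k y \<partial>lborel) = 1"

definition mollifier_scaled :: "(real^'d \<Rightarrow> real) \<Rightarrow> real \<Rightarrow> real^'d \<Rightarrow> real" where
  "mollifier_scaled k \<delta> y = k (y /\<^sub>R \<delta>) / \<delta> ^ CARD('d)"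

definition mollify :: "(real^'d \<Rightarrow> real) \<Rightarrow> real \<Rightarrow> (real^'d) measure \<Rightarrow> real^'d \<Rightarrow> real" where
  "mollify k \<delta> \<mu> y = (\<integral>x. mollifier_scaled k \<delta> (y - x) \<partial>\<mu>)"

text \<open>The function \<open>K_\<delta>\<close> of one variable; \<open>interaction_kernel_diff\<close> below is the
  two-point formula for \<open>K_\<delta> (x - z)\<close>.\<close>

definition interaction_kernel :: "(real^'d \<Rightarrow> real) \<Rightarrow> real \<Rightarrow> real^'d \<Rightarrow> real" where
  "interaction_kernel k \<delta> w =
     (\<integral>y. mollifier_scaled k \<delta> (y - w) * mollifier_scaled k \<delta> y \<partial>lborel)"

section \<open>Functionals\<close>

definition control_cost :: "real \<Rightarrow> ((real^'d) \<times> (real \<Rightarrow> real^'m) set) measure \<Rightarrow> ennreal" where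
  "control_cost T P = (\<integral>\<^sup>+ (x0, \<phi>). ennreal (energy T \<phi>) \<partial>P)"

definition final_uniform :: "(real^'d) set \<Rightarrow> (real^'d) measure \<Rightarrow> ennreal" where
  "final_uniform R \<mu> = (if \<mu> = uniform_measure lborel R then 0 else \<infinity>)"

definition final_eps :: "real \<Rightarrow> (real^'d) measure \<Rightarrow> ennreal" where
  "final_eps \<epsilon> \<mu> =
     (if absolutely_continuous lborel \<mu>
      then ennreal (1 / \<epsilon>) * (\<integral>\<^sup>+ x. (RN_deriv lborel \<mu> x)\<^sup>2 \<partial>lborel) else \<infinity>)"

definition final_eps_delta ::
  "(real^'d \<Rightarrow> real) \<Rightarrow> real \<Rightarrow> real \<Rightarrow> (real^'d) measure \<Rightarrow> ennreal" where
  "final_eps_delta k \<epsilon> \<delta> \<mu> =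
     ennreal (1 / \<epsilon>) * (\<integral>\<^sup>+ y. ennreal (\<bar>mollify k \<delta> \<mu> y\<bar>\<^sup>2) \<partial>lborel)"

definition ROT_energy ::
  "real \<Rightarrow> (real^'d \<Rightarrow> real^'d) \<Rightarrow> ('m::finite \<Rightarrow> real^'d \<Rightarrow> real^'d) \<Rightarrow>
   (real^'m) set \<Rightarrow> (real^'d) set \<Rightarrow>
   ((real^'d) \<times> (real \<Rightarrow> real^'m) set) measure \<Rightarrow> ennreal" where
  "ROT_energy T f0 f U \<Omega> P =
     control_cost T P + final_uniform (reachable_set T f0 f U \<Omega>) (endpoint_law T f0 f P)"

definition ROT_eps_energy ::
  "real \<Rightarrow> (real^'d \<Rightarrow> real^'d) \<Rightarrow> ('m::finite \<Rightarrow> real^'d \<Rightarrow> real^'d) \<Rightarrow> real \<Rightarrow>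
   ((real^'d) \<times> (real \<Rightarrow> real^'m) set) measure \<Rightarrow> ennreal" where
  "ROT_eps_energy T f0 f \<epsilon> P = control_cost T P + final_eps \<epsilon> (endpoint_law T f0 f P)"

definition ROT_eps_delta_energy ::
  "real \<Rightarrow> (real^'d \<Rightarrow> real^'d) \<Rightarrow> ('m::finite \<Rightarrow> real^'d \<Rightarrow> real^'d) \<Rightarrow>
   (real^'d \<Rightarrow> real) \<Rightarrow> real \<Rightarrow> real \<Rightarrow>
   ((real^'d) \<times> (real \<Rightarrow> real^'m) set) measure \<Rightarrow> ennreal" where
  "ROT_eps_delta_energy T f0 f k \<epsilon> \<delta> P =
     control_cost T P + final_eps_delta k \<epsilon> \<delta> (endpoint_law T f0 f P)"

text \<open>Particle configurations are sequences of which only the entries \<open>p 1, \<dots>, p N\<close> matter.\<close>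

definition particles_energy ::
  "real \<Rightarrow> (real^'d \<Rightarrow> real^'d) \<Rightarrow> ('m::finite \<Rightarrow> real^'d \<Rightarrow> real^'d) \<Rightarrow>
   (real^'d \<Rightarrow> real) \<Rightarrow> real \<Rightarrow> real \<Rightarrow> nat \<Rightarrow>
   (nat \<Rightarrow> (real^'d) \<times> (real \<Rightarrow> real^'m) set) \<Rightarrow> real" where
  "particles_energy T f0 f k \<epsilon> \<delta> N p =
     (1 / real N) * (\<Sum>i=1..N. energy T (snd (p i))) +
     (1 / (\<epsilon> * (real N)\<^sup>2)) *
       (\<Sum>i=1..N. \<Sum>j=1..N.
          interaction_kernel k \<delta> (endpoint T f0 f (p i) - endpoint T f0 f (p j)))"

definition admissible_particles ::
  "real \<Rightarrow> (real^'m) set \<Rightarrow> (real^'d) set \<Rightarrow> nat \<Rightarrow>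
   (nat \<Rightarrow> (real^'d) \<times> (real \<Rightarrow> real^'m) set) \<Rightarrow> bool" where
  "admissible_particles T U \<Omega> N p \<longleftrightarrow> (\<forall>i\<in>{1..N}. p i \<in> \<Omega> \<times> controls T U)"

section \<open>Basic facts\<close>

lemma L2_eq_equiv: "equiv (L2_fun T) (L2_eq T)"
proof (rule equivI)
  show "L2_eq T \<subseteq> L2_fun T \<times> L2_fun T" "refl_on (L2_fun T) (L2_eq T)"
    by (simp_all add: L2_eq_def refl_on_def subset_eq)
  show "sym (L2_eq T)"
    unfolding L2_eq_def sym_def by (simp add: eq_commute)
  show "trans (L2_eq T)"
  proof (rule transI)
    fix u v w :: "real \<Rightarrow> 'b::euclidean_space"
    assume uv: "(u, v) \<in> L2_eq T" and vw: "(v, w) \<in> L2_eq T"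
    then have "AE t in lebesgue_on {0..T}. u t = v t" "AE t in lebesgue_on {0..T}. v t = w t"
      by (simp_all add: L2_eq_def)
    then have "AE t in lebesgue_on {0..T}. u t = w t" by eventually_elim simp
    with uv vw show "(u, w) \<in> L2_eq T" by (simp add: L2_eq_def)
  qed
qed

lemma rep_mem_L2:
  assumes "\<phi> \<in> L2 T"
  shows "rep \<phi> \<in> \<phi>" and "rep \<phi> \<in> L2_fun T"
proof -
  have ne: "\<phi> \<noteq> {}" and sub: "\<phi> \<subseteq> L2_fun T"
    using in_quotient_imp_non_empty[OF L2_eq_equiv] in_quotient_imp_subset[OF L2_eq_equiv]
      assms unfolding L2_def by metis+
  show "rep \<phi> \<in> \<phi>"
    using some_in_eq[of \<phi>] ne by (simp add: rep_def)
  with sub show "rep \<phi> \<in> L2_fun T" by (rule subsetD)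
qed

lemma topspace_weak_L2: "topspace (weak_L2 T) = L2 T"
proof -
  have "\<Union> {{\<phi> \<in> L2 T. L2_inner T \<phi> \<gamma> \<in> S} | \<gamma> S. \<gamma> \<in> L2 T \<and> open S} = L2 T"
    (is "\<Union> ?B = _")
  proof (rule equalityI; rule subsetI)
    fix \<phi> :: "(real \<Rightarrow> 'b) set" assume "\<phi> \<in> \<Union> ?B"
    then show "\<phi> \<in> L2 T" by blast
  next
    fix \<phi> :: "(real \<Rightarrow> 'b) set" assume \<phi>: "\<phi> \<in> L2 T"
    then have "{\<psi> \<in> L2 T. L2_inner T \<psi> \<phi> \<in> UNIV} \<in> ?B" using open_UNIV by blast
    moreover have "\<phi> \<in> {\<psi> \<in> L2 T. L2_inner T \<psi> \<phi> \<in> UNIV}" using \<phi> by simp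
    ultimately show "\<phi> \<in> \<Union> ?B" by (rule UnionI)
  qed
  then show ?thesis
    unfolding weak_L2_def by (simp only: topology_generated_by_topspace)
qed

lemma topspace_state_control_top:
  "topspace (state_control_top T U \<Omega>) = \<Omega> \<times> controls T U"
  by (auto simp: state_control_top_def topspace_weak_L2 controls_def)

lemma space_borel_of: "space (borel_of X) = topspace X"
  unfolding borel_of_def by (rule space_measure_of) (auto dest: openin_subset)

lemma borel_of_euclidean: "borel_of euclidean = borel"
  by (simp add: borel_of_def borel_def)

lemma emeasure_empirical:
  assumes "N \<ge> 1" and p: "\<And>i. i \<in> {1..N} \<Longrightarrow> p i \<in> topspace X"
    and A: "A \<in> sets (borel_of X)"
  shows "emeasure (empirical X N p) A
           = (\<Sum>i=1..N. emeasure (return (borel_of X) (p i)) A) / of_nat N"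
proof -
  have m: "p \<in> measurable (uniform_count_measure {1..N}) (borel_of X)"
    using p by (auto simp: measurable_def space_uniform_count_measure
        sets_uniform_count_measure space_borel_of)
  have "emeasure (empirical X N p) A
          = emeasure (uniform_count_measure {1..N}) {i\<in>{1..N}. p i \<in> A}"
    using emeasure_distr[OF m A]
    by (simp add: empirical_def space_uniform_count_measure vimage_def Int_def conj_commute)
  also have "\<dots> = of_nat (card {i\<in>{1..N}. p i \<in> A}) / of_nat N"
    using \<open>N \<ge> 1\<close>
    by (subst emeasure_uniform_count_measure)
       (auto simp: divide_ennreal ennreal_of_nat_eq_real_of_nat)
  also have "of_nat (card {i\<in>{1..N}. p i \<in> A})
               = (\<Sum>i=1..N. emeasure (return (borel_of X) (p i)) A)"
    using A by (simp add: indicator_def sum.If_cases Int_def)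
  finally show ?thesis .
qed

lemma interaction_kernel_diff:
  "interaction_kernel k \<delta> (x - z) =
     (\<integral>y. mollifier_scaled k \<delta> (y - x) * mollifier_scaled k \<delta> (y - z) \<partial>lborel)"
proof -
  let ?g = "\<lambda>y. mollifier_scaled k \<delta> (y - x) * mollifier_scaled k \<delta> (y - z)"
  have "interaction_kernel k \<delta> (x - z) = (\<integral>y. ?g (z + y) \<partial>lborel)"
    unfolding interaction_kernel_def by (simp add: algebra_simps)
  also have "\<dots> = (\<integral>y. ?g y \<partial>lborel)"
  proof (cases "?g \<in> borel_measurable borel")
    case True
    have "(\<integral>y. ?g y \<partial>lborel) = (\<integral>y. ?g y \<partial>distr lborel borel ((+) z))"
      by (simp add: lborel_distr_plus)
    also have "\<dots> = (\<integral>y. ?g (z + y) \<partial>lborel)"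
      using True by (subst integral_distr) simp_all
    finally show ?thesis by simp
  next
    case False
    have "(\<lambda>y. ?g (z + y)) \<notin> borel_measurable borel"
    proof
      assume "(\<lambda>y. ?g (z + y)) \<in> borel_measurable borel"
      then have "(\<lambda>y. (\<lambda>y. ?g (z + y)) (y - z)) \<in> borel_measurable borel"
        by (rule measurable_compose[rotated]) simp
      with False show False by simp
    qed
    with False have "\<not> integrable lborel ?g" "\<not> integrable lborel (\<lambda>y. ?g (z + y))"
      using borel_measurable_integrable by force+
    then show ?thesis by (simp add: not_integrable_integral_eq)
  qed
  finally show ?thesis .
qed

end

theory Submission imports Defs begin

text \<open>The product \<open>X = \<Omega> \<times> \<U>\<close>, with the weak topology on \<open>\<U>\<close>, is compact and metrizable:
  controls correspond to their primitives, which form a compact set of Lipschitz curves by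
  Arzela-Ascoli. Being metrizable, \<open>X\<close> is a continuous image of a compact set of reals, so
  Helly's theorem makes the probability measures on \<open>X\<close> narrowly sequentially compact, and
  Skorohod's theorem represents narrow limits by almost sure limits. The end-point map is
  continuous because the dynamics is affine in the control, and the control energy is lower
  semicontinuous, being convex.

  (i) Among the probability densities on the reachable set the uniform one has the least \<open>L\<^sup>2\<close>
  norm. Comparing \<open>\<P>\<^sub>\<epsilon>\<close> with a competitor of uniform end-point law, the bounded control energy
  shows that the end-point densities are almost minimal, hence converge to the uniform one; the
  same comparison bounds the limiting control energy.

  (ii) By \<open>\<integral> h\<^sup>2 = sup\<^sub>\<phi> (2 \<integral> h \<phi> - \<integral> \<phi>\<^sup>2)\<close> the penalization is a supremum of functionals which pass
  to the limit, and mollification does not increase the \<open>L\<^sup>2\<close> norm of a density.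

  (iii) Replacing one particle of an optimal configuration at a time gives, after averaging, an
  inequality that is affine in the law of the new particle: the first-order optimality condition
  of the convex functional \<open>\<E>\<^sub>\<epsilon>\<^sub>,\<^sub>\<delta>\<close>, up to an error of order \<open>1/N\<close>.\<close>

section \<open>Absolutely continuous curves\<close>

text \<open>Helly's and Skorohod's theorems concern measures on the real line. The surjection
  \<open>g\<close> from \<open>C\<close> onto \<open>X\<close> carries real measures to
  \<open>X\<close>; the way back is a Borel section that picks the least parameter in each fibre. A
  section of \<open>E \<circ> g\<close> also lifts every probability measure on the reachable set to
  one on \<open>X\<close>, which yields the competitor with uniform end-point law. Since
  \<open>U\<close> is bounded, all control energies lie below one constant \<open>K\<close>. In (i)
  this gives the excess of the squared density norm the rate \<open>\<epsilon> * K\<close>, so the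
  whole sequence of end-point laws converges although the measures on \<open>X\<close> converge only
  along a subsequence. In (iii) a direct comparison would need every competitor \<open>Q\<close> to
  be approximated by particle configurations. The optimality condition avoids this: it is integrated
  against \<open>Q\<close> itself, and the only error is the self-interaction
  \<open>K_\<delta>(0)\<close> of the exchanged particle. Solutions are specified by derivatives
  almost everywhere while all estimates use the integral equation, so both halves of the fundamental
  theorem for absolutely continuous curves come first.\<close>

lemma indefinite_integral_has_vector_derivative_AE:
  fixes g :: "real \<Rightarrow> 'a::euclidean_space"
  assumes g: "g integrable_on {a..b}"
  shows "AE t in lebesgue_on {a..b}.
    ((\<lambda>t. integral {a..t} g) has_vector_derivative g t) (at t within {a..b})"
proof -
  \<comment> \<open>Extension by zero gives a meaning to the averages near the ends of
    \<open>{a..b}\<close>, where the averaging interval may leave it.\<close>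
  define f where "f \<equiv> \<lambda>t. if t \<in> {a..b} then g t else 0"
  have "f integrable_on UNIV"
    using g unfolding f_def by (subst integrable_restrict_UNIV)
  then have fI: "f integrable_on {c..d}" for c d
    by (metis box_real(2) integrable_on_subcbox subset_UNIV)
  \<comment> \<open>\<open>integrable_ccontinuous_explicit\<close> controls averages to the right of
    a point; applied to the reflected function it controls those to the left.\<close>
  then have fI': "(\<lambda>x. f (- x)) integrable_on {c..d}" for c d
    using Henstock_Kurzweil_Integration.integrable_reflect_real[where f = f and a = "- d" and b = "- c"] fI by simp
  obtain N1 where N1: "negligible N1"
    "\<And>x e. \<lbrakk>x \<notin> N1; 0 < e\<rbrakk> \<Longrightarrow> \<exists>d>0. \<forall>h. 0 < h \<and> h < d \<longrightarrow>
        norm (integral {x..x + h} f /\<^sub>R h - f x) < e"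
    using integrable_ccontinuous_explicit[of f] fI by auto
  obtain N2 where N2: "negligible N2"
    "\<And>x e. \<lbrakk>x \<notin> N2; 0 < e\<rbrakk> \<Longrightarrow> \<exists>d>0. \<forall>h. 0 < h \<and> h < d \<longrightarrow>
        norm (integral {x..x + h} (\<lambda>x. f (- x)) /\<^sub>R h - f (- x)) < e"
    using integrable_ccontinuous_explicit[of "\<lambda>x. f (- x)"] fI' by auto
  define N where "N \<equiv> N1 \<union> uminus ` N2"
  have "negligible N"
    unfolding N_def by (intro negligible_Un N1 negligible_differentiable_image_negligible N2)
      (auto intro!: derivative_intros simp: differentiable_on_def)
  then have "AE t in lebesgue. t \<notin> N"
    by (simp add: AE_not_in negligible_iff_null_sets)
  then have "AE t in lebesgue_on {a..b}. t \<notin> N \<and> t \<in> {a..b}"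
    by (auto simp: AE_restrict_space_iff elim: eventually_mono)
  moreover have "((\<lambda>t. integral {a..t} g) has_vector_derivative g t) (at t within {a..b})"
    if t: "t \<notin> N" "t \<in> {a..b}" for t
  proof -
    have F: "integral {a..s} g = integral {a..s} f" if "s \<in> {a..b}" for s
      using that unfolding f_def by (intro integral_cong) auto
    have "((\<lambda>t. integral {a..t} f) has_vector_derivative f t) (at t within {a..b})"
      unfolding has_vector_derivative_def has_derivative_within_alt
    proof (intro conjI allI impI bounded_linear_scaleR_left)
      fix e :: real assume e: "e > 0"
      have "t \<notin> N1" "- t \<notin> N2"
        using t(1) by (auto simp: N_def image_iff)
      then obtain d1 d2 where d: "d1 > 0" "d2 > 0"
        and d1: "\<And>h. 0 < h \<and> h < d1 \<Longrightarrow> norm (integral {t..t + h} f /\<^sub>R h - f t) < e"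
        and d2: "\<And>h. 0 < h \<and> h < d2 \<Longrightarrow>
          norm (integral {- t..- t + h} (\<lambda>x. f (- x)) /\<^sub>R h - f t) < e"
        using N1(2)[of t e] N2(2)[of "-t" e] e by auto
      have scale: "norm (I - h *\<^sub>R c) \<le> e * h"
        if "norm (I /\<^sub>R h - c) < e" "h > 0" for I c :: 'a and h :: real
      proof -
        have "I - h *\<^sub>R c = h *\<^sub>R (I /\<^sub>R h - c)"
          using that by (simp add: algebra_simps)
        then have "norm (I - h *\<^sub>R c) = h * norm (I /\<^sub>R h - c)"
          using that by simp
        then show ?thesis using that by (simp add: mult.commute)
      qed
      show "\<exists>d>0. \<forall>y\<in>{a..b}. norm (y - t) < d \<longrightarrow>
          norm (integral {a..y} f - integral {a..t} f - (y - t) *\<^sub>R f t) \<le> e * norm (y - t)"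
      proof (intro exI[of _ "min d1 d2"] conjI ballI impI)
        fix y assume y: "y \<in> {a..b}" "norm (y - t) < min d1 d2"
        consider "y = t" | "y > t" | "y < t" by linarith
        then show "norm (integral {a..y} f - integral {a..t} f - (y - t) *\<^sub>R f t) \<le> e * norm (y - t)"
        proof cases
          case 2
          have "integral {a..y} f - integral {a..t} f = integral {t..y} f"
            using Henstock_Kurzweil_Integration.integral_combine[of a t y f] 2 t(2) fI by (simp add: algebra_simps)
          moreover have "norm (integral {t..t + (y - t)} f - (y - t) *\<^sub>R f t) \<le> e * (y - t)"
            using 2 y by (intro scale d1) auto
          ultimately show ?thesis using 2 by simp
        next
          case 3
          have "integral {a..t} f - integral {a..y} f = integral {y..t} f"
            using Henstock_Kurzweil_Integration.integral_combine[of a y t f] 3 y(1) fI by (simp add: algebra_simps)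
          moreover have "integral {y..t} f = integral {- t..- y} (\<lambda>x. f (- x))"
            using Henstock_Kurzweil_Integration.integral_reflect_real[of t y f] by simp
          moreover have "norm (integral {- t..- t + (t - y)} (\<lambda>x. f (- x)) - (t - y) *\<^sub>R f t) \<le> e * (t - y)"
            using 3 y by (intro scale d2) auto
          moreover have "- t + (t - y) = - y" by simp
          ultimately have *: "norm (integral {a..t} f - integral {a..y} f - (t - y) *\<^sub>R f t) \<le> e * (t - y)"
            by metis
          have "integral {a..y} f - integral {a..t} f - (y - t) *\<^sub>R f t
            = - (integral {a..t} f - integral {a..y} f - (t - y) *\<^sub>R f t)"
            by (simp add: algebra_simps)
          with * 3 show ?thesis by (simp only: norm_minus_cancel) simp
        qed simp
      qed (use d in simp)
    qed
    then have "((\<lambda>t. integral {a..t} g) has_vector_derivative f t) (at t within {a..b})"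
      by (rule has_vector_derivative_transform[rotated 2]) (use t F in auto)
    then show ?thesis using t(2) by (simp add: f_def)
  qed
  ultimately show ?thesis
    by (auto elim: eventually_mono)
qed

lemma abs_cont_on_Lipschitz:
  fixes x :: "real \<Rightarrow> 'a::real_normed_vector"
  assumes "\<And>s t. \<lbrakk>a \<le> s; s \<le> t; t \<le> b\<rbrakk> \<Longrightarrow> norm (x t - x s) \<le> B * (t - s)"
  shows "abs_cont_on a b x"
  unfolding abs_cont_on_def
proof (intro allI impI)
  fix e :: real assume e: "e > 0"
  \<comment> \<open>\<open>B\<close> may be zero, and the threshold \<open>e / C\<close> needs a
    positive divisor.\<close>
  define C where "C = \<bar>B\<bar> + 1"
  have C: "C > 0" "B \<le> C" by (auto simp: C_def)
  show "\<exists>d>0. \<forall>(n::nat) s t. (\<forall>i<n. a \<le> s i \<and> s i \<le> t i \<and> t i \<le> b) \<and>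
        disjoint_family_on (\<lambda>i. {s i<..<t i}) {..<n} \<and> (\<Sum>i<n. t i - s i) < d \<longrightarrow>
        (\<Sum>i<n. norm (x (t i) - x (s i))) < e"
  proof (intro exI[of _ "e / C"] conjI allI impI)
    fix n :: nat and s t
    assume *: "(\<forall>i<n. a \<le> s i \<and> s i \<le> t i \<and> t i \<le> b) \<and>
        disjoint_family_on (\<lambda>i. {s i<..<t i}) {..<n} \<and> (\<Sum>i<n. t i - s i) < e / C"
    have "(\<Sum>i<n. norm (x (t i) - x (s i))) \<le> (\<Sum>i<n. C * (t i - s i))"
    proof (rule sum_mono)
      fix i assume "i \<in> {..<n}"
      with * have i: "a \<le> s i" "s i \<le> t i" "t i \<le> b" by auto
      then have "norm (x (t i) - x (s i)) \<le> B * (t i - s i)" by (rule assms)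
      also have "\<dots> \<le> C * (t i - s i)" using i C by (intro mult_right_mono) auto
      finally show "norm (x (t i) - x (s i)) \<le> C * (t i - s i)" .
    qed
    also have "\<dots> = C * (\<Sum>i<n. t i - s i)" by (simp add: sum_distrib_left)
    also have "\<dots> < e" using * C by (simp add: field_simps)
    finally show "(\<Sum>i<n. norm (x (t i) - x (s i))) < e" .
  qed (use e C in auto)
qed

text \<open>Tags outside the exceptional set are treated with the derivative; the intervals
  tagged by exceptional points lie in an open set of small measure, where absolute continuity
  bounds the total increment.\<close>

lemma abs_cont_on_has_integral:
  fixes x :: "real \<Rightarrow> 'a::euclidean_space"
  assumes ac: "abs_cont_on a b x" and ab: "a \<le> b"
    and der: "AE t in lebesgue_on {a..b}. (x has_vector_derivative g t) (at t within {a..b})"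
  shows "(g has_integral (x b - x a)) {a..b}"
proof -
  define N where "N = {t \<in> {a..b}. \<not> (x has_vector_derivative g t) (at t within {a..b})}"
  have "AE t in lebesgue. t \<in> {a..b} \<longrightarrow> (x has_vector_derivative g t) (at t within {a..b})"
    using der by (simp add: AE_restrict_space_iff)
  then have "AE t in lebesgue. t \<notin> N"
    by eventually_elim (auto simp: N_def)
  then have "N \<in> null_sets lebesgue"
    by (simp add: completion.null_sets_iff_AE)
  then have N: "negligible N" by (simp add: negligible_iff_null_sets)
  \<comment> \<open>With value zero on \<open>N\<close>, an interval with exceptional tag
    contributes its increment alone; a change on a null set does not affect the integral.\<close>
  define G where "G = (\<lambda>t. if t \<in> N then 0 else g t)"
  have "(G has_integral (x b - x a)) (cbox a b)"
    unfolding has_integral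
  proof (intro allI impI)
    fix e :: real assume e: "e > 0"
    \<comment> \<open>The \<open>+ 1\<close> keeps the divisor positive when \<open>a = b\<close>;
      all intervals with good tags together then cost less than \<open>e / 2\<close>.\<close>
    define e' where "e' = e / (2 * (b - a + 1))"
    have e': "e' > 0" "e' * (b - a) < e / 2"
      using e ab by (auto simp: e'_def field_simps)
    obtain d where d: "d > 0" and acd: "\<forall>(n::nat) s t. (\<forall>i<n. a \<le> s i \<and> s i \<le> t i \<and> t i \<le> b) \<and>
        disjoint_family_on (\<lambda>i. {s i<..<t i}) {..<n} \<and> (\<Sum>i<n. t i - s i) < d
        \<longrightarrow> (\<Sum>i<n. norm (x (t i) - x (s i))) < e / 2"
      using ac[unfolded abs_cont_on_def, THEN spec, of "e / 2"] e by auto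
    obtain V where V: "open V" "N \<subseteq> V" "V \<in> lmeasurable" "measure lebesgue V < d"
      
    proof -
      obtain V where V: "open V" "N \<subseteq> V" "V - N \<in> lmeasurable" "emeasure lebesgue (V - N) < ennreal d"
        using sets_lebesgue_outer_open[OF fmeasurableD[OF negligible_imp_measurable[OF N]] d] .
      have *: "measure lebesgue (V - N) < d"
        using V(4) d using fmeasurableD2[OF V(3)] by (simp add: emeasure_eq_ennreal_measure ennreal_less_iff top.not_eq_extremum)
      have VN: "V = (V - N) \<union> N" using V by auto
      then have "V \<in> lmeasurable"
        using V(3) negligible_imp_measurable[OF N] fmeasurable.Un by metis
      moreover have "measure lebesgue V \<le> measure lebesgue (V - N) + measure lebesgue N"
        using VN measure_Un_le[of "V - N" lebesgue N] V(3) negligible_imp_measurable[OF N] by auto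
      ultimately show ?thesis
        using that V * negligible_imp_measure0[OF N] by auto
    qed
    have "\<exists>\<delta>>0. \<forall>y\<in>{a..b}. norm (y - t) < \<delta> \<longrightarrow>
        norm (x y - x t - (y - t) *\<^sub>R g t) \<le> e' * norm (y - t)" if "t \<in> {a..b} - N" for t
      using that e'(1) unfolding N_def has_vector_derivative_def has_derivative_within_alt by auto
    then obtain \<delta> where \<delta>: "\<And>t. t \<in> {a..b} - N \<Longrightarrow> \<delta> t > 0"
      "\<And>t y. \<lbrakk>t \<in> {a..b} - N; y \<in> {a..b}; norm (y - t) < \<delta> t\<rbrakk> \<Longrightarrow>
        norm (x y - x t - (y - t) *\<^sub>R g t) \<le> e' * norm (y - t)"
      by metis
    define \<gamma> where "\<gamma> = (\<lambda>t. if t \<in> N then V else if t \<in> {a..b} then ball t (\<delta> t) else UNIV)"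
    have gauge: "gauge \<gamma>"
      unfolding gauge_def \<gamma>_def using V \<delta> by (auto simp: subset_iff)
    have fine: "norm ((\<Sum>(t, k)\<in>p. measure lborel k *\<^sub>R G t) - (x b - x a)) < e"
      if p: "p tagged_division_of cbox a b" "\<gamma> fine p" for p
    proof -
      note pD = tagged_division_ofD[OF p(1)]
      have fin: "finite p" by (rule pD)
      have k: "\<exists>u v. k = {u..v} \<and> a \<le> u \<and> u \<le> t \<and> t \<le> v \<and> v \<le> b \<and> Inf k = u \<and> Sup k = v
          \<and> measure lborel k = v - u \<and> k \<subseteq> \<gamma> t" if tk: "(t, k) \<in> p" for t k
      proof -
        obtain u v where uv: "k = cbox u v" using pD(4)[OF tk] by auto
        have "t \<in> k" "k \<subseteq> {a..b}" using pD(2,3)[OF tk] by auto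
        moreover have "k \<subseteq> \<gamma> t" using p(2) tk by (auto simp: fine_def)
        ultimately show ?thesis using uv by (intro exI[of _ u] exI[of _ v]) (auto simp: subset_iff)
      qed
      define p1 where "p1 = {q \<in> p. fst q \<notin> N}"
      define p2 where "p2 = {q \<in> p. fst q \<in> N}"
      have pp: "p = p1 \<union> p2" "p1 \<inter> p2 = {}" "finite p1" "finite p2"
        using fin by (auto simp: p1_def p2_def)
      define D where "D = (\<lambda>k. x (Sup k) - x (Inf k))"
      have "(\<Sum>(t, k)\<in>p. D k) = x b - x a"
        unfolding D_def using additive_tagged_division_1[OF ab, of p x] p(1) by simp
      then have "(\<Sum>(t, k)\<in>p. measure lborel k *\<^sub>R G t) - (x b - x a)
          = (\<Sum>(t, k)\<in>p. measure lborel k *\<^sub>R G t - D k)"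
        by (simp add: sum_subtractf case_prod_beta)
      also have "\<dots> = (\<Sum>(t, k)\<in>p1. measure lborel k *\<^sub>R G t - D k) + (\<Sum>(t, k)\<in>p2. measure lborel k *\<^sub>R G t - D k)"
        using pp by (metis (no_types, lifting) sum.union_disjoint)
      also have "norm \<dots> \<le> (\<Sum>(t, k)\<in>p1. norm (measure lborel k *\<^sub>R G t - D k))
          + (\<Sum>(t, k)\<in>p2. norm (measure lborel k *\<^sub>R G t - D k))"
        by (rule order.trans[OF norm_triangle_ineq add_mono]; rule order.trans[OF norm_sum])
          (simp_all add: case_prod_beta)
      also have "(\<Sum>(t, k)\<in>p1. norm (measure lborel k *\<^sub>R G t - D k)) \<le> (\<Sum>(t, k)\<in>p1. e' * measure lborel k)"
      proof (rule sum_mono, clarify)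
        fix t k assume tk: "(t, k) \<in> p1"
        then have tN: "t \<notin> N" and "(t, k) \<in> p" by (auto simp: p1_def)
        from k[OF this(2)] obtain u v where uv: "k = {u..v}" "a \<le> u" "u \<le> t" "t \<le> v" "v \<le> b"
          "Inf k = u" "Sup k = v" "measure lborel k = v - u" "k \<subseteq> \<gamma> t" by blast
        have t: "t \<in> {a..b} - N" using uv tN by auto
        have "u \<in> ball t (\<delta> t)" "v \<in> ball t (\<delta> t)"
          using uv t unfolding \<gamma>_def by (auto simp: subset_iff)
        then have "norm (x u - x t - (u - t) *\<^sub>R g t) \<le> e' * norm (u - t)"
          "norm (x v - x t - (v - t) *\<^sub>R g t) \<le> e' * norm (v - t)"
          using \<delta>(2)[OF t, of u] \<delta>(2)[OF t, of v] uv
          by (auto simp: dist_norm norm_minus_commute abs_minus_commute)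
        then have "norm ((x v - x t - (v - t) *\<^sub>R g t) - (x u - x t - (u - t) *\<^sub>R g t)) \<le> e' * (v - u)"
          using norm_triangle_ineq4[of "x v - x t - (v - t) *\<^sub>R g t" "x u - x t - (u - t) *\<^sub>R g t"] uv
          by (simp add: algebra_simps)
        moreover have "measure lborel k *\<^sub>R G t - D k
          = - ((x v - x t - (v - t) *\<^sub>R g t) - (x u - x t - (u - t) *\<^sub>R g t))"
          using uv tN by (simp add: G_def D_def algebra_simps)
        ultimately show "norm (measure lborel k *\<^sub>R G t - D k) \<le> e' * measure lborel k"
          using uv(8) by (simp only: norm_minus_cancel)
      qed
      also have "\<dots> \<le> (\<Sum>(t, k)\<in>p. e' * measure lborel k)"
        using pp e' by (intro sum_mono2) (auto simp: fin)
      also have "\<dots> = e' * (b - a)"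
        using additive_content_tagged_division[OF p(1)] ab
        by (simp add: case_prod_beta flip: sum_distrib_left)
      also have "\<dots> < e / 2" by (rule e')
      also have "(\<Sum>(t, k)\<in>p2. norm (measure lborel k *\<^sub>R G t - D k)) = (\<Sum>(t, k)\<in>p2. norm (D k))"
        by (intro sum.cong) (auto simp: p2_def G_def)
      also have "\<dots> < e / 2"
      proof -
        \<comment> \<open>Absolute continuity is stated for families indexed by
          \<open>i < n\<close>, so the exceptional intervals are enumerated. Their interiors are
          disjoint and lie in \<open>V\<close>, hence their total length is below
          \<open>d\<close>.\<close>
        obtain h where h: "bij_betw h {..<card p2} p2"
          using ex_bij_betw_nat_finite[OF pp(4)] by (metis atLeast0LessThan)
        define s where "s = (\<lambda>i. Inf (snd (h i)))"
        define u where "u = (\<lambda>i. Sup (snd (h i)))"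
        have hi: "h i \<in> p2" if "i < card p2" for i
          using h that by (auto simp: bij_betw_def)
        have su: "a \<le> s i \<and> s i \<le> u i \<and> u i \<le> b \<and> snd (h i) = {s i..u i} \<and> {s i..u i} \<subseteq> V"
          if "i < card p2" for i
        proof -
          obtain t k' where tk: "h i = (t, k')" by (cases "h i")
          with hi[OF that] have "(t, k') \<in> p" "t \<in> N" by (auto simp: p2_def)
          with k[OF this(1)] tk show ?thesis
            by (auto simp: s_def u_def \<gamma>_def)
        qed
        have disj: "disjoint_family_on (\<lambda>i. {s i<..<u i}) {..<card p2}"
          unfolding disjoint_family_on_def
        proof (intro ballI impI)
          fix i j assume ij: "i \<in> {..<card p2}" "j \<in> {..<card p2}" "i \<noteq> j"
          then have "h i \<noteq> h j" using h by (auto simp: bij_betw_def inj_on_def)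
          moreover have "h i \<in> p" "h j \<in> p" using hi ij by (auto simp: p2_def)
          ultimately have "interior (snd (h i)) \<inter> interior (snd (h j)) = {}"
            using pD(5)[of "fst (h i)" "snd (h i)" "fst (h j)" "snd (h j)"] by (metis prod.collapse)
          then show "{s i<..<u i} \<inter> {s j<..<u j} = {}"
            using su ij by (simp add: interior_atLeastAtMost_real)
        qed
        have "(\<Sum>i<card p2. u i - s i) = (\<Sum>i<card p2. measure lebesgue {s i<..<u i})"
          using su by (intro sum.cong) auto
        also have "\<dots> = measure lebesgue (\<Union>i<card p2. {s i<..<u i})"
          using disj su by (intro measure_finite_Union[symmetric]) auto
        also have "\<dots> \<le> measure lebesgue V"
        proof (rule measure_mono_fmeasurable)
          show "(\<Union>i<card p2. {s i<..<u i}) \<subseteq> V" using su by fastforce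
        qed (use V in auto)
        finally have "(\<Sum>i<card p2. u i - s i) < d" using V by simp
        with acd disj su have "(\<Sum>i<card p2. norm (x (u i) - x (s i))) < e / 2" by blast
        also have "(\<Sum>i<card p2. norm (x (u i) - x (s i))) = (\<Sum>i<card p2. norm (D (snd (h i))))"
          by (simp add: D_def s_def u_def)
        also have "\<dots> = (\<Sum>q\<in>p2. norm (D (snd q)))"
          using sum.reindex_bij_betw[OF h, of "\<lambda>q. norm (D (snd q))"] by simp
        finally show ?thesis by (simp add: case_prod_beta)
      qed
      finally show ?thesis by simp
    qed
    show "\<exists>\<gamma>. gauge \<gamma> \<and> (\<forall>p. p tagged_division_of cbox a b \<and> \<gamma> fine p \<longrightarrow>
        norm ((\<Sum>(t, k)\<in>p. measure lborel k *\<^sub>R G t) - (x b - x a)) < e)"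
      by (intro exI[of _ \<gamma>] conjI allI impI gauge; elim conjE; rule fine)
  qed
  then have "(G has_integral (x b - x a)) {a..b}" by simp
  then show ?thesis
    by (rule has_integral_spike[OF N, rotated]) (auto simp: G_def)
qed

text \<open>The difference \<open>exp (- (L * t)) * integral {0..t} h - integral {0..t} r\<close>
  vanishes at 0 and has nonpositive derivative. The bound is for the integral of \<open>h\<close> in
  terms of the integral of \<open>r\<close>, because the errors \<open>r\<close> of the stability
  estimate are shown to vanish pointwise and in mean only.\<close>

lemma gronwall_integral:
  fixes h r :: "real \<Rightarrow> real"
  assumes h: "continuous_on {0..T} h" and r: "continuous_on {0..T} r" and L: "L \<ge> 0"
    and r0: "\<And>t. t \<in> {0..T} \<Longrightarrow> 0 \<le> r t"
    and le: "\<And>t. t \<in> {0..T} \<Longrightarrow> h t \<le> r t + L * integral {0..t} h"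
    and t: "t \<in> {0..T}"
  shows "integral {0..t} h \<le> exp (L * t) * integral {0..t} r"
proof -
  define \<Phi> where "\<Phi> = (\<lambda>t. exp (- (L * t)) * integral {0..t} h - integral {0..t} r)"
  have der: "(\<Phi> has_real_derivative (exp (- (L * s)) * (h s - L * integral {0..s} h) - r s))
      (at s within {0..T})" if "s \<in> {0..T}" for s
    unfolding \<Phi>_def
    by (rule derivative_eq_intros integral_has_real_derivative[OF h that]
        integral_has_real_derivative[OF r that] refl)+ (simp add: algebra_simps)
  have "\<Phi> t \<le> \<Phi> 0"
  proof (rule DERIV_nonpos_imp_decreasing_open[of 0 t])
    show "0 \<le> t" using t by simp
    fix s assume s: "0 < s" "s < t"
    then have sT: "s \<in> {0..T}" using t by auto
    have "(\<Phi> has_real_derivative (exp (- (L * s)) * (h s - L * integral {0..s} h) - r s)) (at s)"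
      using der[OF sT] s t by (simp add: at_within_Icc_at)
    moreover have "exp (- (L * s)) * (h s - L * integral {0..s} h) - r s \<le> 0"
    proof -
      have "exp (- (L * s)) * (h s - L * integral {0..s} h) \<le> exp (- (L * s)) * r s"
        using le[OF sT] by (intro mult_left_mono) auto
      also have "\<dots> \<le> 1 * r s" using L s r0[OF sT] by (intro mult_right_mono) auto
      finally show ?thesis by simp
    qed
    ultimately show "\<exists>y. (\<Phi> has_real_derivative y) (at s) \<and> y \<le> 0" by blast
  next
    show "continuous_on {0..t} \<Phi>"
      by (rule continuous_on_subset[of "{0..T}"], rule DERIV_continuous_on, rule der) (use t in auto)
  qed
  then have "exp (L * t) * (exp (- (L * t)) * integral {0..t} h) \<le> exp (L * t) * integral {0..t} r"
    by (intro mult_left_mono) (auto simp: \<Phi>_def)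
  then show ?thesis by (simp add: mult.assoc[symmetric] exp_minus_inverse)
qed

section \<open>Densities of Lipschitz curves\<close>

text \<open>For a strictly increasing bi-Lipschitz \<open>F\<close>, the push-forward of Lebesgue measure under
  the inverse of \<open>F\<close> is absolutely continuous, and its Radon-Nikodym density is \<open>F'\<close>.
  Adding a linear function reduces an arbitrary Lipschitz function to this case.\<close>

lemma Lipschitz_has_density_real:
  fixes y :: "real \<Rightarrow> real"
  assumes lip: "\<And>s t. \<bar>y t - y s\<bar> \<le> B * \<bar>t - s\<bar>"
  obtains g where "g \<in> borel_measurable borel" "\<And>a b. a \<le> b \<Longrightarrow> (g has_integral (y b - y a)) {a..b}"
proof -
  \<comment> \<open>Slope \<open>B\<close> makes the sum nondecreasing; the additional 1 makes it
    grow at least as fast as \<open>t\<close>, so that it is a bijection of the line.\<close>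
  define F where "F = (\<lambda>t. y t + (B + 1) * t)"
  have F_diff: "F t - F s \<ge> t - s" if "s \<le> t" for s t
  proof -
    have "\<bar>y t - y s\<bar> \<le> B * (t - s)" using lip[of t s] that by simp
    then show ?thesis by (simp add: F_def algebra_simps abs_le_iff)
  qed
  have F_mono: "s < t \<Longrightarrow> F s < F t" for s t using F_diff[of s t] by simp
  have F_less: "F s \<le> F t \<longleftrightarrow> s \<le> t" for s t
    using F_mono[of s t] F_mono[of t s] by (cases s t rule: linorder_cases) auto
  have F_lip: "norm (F t - F s) \<le> (\<bar>B\<bar> + \<bar>B + 1\<bar>) * norm (t - s)" for s t
  proof -
    have "F t - F s = (y t - y s) + (B + 1) * (t - s)" by (simp add: F_def algebra_simps)
    then have "\<bar>F t - F s\<bar> \<le> \<bar>y t - y s\<bar> + \<bar>B + 1\<bar> * \<bar>t - s\<bar>"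
      using abs_triangle_ineq[of "y t - y s" "(B + 1) * (t - s)"] by (simp add: abs_mult)
    moreover have "B * \<bar>t - s\<bar> \<le> \<bar>B\<bar> * \<bar>t - s\<bar>" by (intro mult_right_mono) auto
    ultimately show ?thesis using lip[of t s] by (simp add: algebra_simps)
  qed
  have F_cont: "continuous_on S F" for S
    by (rule lipschitz_on_continuous_on[where L = "\<bar>B\<bar> + \<bar>B + 1\<bar>"], rule lipschitz_onI)
      (use F_lip in \<open>auto simp: dist_norm\<close>)
  have "surj F"
    unfolding surj_def
  proof
    fix z
    define r where "r = \<bar>z - F 0\<bar>"
    have "F (- r) \<le> z" "z \<le> F r"
      using F_diff[of "- r" 0] F_diff[of 0 r] by (auto simp: r_def)
    then show "\<exists>t. z = F t"
      using IVT'[of F "- r" z r] F_cont by (auto simp: r_def)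
  qed
  moreover have "inj F" using F_mono by (metis injI linorder_neqE order_less_irrefl)
  ultimately have bij: "bij F" by (simp add: bij_def)
  define G where "G = inv F"
  have GF: "G (F t) = t" and FG: "F (G z) = z" for t z
    using bij by (simp_all add: G_def bij_is_inj bij_is_surj surj_f_inv_f)
  \<comment> \<open>Preimages under the inverse are images under \<open>F\<close>, so the
    push-forward measures an interval by the increment of \<open>F\<close> over it.\<close>
  have vim: "G -` A = F ` A" for A by (auto simp: GF) (metis FG imageI)
  have G_mono: "mono G" by (rule monoI) (metis F_less FG)
  have G_meas: "G \<in> borel_measurable borel" using G_mono by (rule borel_measurable_mono)
  define M where "M = distr lborel borel G"
  have M_eq: "emeasure M A = emeasure lborel (F ` A)" if "A \<in> sets borel" for A
    unfolding M_def using that G_meas vim[of A] by (subst emeasure_distr) auto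
  have "absolutely_continuous lborel M"
    unfolding absolutely_continuous_def
  proof
    fix A :: "real set" assume A: "A \<in> null_sets lborel"
    then have "negligible A" by (simp add: negligible_iff_null_sets null_sets_completionI)
    then have "negligible (F ` A)"
      using F_lip by (intro negligible_locally_Lipschitz_image) auto
    moreover have Ab: "A \<in> sets borel" using A by auto
    moreover have "F ` A \<in> sets borel"
      using measurable_sets[OF G_meas Ab] by (simp add: vim)
    ultimately have "F ` A \<in> null_sets lborel"
      by (simp add: negligible_iff_null_sets null_sets_completion_iff)
    with Ab show "A \<in> null_sets M" using M_eq[OF Ab] by (auto simp: M_def null_sets_def)
  qed
  moreover have "sets M = sets lborel" by (simp add: M_def)
  ultimately obtain g0 where g0: "g0 \<in> borel_measurable lborel" "density lborel g0 = M"
    using sigma_finite_measure.Radon_Nikodym[OF sigma_finite_lborel] by blast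
  have int_g0: "(\<integral>\<^sup>+t. g0 t * indicator {a..b} t \<partial>lborel) = ennreal (F b - F a)" if "a \<le> b" for a b
  proof -
    have "F ` {a..b} = {F a..F b}"
    proof (intro equalityI subsetI)
      fix z assume "z \<in> {F a..F b}"
      then have "G z \<in> {a..b}" using F_less[of a "G z"] F_less[of "G z" b] FG by auto
      then show "z \<in> F ` {a..b}" by (metis FG imageI)
    qed (use F_less in auto)
    moreover have "emeasure M {a..b} = (\<integral>\<^sup>+t. g0 t * indicator {a..b} t \<partial>lborel)"
      unfolding g0(2)[symmetric] using g0(1) by (subst emeasure_density) auto
    ultimately show ?thesis
      using M_eq[of "{a..b}"] that F_less[of a b] by simp
  qed
  have fin: "AE t in lborel. g0 t \<noteq> \<infinity>"
  proof -
    have "AE t in lborel. g0 t * indicator {- real n..real n} t \<noteq> \<infinity>" for n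
      using int_g0[of "- real n" "real n"] g0(1) by (intro nn_integral_PInf_AE) auto
    then have "AE t in lborel. \<forall>n. g0 t * indicator {- real n..real n} t \<noteq> \<infinity>"
      by (simp add: AE_all_countable)
    then show ?thesis
    proof eventually_elim
      fix t assume *: "\<forall>n. g0 t * indicator {- real n..real n} t \<noteq> \<infinity>"
      obtain n where "\<bar>t\<bar> \<le> real n" using real_arch_simple by blast
      with *[rule_format, of n] show "g0 t \<noteq> \<infinity>" by (auto simp: abs_le_iff indicator_def split: if_splits)
    qed
  qed
  \<comment> \<open>Removes the linear term that was added to \<open>y\<close>.\<close>
  define g where "g = (\<lambda>t. enn2real (g0 t) - (B + 1))"
  have gm: "g \<in> borel_measurable borel" using g0(1) by (simp add: g_def)
  moreover have "(g has_integral (y b - y a)) {a..b}" if ab: "a \<le> b" for a b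
  proof -
    have "(\<integral>\<^sup>+t. ennreal (indicator {a..b} t * enn2real (g0 t)) \<partial>lborel) = (\<integral>\<^sup>+t. g0 t * indicator {a..b} t \<partial>lborel)"
      using fin by (intro nn_integral_cong_AE, eventually_elim)
        (auto simp: indicator_def top.not_eq_extremum)
    also have "\<dots> = ennreal (F b - F a)" by (rule int_g0[OF ab])
    finally have "((\<lambda>t. indicator {a..b} t * enn2real (g0 t)) has_integral (F b - F a)) UNIV"
      using ab F_less[of a b] g0(1) by (intro nn_integral_has_integral) auto
    moreover have "(\<lambda>t. indicator {a..b} t * enn2real (g0 t)) = (\<lambda>t. if t \<in> {a..b} then enn2real (g0 t) else 0)"
      by auto
    ultimately have "((\<lambda>t. enn2real (g0 t)) has_integral (F b - F a)) {a..b}"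
      by (simp only: has_integral_restrict_UNIV)
    from has_integral_diff[OF this has_integral_const_real[of "B + 1" a b]]
    have "(g has_integral ((F b - F a) - (b - a) * (B + 1))) {a..b}"
      using ab by (simp add: g_def)
    moreover have "(F b - F a) - (b - a) * (B + 1) = y b - y a" by (simp add: F_def algebra_simps)
    ultimately show ?thesis by simp
  qed
  ultimately show ?thesis by (rule that)
qed

lemma Lipschitz_has_density:
  fixes y :: "real \<Rightarrow> 'a::euclidean_space"
  assumes lip: "\<And>s t. norm (y t - y s) \<le> B * \<bar>t - s\<bar>"
  obtains g where "g \<in> borel_measurable borel" "\<And>a b. a \<le> b \<Longrightarrow> (g has_integral (y b - y a)) {a..b}"
proof -
  have "\<exists>g\<in>borel_measurable borel. \<forall>a c. a \<le> c \<longrightarrow> (g has_integral (y c \<bullet> b - y a \<bullet> b)) {a..c}"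
    if b: "b \<in> Basis" for b
  proof -
    have "\<bar>y t \<bullet> b - y s \<bullet> b\<bar> \<le> B * \<bar>t - s\<bar>" for s t
      using order.trans[OF Basis_le_norm[OF b] lip] by (simp add: inner_diff_left)
    from Lipschitz_has_density_real[OF this] show ?thesis by metis
  qed
  then obtain h where h: "\<And>b. b \<in> Basis \<Longrightarrow> h b \<in> borel_measurable borel"
    "\<And>b a c. \<lbrakk>b \<in> Basis; a \<le> c\<rbrakk> \<Longrightarrow> (h b has_integral (y c \<bullet> b - y a \<bullet> b)) {a..c}"
    by metis
  define g where "g = (\<lambda>t. \<Sum>b\<in>Basis. h b t *\<^sub>R b)"
  have "g \<in> borel_measurable borel"
    unfolding g_def using h(1) by (intro borel_measurable_sum borel_measurable_scaleR) auto
  moreover have "(g has_integral (y c - y a)) {a..c}" if "a \<le> c" for a c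
    by (subst has_integral_componentwise_iff)
      (use that h(2) in \<open>auto simp: g_def inner_sum_left_Basis inner_diff_left\<close>)
  ultimately show ?thesis by (rule that)
qed

text \<open>Otherwise a hyperplane strictly separates the average from \<open>S\<close>, and
  integrating the strict inequality over the values of \<open>g\<close> contradicts this.\<close>

lemma average_in_closed_convex:
  fixes g :: "real \<Rightarrow> 'a::euclidean_space"
  assumes S: "closed S" "convex S" and g: "g integrable_on {a..b}" and ab: "a < b"
    and gS: "\<And>t. t \<in> {a..b} \<Longrightarrow> g t \<in> S"
  shows "integral {a..b} g /\<^sub>R (b - a) \<in> S"
proof (rule ccontr)
  assume "integral {a..b} g /\<^sub>R (b - a) \<notin> S"
  from separating_hyperplane_closed_point[OF S(2,1) this] obtain v c where
    vc: "v \<bullet> (integral {a..b} g /\<^sub>R (b - a)) < c" "\<And>x. x \<in> S \<Longrightarrow> c < v \<bullet> x" by blast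
  have int: "(\<lambda>t. v \<bullet> g t) integrable_on {a..b}"
    using integrable_component[of g "{a..b}"] integrable_linear[OF g bounded_linear_inner_right[of v]] by (simp add: o_def)
  have "c * (b - a) = integral {a..b} (\<lambda>_. c)" using ab by simp
  also have "\<dots> \<le> integral {a..b} (\<lambda>t. v \<bullet> g t)"
    using vc(2)[OF gS] int by (intro integral_le) (auto intro: less_imp_le integrable_const_ivl)
  also have "\<dots> = v \<bullet> integral {a..b} g"
    using integral_linear[OF g bounded_linear_inner_right[of v]] by (simp add: o_def)
  finally show False using vc(1) ab by (simp add: field_simps)
qed

text \<open>The derivative is a limit of difference quotients, all of which lie in the closed set
  \<open>S\<close>. It suffices to find one quotient closer to \<open>d\<close> than a ball that
  misses \<open>S\<close>.\<close>

lemma has_vector_derivative_in_closed: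
  fixes y :: "real \<Rightarrow> 'a::real_normed_vector"
  assumes der: "(y has_vector_derivative d) (at t within {a..b})" and t: "t \<in> {a..b}" and ab: "a < b"
    and S: "closed S" and q: "\<And>s t. \<lbrakk>a \<le> s; s < t; t \<le> b\<rbrakk> \<Longrightarrow> (y t - y s) /\<^sub>R (t - s) \<in> S"
  shows "d \<in> S"
proof (rule ccontr)
  assume "d \<notin> S"
  then obtain e where e: "e > 0" "\<And>x. dist x d < e \<Longrightarrow> x \<notin> S"
    using S by (metis open_Compl closed_def ComplI ComplD open_dist)
  have "\<exists>\<delta>>0. \<forall>s\<in>{a..b}. norm (s - t) < \<delta> \<longrightarrow> norm (y s - y t - (s - t) *\<^sub>R d) \<le> e / 2 * norm (s - t)"
    using der e(1) half_gt_zero unfolding has_vector_derivative_def has_derivative_within_alt by blast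
  then obtain \<delta> where \<delta>: "\<delta> > 0" "\<And>s. \<lbrakk>s \<in> {a..b}; norm (s - t) < \<delta>\<rbrakk> \<Longrightarrow>
      norm (y s - y t - (s - t) *\<^sub>R d) \<le> e / 2 * norm (s - t)" by blast
  \<comment> \<open>A point to the right of \<open>t\<close>, or to the left when
    \<open>t = b\<close>; \<open>min\<close> and \<open>max\<close> keep it inside the
    interval.\<close>
  define s where "s = (if t < b then min b (t + \<delta> / 2) else max a (t - \<delta> / 2))"
  have s: "s \<in> {a..b}" "norm (s - t) < \<delta>" "s \<noteq> t"
    using t ab \<delta>(1) by (auto simp: s_def min_def max_def)
  define w where "w = (y s - y t) /\<^sub>R (s - t)"
  have "w \<in> S"
  proof (cases "s < t")
    case True
    have "(y s - y t) /\<^sub>R (s - t) = (- (y t - y s)) /\<^sub>R (- (t - s))" by simp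
    also have "\<dots> = (y t - y s) /\<^sub>R (t - s)"
      by (simp only: inverse_minus_eq scaleR_minus_left scaleR_minus_right minus_minus)
    finally have "w = (y t - y s) /\<^sub>R (t - s)" by (simp only: w_def)
    then show ?thesis using q[of s t] True s t by simp
  next
    case False
    then show ?thesis using q[of t s] s t by (simp add: w_def)
  qed
  moreover have "dist w d < e"
  proof -
    have "w - d = (y s - y t - (s - t) *\<^sub>R d) /\<^sub>R (s - t)"
      using s(3) by (simp add: w_def scaleR_diff_right)
    then have "norm (w - d) = norm (y s - y t - (s - t) *\<^sub>R d) / norm (s - t)"
      by (simp add: divide_inverse mult.commute)
    also have "\<dots> \<le> e / 2" using \<delta>(2)[OF s(1,2)] s(3) by (simp add: field_simps)
    finally show ?thesis using e(1) by (simp add: dist_norm)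
  qed
  ultimately show False using e(2) by blast
qed

section \<open>Trajectories and the end-point map\<close>

text \<open>\<open>Ck 1\<close> supplies continuity of the partial derivatives, hence one bound per
  basis direction on the compact ball. Expanding a vector in the basis bounds the operator norm by
  their sum, and the mean value inequality applies on the convex ball.\<close>

lemma Ck_1_Lipschitz_on_cball:
  fixes g :: "'a::euclidean_space \<Rightarrow> 'b::euclidean_space"
  assumes "Ck 1 g"
  obtains L where "L \<ge> 0" "\<And>x y. \<lbrakk>x \<in> cball 0 R; y \<in> cball 0 R\<rbrakk> \<Longrightarrow> norm (g x - g y) \<le> L * norm (x - y)"
proof -
  let ?D = "\<lambda>x. frechet_derivative g (at x)"
  have diff: "g differentiable (at x)" for x using assms by simp
  have cont: "continuous_on UNIV (\<lambda>x. ?D x b)" if "b \<in> Basis" for b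
    using assms that by simp
  have "compact ((\<lambda>x. ?D x b) ` cball 0 R)" if "b \<in> Basis" for b
    using cont[OF that] by (intro compact_continuous_image) (auto intro: continuous_on_subset)
  then have "\<exists>B. \<forall>x\<in>cball 0 R. norm (?D x b) \<le> B" if "b \<in> Basis" for b
    using that by (meson compact_imp_bounded bounded_iff imageI)
  then obtain B where B: "\<And>b x. \<lbrakk>b \<in> Basis; x \<in> cball 0 R\<rbrakk> \<Longrightarrow> norm (?D x b) \<le> B b"
    by metis
  define L where "L = (\<Sum>b\<in>Basis. \<bar>B b\<bar>)"
  have "norm (g x - g y) \<le> L * norm (x - y)" if "x \<in> cball 0 R" "y \<in> cball 0 R" for x y
  proof (rule differentiable_bound[OF convex_cball[of 0 R] _ _ that])
    fix z :: 'a assume z: "z \<in> cball 0 R"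
    show "(g has_derivative ?D z) (at z within cball 0 R)"
      using diff frechet_derivative_works has_derivative_at_withinI by blast
    then have lin: "linear (?D z)" by (simp add: has_derivative_linear)
    show "onorm (?D z) \<le> L"
    proof (rule onorm_le)
      fix h
      have "?D z h = (\<Sum>b\<in>Basis. (h \<bullet> b) *\<^sub>R ?D z b)"
        using linear_sum[OF lin, of "\<lambda>b. (h \<bullet> b) *\<^sub>R b" Basis]
        by (simp add: euclidean_representation linear_scale[OF lin])
      also have "norm \<dots> \<le> (\<Sum>b\<in>Basis. \<bar>B b\<bar> * norm h)"
      proof (rule order.trans[OF norm_sum sum_mono])
        fix b :: 'a assume b: "b \<in> Basis"
        show "norm ((h \<bullet> b) *\<^sub>R ?D z b) \<le> \<bar>B b\<bar> * norm h"
          using mult_mono[OF Basis_le_norm[OF b, of h] order.trans[OF B[OF b z] abs_ge_self]]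
          by (simp add: mult.commute)
      qed
      finally show "norm (?D z h) \<le> L * norm h" by (simp add: L_def sum_distrib_right)
    qed
  qed
  moreover have "L \<ge> 0" by (simp add: L_def sum_nonneg)
  ultimately show ?thesis using that by blast
qed

text \<open>Gronwall's inequality for the norm. The bound depends on \<open>r\<close>,
  \<open>M\<close> and \<open>T\<close> alone, hence is uniform over initial points and controls.
  \<open>G\<close> is kept abstract so that the truncated dynamics of the existence proof is covered
  too.\<close>

lemma linear_growth_bound:
  fixes x G :: "real \<Rightarrow> 'a::euclidean_space"
  assumes x: "continuous_on {0..T} x" and G: "G integrable_on {0..T}"
    and eq: "\<And>t. t \<in> {0..T} \<Longrightarrow> x t = x0 + integral {0..t} G"
    and M: "M \<ge> 0" and bnd: "\<And>s. s \<in> {0..T} \<Longrightarrow> norm (G s) \<le> M * (1 + norm (x s))"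
    and x0: "norm x0 \<le> r" and t: "t \<in> {0..T}"
  shows "norm (x t) \<le> (r + M * T) + M * (exp (M * T) * ((r + M * T) * T))"
proof -
  have T: "0 \<le> T" and r: "0 \<le> r" using t norm_ge_zero[of x0] x0 by (auto simp del: norm_ge_zero)
  have h: "continuous_on {0..T} (\<lambda>s. norm (x s))" using x by (intro continuous_intros)
  then have hI: "(\<lambda>s. norm (x s)) integrable_on {0..s}" if "s \<in> {0..T}" for s
    using that by (intro integrable_continuous_interval) (auto intro: continuous_on_subset)
  have le: "norm (x s) \<le> (r + M * T) + M * integral {0..s} (\<lambda>s. norm (x s))" if s: "s \<in> {0..T}" for s
  proof -
    have "norm (integral {0..s} G) \<le> integral {0..s} (\<lambda>s. M * (1 + norm (x s)))"
      using s hI[OF s] integrable_on_subinterval[OF G, of 0 s]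
      by (intro integral_norm_bound_integral bnd integrable_on_mult_right integrable_add) auto
    also have "\<dots> = M * (s + integral {0..s} (\<lambda>s. norm (x s)))"
      using s Henstock_Kurzweil_Integration.integral_add[OF integrable_const_ivl[of 1 0 s] hI[OF s]] by simp
    also have "\<dots> \<le> M * T + M * integral {0..s} (\<lambda>s. norm (x s))"
      using s M by (simp add: distrib_left mult_left_mono)
    finally show ?thesis
      using eq[OF s] norm_triangle_ineq[of x0 "integral {0..s} G"] x0 by simp
  qed
  have "integral {0..t} (\<lambda>s. norm (x s)) \<le> exp (M * t) * integral {0..t} (\<lambda>_. r + M * T)"
    by (rule gronwall_integral[OF h _ M _ le t]) (use r M T in auto)
  also have "\<dots> \<le> exp (M * T) * ((r + M * T) * T)"
    using t r M T mult_right_mono[of t T "r + M * T"]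
    by (intro mult_mono) (auto simp: mult_left_mono mult.commute)
  finally have "M * integral {0..t} (\<lambda>s. norm (x s)) \<le> M * (exp (M * T) * ((r + M * T) * T))"
    using M by (rule mult_left_mono)
  with le[OF t] show ?thesis by linarith
qed

locale control_system =
  fixes T :: real
    and f0 :: "real^'d \<Rightarrow> real^'d"
    and f :: "'m::finite \<Rightarrow> real^'d \<Rightarrow> real^'d"
    and U :: "(real^'m) set"
    and \<Omega> :: "(real^'d) set"
  assumes T: "T > 0"
    and smooth: "Ck 1 f0" "\<And>i. Ck 1 (f i)"
    and growth: "\<exists>C>0. \<forall>x. norm (f0 x) \<le> C * (1 + norm x) \<and>
                             (\<forall>i. norm (f i x) \<le> C * (1 + norm x))"
    and Omega: "\<Omega> \<noteq> {}" "compact \<Omega>"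
    and U: "U \<noteq> {}" "compact U" "convex U"
begin

section \<open>Uniform bounds for the dynamics and its trajectories\<close>

definition field :: "real^'m \<Rightarrow> real^'d \<Rightarrow> real^'d" where
  "field v x = f0 x + (\<Sum>i\<in>UNIV. (v $ i) *\<^sub>R f i x)"

text \<open>Representatives with values in \<open>U\<close> at every time, not just almost every
  time, so that the bounds on the field hold pointwise.\<close>

definition admissible :: "(real \<Rightarrow> real^'m) \<Rightarrow> bool" where
  "admissible w \<longleftrightarrow> w \<in> borel_measurable (lebesgue_on {0..T}) \<and> (\<forall>t. w t \<in> U)"

text \<open>The Caratheodory form of the equation, which is stable under limits.\<close>

definition integral_solution :: "real^'d \<Rightarrow> (real \<Rightarrow> real^'m) \<Rightarrow> (real \<Rightarrow> real^'d) \<Rightarrow> bool" where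
  "integral_solution x0 w x \<longleftrightarrow> continuous_on {0..T} x \<and>
     (\<forall>t\<in>{0..T}. x t = x0 + integral {0..t} (\<lambda>s. field (w s) (x s)))"

lemma control_bound: obtains B where "B \<ge> 0" "\<And>v. v \<in> U \<Longrightarrow> norm v \<le> B"
  using compact_imp_bounded[OF U(2)] U(1) by (auto simp: bounded_iff) (meson norm_ge_zero order_trans)

lemma Omega_bound: obtains r where "\<And>x. x \<in> \<Omega> \<Longrightarrow> norm x \<le> r"
  using compact_imp_bounded[OF Omega(2)] by (auto simp: bounded_iff)

lemma f_continuous: "continuous_on S f0" "continuous_on S (f i)"
  using smooth differentiable_imp_continuous_within
  by (auto intro!: differentiable_imp_continuous_on simp: differentiable_on_def differentiable_at_withinI)

lemma field_growth: obtains M where "M > 0" "\<And>v x. v \<in> U \<Longrightarrow> norm (field v x) \<le> M * (1 + norm x)"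
proof -
  obtain C where C: "C > 0" "\<And>x. norm (f0 x) \<le> C * (1 + norm x)" "\<And>i x. norm (f i x) \<le> C * (1 + norm x)"
    using growth by blast
  obtain B where B: "B \<ge> 0" "\<And>v. v \<in> U \<Longrightarrow> norm v \<le> B" by (rule control_bound) blast
  have "norm (field v x) \<le> (C + real CARD('m) * (B * C)) * (1 + norm x)" if v: "v \<in> U" for v x
  proof -
    have "norm (field v x) \<le> norm (f0 x) + (\<Sum>i\<in>UNIV. norm ((v $ i) *\<^sub>R f i x))"
      unfolding field_def by (rule order.trans[OF norm_triangle_ineq add_left_mono[OF norm_sum]])
    also have "\<dots> \<le> C * (1 + norm x) + (\<Sum>i\<in>(UNIV::'m set). B * (C * (1 + norm x)))"
      using C B(1) order.trans[OF component_le_norm_cart B(2)[OF v]]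
      by (intro add_mono sum_mono) (auto simp: intro!: mult_mono)
    finally show ?thesis by (simp add: algebra_simps)
  qed
  moreover have "C + real CARD('m) * (B * C) > 0" using C B by (simp add: add_pos_nonneg)
  ultimately show ?thesis using that by blast
qed

lemma field_Lipschitz_on_cball:
  obtains L where "L > 0"
    "\<And>v x y. \<lbrakk>v \<in> U; x \<in> cball 0 R; y \<in> cball 0 R\<rbrakk> \<Longrightarrow> norm (field v x - field v y) \<le> L * norm (x - y)"
proof -
  obtain L0 where L0: "L0 \<ge> 0" "\<And>x y. \<lbrakk>x \<in> cball 0 R; y \<in> cball 0 R\<rbrakk> \<Longrightarrow> norm (f0 x - f0 y) \<le> L0 * norm (x - y)"
    using Ck_1_Lipschitz_on_cball[OF smooth(1)] by blast
  have "\<exists>L\<ge>0. \<forall>x\<in>cball 0 R. \<forall>y\<in>cball 0 R. norm (f i x - f i y) \<le> L * norm (x - y)" for i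
    using Ck_1_Lipschitz_on_cball[OF smooth(2)[of i], of R] by metis
  then obtain L1 where L1: "\<And>i. L1 i \<ge> 0"
    "\<And>i x y. \<lbrakk>x \<in> cball 0 R; y \<in> cball 0 R\<rbrakk> \<Longrightarrow> norm (f i x - f i y) \<le> L1 i * norm (x - y)" by metis
  obtain B where B: "B \<ge> 0" "\<And>v. v \<in> U \<Longrightarrow> norm v \<le> B" by (rule control_bound) blast
  have "norm (field v x - field v y) \<le> (1 + L0 + (\<Sum>i\<in>UNIV. B * L1 i)) * norm (x - y)"
    if v: "v \<in> U" "x \<in> cball 0 R" "y \<in> cball 0 R" for v x y
  proof -
    have "field v x - field v y = (f0 x - f0 y) + (\<Sum>i\<in>UNIV. (v $ i) *\<^sub>R (f i x - f i y))"
      by (simp add: field_def sum_subtractf scaleR_diff_right)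
    also have "norm \<dots> \<le> norm (f0 x - f0 y) + (\<Sum>i\<in>UNIV. norm ((v $ i) *\<^sub>R (f i x - f i y)))"
      by (rule order.trans[OF norm_triangle_ineq add_left_mono[OF norm_sum]])
    also have "\<dots> \<le> L0 * norm (x - y) + (\<Sum>i\<in>UNIV. B * (L1 i * norm (x - y)))"
      using L0 L1 v B(1) order.trans[OF component_le_norm_cart B(2)[OF v(1)]]
      by (intro add_mono sum_mono) (auto simp: intro!: mult_mono)
    also have "\<dots> = (L0 + (\<Sum>i\<in>UNIV. B * L1 i)) * norm (x - y)"
      by (simp add: algebra_simps sum_distrib_left sum_distrib_right)
    also have "\<dots> \<le> (1 + L0 + (\<Sum>i\<in>UNIV. B * L1 i)) * norm (x - y)"
      by (intro mult_right_mono) auto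
    finally show ?thesis .
  qed
  moreover have "1 + L0 + (\<Sum>i\<in>UNIV. B * L1 i) > 0"
    using L0 L1 B by (simp add: add_pos_nonneg sum_nonneg)
  ultimately show ?thesis using that by blast
qed

lemma field_absolutely_integrable:
  assumes w: "admissible w" and x: "continuous_on {0..T} x" and t: "t \<in> {0..T}"
  shows "(\<lambda>s. field (w s) (x s)) absolutely_integrable_on {0..t}"
proof -
  obtain M where M: "M > 0" "\<And>v x. v \<in> U \<Longrightarrow> norm (field v x) \<le> M * (1 + norm x)"
    by (rule field_growth) blast
  have wm: "w \<in> borel_measurable (lebesgue_on {0..T})" and wU: "\<And>s. w s \<in> U"
    using w by (auto simp: admissible_def)
  have meas: "(\<lambda>s. f0 (x s)) \<in> borel_measurable (lebesgue_on {0..T})"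
    "(\<lambda>s. f i (x s)) \<in> borel_measurable (lebesgue_on {0..T})" for i
    by (auto intro!: continuous_imp_measurable_on_sets_lebesgue continuous_on_compose2[OF f_continuous(1) x]
      continuous_on_compose2[OF f_continuous(2) x])
  have wi: "(\<lambda>s. w s $ i) \<in> borel_measurable (lebesgue_on {0..T})" for i
    by (rule measurable_compose[OF wm borel_measurable_continuous_onI]) (intro continuous_intros)
  have "(\<lambda>s. field (w s) (x s)) absolutely_integrable_on {0..T}"
  proof (rule measurable_bounded_by_integrable_imp_absolutely_integrable)
    show "(\<lambda>s. field (w s) (x s)) \<in> borel_measurable (lebesgue_on {0..T})"
      unfolding field_def using meas wi by measurable
    show "(\<lambda>s. M * (1 + norm (x s))) integrable_on {0..T}"
      using x by (intro integrable_continuous_interval continuous_intros)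
  qed (use M wU in auto)
  then show ?thesis
    using t by (auto intro: set_integrable_subset)
qed

lemma field_integrable:
  assumes "admissible w" "continuous_on {0..T} x" "t \<in> {0..T}"
  shows "(\<lambda>s. field (w s) (x s)) integrable_on {0..t}"
  using field_absolutely_integrable[OF assms] set_lebesgue_integral_eq_integral(1) by blast

text \<open>The second form admits a field evaluated at a point \<open>y\<close> no longer than the
  state. It applies to the dynamics projected onto a ball and shows there that the projection is
  never active.\<close>

lemma trajectory_bound:
  obtains R where "R > 0"
    "\<And>x0 w x t. \<lbrakk>x0 \<in> \<Omega>; admissible w; integral_solution x0 w x; t \<in> {0..T}\<rbrakk> \<Longrightarrow> norm (x t) \<le> R"
    "\<And>x0 x G t. \<lbrakk>x0 \<in> \<Omega>; continuous_on {0..T} x; G integrable_on {0..T};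
       \<And>t. t \<in> {0..T} \<Longrightarrow> x t = x0 + integral {0..t} G;
       \<And>s. s \<in> {0..T} \<Longrightarrow> \<exists>v\<in>U. \<exists>y. G s = field v y \<and> norm y \<le> norm (x s); t \<in> {0..T}\<rbrakk>
       \<Longrightarrow> norm (x t) \<le> R"
proof -
  obtain M where M: "M > 0" "\<And>v x. v \<in> U \<Longrightarrow> norm (field v x) \<le> M * (1 + norm x)"
    by (rule field_growth) blast
  obtain r where r: "\<And>x. x \<in> \<Omega> \<Longrightarrow> norm x \<le> r" by (rule Omega_bound) blast
  define R where "R = \<bar>(r + M * T) + M * (exp (M * T) * ((r + M * T) * T))\<bar> + 1"
  have *: "norm (x t) \<le> R" if "x0 \<in> \<Omega>" "continuous_on {0..T} x" "G integrable_on {0..T}"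
       "\<And>t. t \<in> {0..T} \<Longrightarrow> x t = x0 + integral {0..t} G"
       and G: "\<And>s. s \<in> {0..T} \<Longrightarrow> \<exists>v\<in>U. \<exists>y. G s = field v y \<and> norm y \<le> norm (x s)" and t: "t \<in> {0..T}"
     for x0 x G t
  proof -
    have "norm (x t) \<le> (r + M * T) + M * (exp (M * T) * ((r + M * T) * T))"
    proof (rule linear_growth_bound[OF that(2,3) that(4) _ _ r[OF that(1)] t])
      fix s assume "s \<in> {0..T}"
      then obtain v y where "v \<in> U" "G s = field v y" "norm y \<le> norm (x s)" using G by blast
      then show "norm (G s) \<le> M * (1 + norm (x s))"
        using order.trans[OF M(2)[of v y] mult_left_mono[of "1 + norm y" "1 + norm (x s)" M]] M(1) by auto
    qed (use M in auto)
    then show ?thesis by (simp add: R_def)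
  qed
  show ?thesis
  proof (rule that[of R])
    fix x0 w x t assume "x0 \<in> \<Omega>" "admissible w" "integral_solution x0 w x" "t \<in> {0..T}"
    then show "norm (x t) \<le> R"
      using T by (intro *[of x0 x "\<lambda>s. field (w s) (x s)"] field_integrable)
        (auto simp: integral_solution_def admissible_def)
  qed (use * in \<open>auto simp: R_def\<close>)
qed

text \<open>Both curves stay in one ball, on which the field is Lipschitz uniformly in the control;
  Gronwall's inequality with \<open>r = 0\<close> annihilates their distance.\<close>

lemma integral_solution_unique:
  assumes w: "admissible w" and x: "integral_solution x0 w x" and y: "integral_solution x0 w y"
    and t: "t \<in> {0..T}"
  shows "x t = y t"
proof -
  have cx: "continuous_on {0..T} x" and cy: "continuous_on {0..T} y"
    using x y by (auto simp: integral_solution_def)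
  have "bounded (x ` {0..T} \<union> y ` {0..T})"
    using cx cy by (simp add: compact_continuous_image compact_imp_bounded)
  then obtain R where R: "\<And>z. z \<in> x ` {0..T} \<union> y ` {0..T} \<Longrightarrow> norm z \<le> R"
    unfolding bounded_iff by blast
  obtain L where L: "L > 0" "\<And>v x y. \<lbrakk>v \<in> U; x \<in> cball 0 R; y \<in> cball 0 R\<rbrakk> \<Longrightarrow>
      norm (field v x - field v y) \<le> L * norm (x - y)"
    by (rule field_Lipschitz_on_cball[of R]) blast
  define h where "h = (\<lambda>s. norm (x s - y s))"
  have ch: "continuous_on {0..T} h" unfolding h_def using cx cy by (intro continuous_intros)
  have le: "h s \<le> 0 + L * integral {0..s} h" if s: "s \<in> {0..T}" for s
  proof -
    have hI: "h integrable_on {0..s}"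
      using s ch by (intro integrable_continuous_interval) (auto intro: continuous_on_subset)
    have "x s - y s = integral {0..s} (\<lambda>s. field (w s) (x s) - field (w s) (y s))"
      using x y s by (simp add: integral_solution_def field_integrable[OF w cx s] field_integrable[OF w cy s]
        Henstock_Kurzweil_Integration.integral_diff)
    also have "norm \<dots> \<le> integral {0..s} (\<lambda>s. L * h s)"
      unfolding h_def
    proof (intro integral_norm_bound_integral)
      fix u assume "u \<in> {0..s}"
      then show "norm (field (w u) (x u) - field (w u) (y u)) \<le> L * norm (x u - y u)"
        using w R s by (intro L(2)) (auto simp: admissible_def)
    qed (use hI in \<open>auto simp: h_def intro!: integrable_diff field_integrable integrable_on_mult_right w cx cy s\<close>)
    finally show ?thesis by (simp add: h_def)
  qed
  have "integral {0..t} h \<le> exp (L * t) * integral {0..t} (\<lambda>_. 0)"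
    by (rule gronwall_integral[OF ch _ _ _ le t]) (use L in auto)
  then have "L * integral {0..t} h \<le> 0" using L by (simp add: mult_nonneg_nonpos)
  with le[OF t] have "h t \<le> 0" by linarith
  then show ?thesis by (simp add: h_def)
qed

text \<open>Picard iteration for the field composed with the projection onto the ball of the a
  priori radius \<open>R\<close>. The composition is globally Lipschitz, and its fixed point obeys
  the a priori bound, hence solves the original equation.\<close>

lemma integral_solution_exists:
  assumes x0: "x0 \<in> \<Omega>" and w: "admissible w"
  obtains x where "integral_solution x0 w x"
proof -
  obtain R where R: "R > 0"
    "\<And>x0 x G t. \<lbrakk>x0 \<in> \<Omega>; continuous_on {0..T} x; G integrable_on {0..T};
       \<And>t. t \<in> {0..T} \<Longrightarrow> x t = x0 + integral {0..t} G;
       \<And>s. s \<in> {0..T} \<Longrightarrow> \<exists>v\<in>U. \<exists>y. G s = field v y \<and> norm y \<le> norm (x s); t \<in> {0..T}\<rbrakk>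
       \<Longrightarrow> norm (x t) \<le> R"
    by (rule trajectory_bound) metis
  obtain L where L: "L > 0" "\<And>v x y. \<lbrakk>v \<in> U; x \<in> cball 0 R; y \<in> cball 0 R\<rbrakk> \<Longrightarrow>
      norm (field v x - field v y) \<le> L * norm (x - y)"
    by (rule field_Lipschitz_on_cball[of R]) blast
  obtain M where M: "M > 0" "\<And>v x. v \<in> U \<Longrightarrow> norm (field v x) \<le> M * (1 + norm x)"
    by (rule field_growth) blast
  have wU: "\<And>s. w s \<in> U" using w by (simp add: admissible_def)
  \<comment> \<open>The projection is 1-Lipschitz and fixes the origin, so it does not increase
    norms, as the second form of \<open>trajectory_bound\<close> requires.\<close>
  define P where "P = closest_point (cball (0::real^'d) R)"
  have ball: "convex (cball (0::real^'d) R)" "closed (cball (0::real^'d) R)" "cball (0::real^'d) R \<noteq> {}"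
    using R(1) by auto
  have P_in: "P y \<in> cball 0 R" for y
    unfolding P_def using closest_point_in_set[OF ball(2,3)] .
  have P_lip: "norm (P y - P z) \<le> norm (y - z)" for y z
    using closest_point_lipschitz[OF ball] by (simp add: P_def dist_norm)
  have P_id: "P y = y" if "norm y \<le> R" for y
    unfolding P_def using that by (intro closest_point_self) simp
  have P_norm: "norm (P y) \<le> norm y" for y
    using P_lip[of y 0] P_id[of 0] R(1) by simp
  have P_cont: "continuous_on S P" for S
    unfolding P_def by (rule continuous_on_closest_point[OF ball])
  define G where "G = (\<lambda>x s. field (w s) (P (x s)))"
  have G_int: "G x integrable_on {0..t}" if "continuous_on {0..T} x" "t \<in> {0..T}" for x t
    unfolding G_def using that
    by (intro field_integrable[OF w]) (auto intro: continuous_on_compose2[OF P_cont])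
  have G_bound: "norm (G x s) \<le> M * (1 + R)" for x s
    using order.trans[OF M(2)[OF wU] mult_left_mono[of _ "1 + R" M]] P_in M(1) by (simp add: G_def)
  have G_lip: "norm (G x s - G y s) \<le> L * norm (x s - y s)" for x y s
    using order.trans[OF L(2)[OF wU P_in P_in] mult_left_mono[OF P_lip]] L(1) by (simp add: G_def)
  define X where "X = rec_nat (\<lambda>_. x0) (\<lambda>_ x t. x0 + integral {0..t} (G x))"
  have X0: "X 0 = (\<lambda>_. x0)" and XS: "X (Suc n) = (\<lambda>t. x0 + integral {0..t} (G (X n)))" for n
    by (simp_all add: X_def)
  have X_cont: "continuous_on {0..T} (X n)" for n
  proof (induction n)
    case (Suc n)
    have "G (X n) integrable_on {0..T}" using G_int[OF Suc, of T] T by simp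
    then show ?case unfolding XS
      by (intro continuous_intros indefinite_integral_continuous_1)
  qed (simp add: X0)
  define d where "d = (\<lambda>n t. X (Suc n) t - X n t)"
  define K where "K = M * (1 + R) * T"
  have K: "K \<ge> 0" using M R T by (simp add: K_def)
  \<comment> \<open>The weight \<open>exp (2 * L * t)\<close> makes each iteration gain a factor
    1/2: integrating \<open>L\<close> times the weight gives at most half of it. So the increments
    are summable on all of \<open>{0..T}\<close>, however large \<open>L * T\<close> is.
    \<open>K\<close> bounds the first increment.\<close>
  have d_bound: "norm (d n t) \<le> K * exp (2 * L * t) * (1 / 2) ^ n" if "t \<in> {0..T}" for n t
    using that
  proof (induction n arbitrary: t)
    case 0
    have "norm (d 0 t) \<le> integral {0..t} (\<lambda>_. M * (1 + R))"
      unfolding d_def XS X0 using 0 G_int[of "\<lambda>_. x0" t] G_bound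
      by (simp only: add_diff_cancel_left') (intro integral_norm_bound_integral; simp add: integrable_const_ivl)
    also have "\<dots> \<le> K" using 0 M R by (simp add: K_def mult_left_mono mult.commute)
    also have "\<dots> \<le> K * exp (2 * L * t)" using K L 0 by (simp add: mult_le_cancel_left1)
    finally show ?case by simp
  next
    case (Suc n)
    have int: "((\<lambda>s. L * (K * exp (2 * L * s) * (1 / 2) ^ n)) has_integral
        (K * exp (2 * L * t) * (1 / 2) ^ Suc n - K * exp (2 * L * 0) * (1 / 2) ^ Suc n)) {0..t}"
      by (rule fundamental_theorem_of_calculus)
        (use Suc.prems in \<open>auto intro!: derivative_eq_intros simp flip: has_real_derivative_iff_has_vector_derivative\<close>)
    have "d (Suc n) t = integral {0..t} (\<lambda>s. G (X (Suc n)) s - G (X n) s)"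
      using fun_cong[OF XS[of "Suc n"], of t] fun_cong[OF XS[of n], of t]
        Henstock_Kurzweil_Integration.integral_diff[OF G_int[OF X_cont Suc.prems] G_int[OF X_cont Suc.prems], of "Suc n" n]
      by (simp add: d_def)
    also have "norm \<dots> \<le> integral {0..t} (\<lambda>s. L * (K * exp (2 * L * s) * (1 / 2) ^ n))"
    proof (rule integral_norm_bound_integral)
      show "(\<lambda>s. G (X (Suc n)) s - G (X n) s) integrable_on {0..t}"
        using Suc.prems by (intro integrable_diff G_int X_cont) 
      show "(\<lambda>s. L * (K * exp (2 * L * s) * (1 / 2) ^ n)) integrable_on {0..t}"
        using int by blast
      fix s assume "s \<in> {0..t}"
      then have "s \<in> {0..T}" using Suc.prems by auto
      then have "norm (X (Suc n) s - X n s) \<le> K * exp (2 * L * s) * (1 / 2) ^ n"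
        using Suc.IH by (simp only: d_def)
      then show "norm (G (X (Suc n)) s - G (X n) s) \<le> L * (K * exp (2 * L * s) * (1 / 2) ^ n)"
        using order.trans[OF G_lip mult_left_mono] L(1) by (meson less_imp_le)
    qed
    also have "\<dots> \<le> K * exp (2 * L * t) * (1 / 2) ^ Suc n"
      unfolding integral_unique[OF int] using K by simp
    finally show ?case .
  qed
  have X_sum: "X n t = x0 + (\<Sum>i<n. d i t)" for n t
    by (induction n) (auto simp: X0 d_def)
  define x where "x = (\<lambda>t. x0 + (\<Sum>i. d i t))"
  have "uniform_limit {0..T} (\<lambda>n t. \<Sum>i<n. d i t) (\<lambda>t. \<Sum>i. d i t) sequentially"
  proof (rule Weierstrass_m_test)
    fix n t assume t: "t \<in> {0..T}"
    have "norm (d n t) \<le> K * exp (2 * L * t) * (1 / 2) ^ n" by (rule d_bound[OF t])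
    also have "\<dots> \<le> K * exp (2 * L * T) * (1 / 2) ^ n"
      using t K L(1) by (intro mult_right_mono mult_left_mono) auto
    finally show "norm (d n t) \<le> K * exp (2 * L * T) * (1 / 2) ^ n" .
  qed (intro summable_mult summable_geometric; simp)
  then have "uniform_limit {0..T} X x sequentially"
    unfolding x_def X_sum[abs_def] by (intro uniform_limit_intros) 
  note X_unif = this
  have x_cont: "continuous_on {0..T} x"
    by (rule uniform_limit_theorem[OF _ X_unif]) (simp_all add: X_cont)
  have X_lim: "(\<lambda>n. X n t) \<longlonglongrightarrow> x t" if "t \<in> {0..T}" for t
    using X_unif that by (rule tendsto_uniform_limitI)
  have x_eq: "x t = x0 + integral {0..t} (G x)" if t: "t \<in> {0..T}" for t
  proof (rule LIMSEQ_unique)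
    show "(\<lambda>n. X (Suc n) t) \<longlonglongrightarrow> x t" using X_lim[OF t] by (rule LIMSEQ_Suc)
    have "(\<lambda>n. integral {0..t} (G (X n))) \<longlonglongrightarrow> integral {0..t} (G x)"
    proof (rule dominated_convergence(2))
      show "G (X n) integrable_on {0..t}" for n using t by (intro G_int X_cont)
      show "(\<lambda>_. M * (1 + R)) integrable_on {0..t}" by (rule integrable_const_ivl)
      show "norm (G (X n) s) \<le> M * (1 + R)" for n s by (rule G_bound)
      fix s assume "s \<in> {0..t}"
      then have "(\<lambda>n. X n s) \<longlonglongrightarrow> x s" using t by (intro X_lim) auto
      then have lim: "(\<lambda>n. L * norm (X n s - x s)) \<longlonglongrightarrow> 0"
        by (intro tendsto_mult_right_zero tendsto_norm_zero) (rule LIM_zero)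
      have "\<forall>n. norm (G (X n) s - G x s) \<le> L * norm (X n s - x s)"
        by (intro allI G_lip)
      from Lim_null_comparison[OF always_eventually[OF this] lim]
      have "(\<lambda>n. G (X n) s - G x s) \<longlonglongrightarrow> 0" .
      then show "(\<lambda>n. G (X n) s) \<longlonglongrightarrow> G x s" by (rule LIM_zero_cancel)
    qed
    then show "(\<lambda>n. X (Suc n) t) \<longlonglongrightarrow> x0 + integral {0..t} (G x)"
      unfolding XS by (intro tendsto_intros)
  qed
  \<comment> \<open>Along the limit the projection acts as the identity.\<close>
  have "norm (x t) \<le> R" if "t \<in> {0..T}" for t
  proof (rule R(2)[OF x0 x_cont _ x_eq _ that])
    show "G x integrable_on {0..T}" using G_int[OF x_cont, of T] T by simp
  qed (use wU P_norm in \<open>auto simp: G_def\<close>)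
  then have "integral {0..t} (G x) = integral {0..t} (\<lambda>s. field (w s) (x s))" if "t \<in> {0..T}" for t
    using that by (intro integral_cong) (auto simp: G_def P_id)
  then have "integral_solution x0 w x"
    using x_cont x_eq by (simp add: integral_solution_def)
  then show ?thesis by (rule that)
qed

text \<open>One direction integrates the derivative of an absolutely continuous curve, the other
  differentiates an indefinite integral almost everywhere. It also frees the notion of solution from
  the arbitrary representative \<open>rep \<phi>\<close>.\<close>

lemma is_solution_iff:
  assumes w: "admissible w" and \<phi>: "AE t in lebesgue_on {0..T}. rep \<phi> t = w t"
  shows "is_solution T f0 f x0 \<phi> x \<longleftrightarrow> integral_solution x0 w x"
proof
  assume sol: "is_solution T f0 f x0 \<phi> x"
  then have ac: "abs_cont_on 0 T x" and x0: "x 0 = x0"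
    and der: "AE t in lebesgue_on {0..T}. (x has_vector_derivative field (rep \<phi> t) (x t)) (at t within {0..T})"
    by (simp_all add: is_solution_def field_def)
  from der \<phi> have der: "AE t in lebesgue_on {0..T}. (x has_vector_derivative field (w t) (x t)) (at t within {0..T})"
    by eventually_elim simp
  have hi: "((\<lambda>s. field (w s) (x s)) has_integral (x t - x 0)) {0..t}" if t: "t \<in> {0..T}" for t
  proof (rule abs_cont_on_has_integral)
    show "abs_cont_on 0 t x"
      using ac t unfolding abs_cont_on_def by (meson atLeastAtMost_iff order_trans)
    have "AE s in lebesgue. s \<in> {0..T} \<longrightarrow> (x has_vector_derivative field (w s) (x s)) (at s within {0..T})"
      using der by (simp add: AE_restrict_space_iff)
    then have "AE s in lebesgue. s \<in> {0..t} \<longrightarrow> (x has_vector_derivative field (w s) (x s)) (at s within {0..t})"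
    proof eventually_elim
      case (elim s)
      with t show ?case by (auto intro: has_vector_derivative_within_subset[of x _ _ "{0..T}"])
    qed
    then show "AE s in lebesgue_on {0..t}. (x has_vector_derivative field (w s) (x s)) (at s within {0..t})"
      by (simp add: AE_restrict_space_iff)
  qed (use t in auto)
  have "x t = x0 + integral {0..t} (\<lambda>s. field (w s) (x s))" if "t \<in> {0..T}" for t
    using integral_unique[OF hi[OF that]] x0 by simp
  moreover have "continuous_on {0..T} x"
  proof -
    have "continuous_on {0..T} (\<lambda>t. x 0 + integral {0..t} (\<lambda>s. field (w s) (x s)))"
      using hi[of T] T by (intro continuous_intros indefinite_integral_continuous_1) auto
    then show ?thesis
      by (rule continuous_on_eq) (simp add: integral_unique[OF hi])
  qed
  ultimately show "integral_solution x0 w x" by (simp add: integral_solution_def)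
next
  assume sol: "integral_solution x0 w x"
  then have xc: "continuous_on {0..T} x"
    and eq: "\<And>t. t \<in> {0..T} \<Longrightarrow> x t = x0 + integral {0..t} (\<lambda>s. field (w s) (x s))"
    by (auto simp: integral_solution_def)
  let ?g = "\<lambda>s. field (w s) (x s)"
  have gI: "?g integrable_on {0..T}" using field_integrable[OF w xc, of T] T by simp
  have wU: "\<And>s. w s \<in> U" using w by (simp add: admissible_def)
  obtain M where M: "M > 0" "\<And>v x. v \<in> U \<Longrightarrow> norm (field v x) \<le> M * (1 + norm x)"
    by (rule field_growth) blast
  have "bounded (x ` {0..T})" using xc by (simp add: compact_continuous_image compact_imp_bounded)
  then obtain R where R: "\<And>t. t \<in> {0..T} \<Longrightarrow> norm (x t) \<le> R" unfolding bounded_iff by blast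
  have "abs_cont_on 0 T x"
  proof (rule abs_cont_on_Lipschitz[where B = "M * (1 + R)"])
    fix s t assume st: "0 \<le> s" "s \<le> t" "t \<le> T"
    have gIt: "?g integrable_on {0..t}" "?g integrable_on {s..t}"
      using st by (auto intro: integrable_on_subinterval[OF gI])
    have "x t - x s = integral {s..t} ?g"
      using Henstock_Kurzweil_Integration.integral_combine[of 0 s t ?g] st gIt eq[of t] eq[of s]
      by (simp add: algebra_simps)
    also have "norm \<dots> \<le> integral {s..t} (\<lambda>_. M * (1 + R))"
    proof (rule integral_norm_bound_integral[OF gIt(2)])
      fix u assume "u \<in> {s..t}"
      then show "norm (?g u) \<le> M * (1 + R)"
        using order.trans[OF M(2)[OF wU] mult_left_mono[of "1 + norm (x u)" "1 + R" M]] R[of u] M(1) st by auto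
    qed (rule integrable_const_ivl)
    also have "\<dots> = M * (1 + R) * (t - s)" using st by (simp add: mult.commute)
    finally show "norm (x t - x s) \<le> M * (1 + R) * (t - s)" .
  qed
  moreover have "x 0 = x0" using eq[of 0] T by simp
  moreover have "AE t in lebesgue_on {0..T}. (x has_vector_derivative field (rep \<phi> t) (x t)) (at t within {0..T})"
  proof -
    have "AE t in lebesgue_on {0..T}. t \<in> {0..T}"
      by (simp add: AE_restrict_space_iff)
    with indefinite_integral_has_vector_derivative_AE[OF gI] \<phi> show ?thesis
    proof eventually_elim
      fix t assume t: "((\<lambda>t. integral {0..t} ?g) has_vector_derivative ?g t) (at t within {0..T})"
        "rep \<phi> t = w t" "t \<in> {0..T}"
      have "((\<lambda>t. x0 + integral {0..t} ?g) has_vector_derivative 0 + ?g t) (at t within {0..T})"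
        using t(1) by (intro derivative_intros)
      then show "(x has_vector_derivative field (rep \<phi> t) (x t)) (at t within {0..T})"
        using t eq by (intro has_vector_derivative_transform[OF t(3) eq]) auto
    qed
  qed
  ultimately show "is_solution T f0 f x0 \<phi> x"
    by (simp add: is_solution_def field_def)
qed

text \<open>Uniqueness of solutions is what gives the definite description in
  \<open>endpoint\<close> its value.\<close>

lemma endpoint_eq:
  assumes w: "admissible w" and \<phi>: "AE t in lebesgue_on {0..T}. rep \<phi> t = w t"
    and x: "integral_solution x0 w x"
  shows "endpoint T f0 f (x0, \<phi>) = x T"
  unfolding endpoint_def
proof (simp add: is_solution_iff[OF w \<phi>], rule the_equality)
  show "\<exists>z. integral_solution x0 w z \<and> x T = z T" using x by blast
  fix y assume "\<exists>z. integral_solution x0 w z \<and> y = z T"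
  then show "y = x T" using integral_solution_unique[OF w x, of _ T] T by auto
qed

section \<open>Stability of the end point under weak convergence of controls\<close>

lemma admissible_inner_integrable:
  assumes w: "admissible w" and v: "v \<in> L2_fun T"
  shows "integrable (lebesgue_on {0..T}) (\<lambda>t. w t \<bullet> v t)"
proof -
  obtain B where B: "B \<ge> 0" "\<And>u. u \<in> U \<Longrightarrow> norm u \<le> B" by (rule control_bound) blast
  have "integrable (lebesgue_on {0..T}) (\<lambda>t. B * (1 + (norm (v t))\<^sup>2))"
    using v by (auto simp: L2_fun_def intro!: integrable_mult_right Bochner_Integration.integrable_add)
  then show ?thesis
  proof (rule Bochner_Integration.integrable_bound)
    show "(\<lambda>t. w t \<bullet> v t) \<in> borel_measurable (lebesgue_on {0..T})"
      using w v by (auto simp: admissible_def L2_fun_def)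
    have "\<bar>w t \<bullet> v t\<bar> \<le> B * (1 + (norm (v t))\<^sup>2)" for t
    proof -
      have "norm (v t) \<le> 1 + (norm (v t))\<^sup>2"
        using zero_le_power2[of "norm (v t) - 1"] norm_ge_zero[of "v t"]
        unfolding power2_diff power_one mult_1_right by linarith
      then show ?thesis
        using order.trans[OF Cauchy_Schwarz_ineq2 mult_mono[OF B(2)]] w B(1) by (auto simp: admissible_def)
    qed
    then show "AE t in lebesgue_on {0..T}. norm (w t \<bullet> v t) \<le> norm (B * (1 + (norm (v t))\<^sup>2))"
      using B(1) by (auto simp: order.trans[OF _ abs_ge_self])
  qed
qed

lemma bounded_measurable_L2_fun:
  assumes "v \<in> borel_measurable (lebesgue_on {0..S})" "\<And>t. t \<in> {0..S} \<Longrightarrow> norm (v t) \<le> C"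
  shows "v \<in> L2_fun S"
proof -
  have "finite_measure (lebesgue_on {0..S})"
    by (intro finite_measureI) (simp add: emeasure_restrict_space emeasure_lborel_Icc_eq)
  then have "integrable (lebesgue_on {0..S}) (\<lambda>t. (norm (v t))\<^sup>2)"
    using assms by (intro finite_measure.integrable_const_bound[where B = "C\<^sup>2"]) (auto intro!: AE_I2 power_mono)
  then show ?thesis using assms by (simp add: L2_fun_def)
qed

text \<open>The drift difference splits in two. With the same control \<open>W n\<close> in both
  states it is Lipschitz in the state and is absorbed by Gronwall's inequality. With both controls
  along the limit curve \<open>x\<close> it is linear in the difference of the controls, so its
  integral vanishes by weak convergence. Pointwise convergence and a uniform bound on these
  integrals suffice.\<close>

lemma endpoint_tendsto:
  assumes X0: "\<And>n. X0 n \<in> \<Omega>" "X0 \<longlonglongrightarrow> x0" "x0 \<in> \<Omega>"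
    and W: "\<And>n. admissible (W n)" and w: "admissible w"
    and weak: "\<And>v. v \<in> L2_fun T \<Longrightarrow> (\<lambda>n. \<integral>t. W n t \<bullet> v t \<partial>lebesgue_on {0..T}) \<longlonglongrightarrow> (\<integral>t. w t \<bullet> v t \<partial>lebesgue_on {0..T})"
    and Y: "\<And>n. integral_solution (X0 n) (W n) (Y n)" and x: "integral_solution x0 w x"
  shows "(\<lambda>n. Y n T) \<longlonglongrightarrow> x T"
proof -
  have xc: "continuous_on {0..T} x" and Yc: "\<And>n. continuous_on {0..T} (Y n)"
    using x Y by (auto simp: integral_solution_def)
  obtain R where R: "R > 0" "\<And>x0 w x t. \<lbrakk>x0 \<in> \<Omega>; admissible w; integral_solution x0 w x; t \<in> {0..T}\<rbrakk> \<Longrightarrow> norm (x t) \<le> R"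
    by (rule trajectory_bound) metis
  obtain L where L: "L > 0" "\<And>v x y. \<lbrakk>v \<in> U; x \<in> cball 0 R; y \<in> cball 0 R\<rbrakk> \<Longrightarrow>
      norm (field v x - field v y) \<le> L * norm (x - y)"
    by (rule field_Lipschitz_on_cball[of R]) blast
  obtain M where M: "M > 0" "\<And>v x. v \<in> U \<Longrightarrow> norm (field v x) \<le> M * (1 + norm x)"
    by (rule field_growth) blast
  have wU: "w s \<in> U" and WU: "W n s \<in> U" for n s using w W by (auto simp: admissible_def)
  have xR: "norm (x s) \<le> R" and YR: "norm (Y n s) \<le> R" if "s \<in> {0..T}" for s n
    using R(2)[OF X0(3) w x that] R(2)[OF X0(1) W Y that] by auto
  \<comment> \<open>The error from the control alone: the state is frozen along the limit
    trajectory.\<close>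
  define g where "g = (\<lambda>n s. field (W n s) (x s) - field (w s) (x s))"
  have g_int: "g n integrable_on {0..t}" if "t \<in> {0..T}" for n t
    unfolding g_def using that by (intro integrable_diff field_integrable W w xc)
  have g_bound: "norm (g n s) \<le> 2 * (M * (1 + R))" if "s \<in> {0..T}" for n s
  proof -
    have "norm (field v (x s)) \<le> M * (1 + R)" if "v \<in> U" for v
      using order.trans[OF M(2)[OF that] mult_left_mono[of "1 + norm (x s)" "1 + R" M]] xR \<open>s \<in> _\<close> M(1) by auto
    from this[OF wU[of s]] this[OF WU[of n s]] show ?thesis
      unfolding g_def by (intro order.trans[OF norm_triangle_ineq4]) linarith
  qed
  define Z where "Z = (\<lambda>n t. integral {0..t} (g n))"
  have Z_lim: "(\<lambda>n. Z n t) \<longlonglongrightarrow> 0" if t: "t \<in> {0..T}" for t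
  proof (rule vec_tendstoI)
    fix j
    \<comment> \<open>In \<open>g n s\<close> the drift \<open>f0\<close> cancels, and its
      \<open>j\<close>-th component is the inner product of \<open>W n s - w s\<close> with
      \<open>q s\<close>. Restricted to \<open>{0..t}\<close>, \<open>q\<close> is a legitimate test
      function for weak convergence.\<close>
    define q where "q = (\<lambda>s. \<chi> i. f i (x s) $ j)"
    define v where "v = (\<lambda>s. indicator {0..t} s *\<^sub>R q s)"
    have q_cont: "continuous_on {0..T} q"
      unfolding q_def by (intro continuous_intros continuous_on_compose2[OF f_continuous(2) xc]) auto
    have "bounded (q ` {0..T})" using q_cont by (simp add: compact_continuous_image compact_imp_bounded)
    then obtain C where C: "\<And>s. s \<in> {0..T} \<Longrightarrow> norm (q s) \<le> C" unfolding bounded_iff by blast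
    have v_L2: "v \<in> L2_fun T"
    proof (rule bounded_measurable_L2_fun)
      have "q \<in> borel_measurable (lebesgue_on {0..T})"
        by (rule continuous_imp_measurable_on_sets_lebesgue[OF q_cont]) simp
      moreover have "(indicator {0..t} :: real \<Rightarrow> real) \<in> borel_measurable (lebesgue_on {0..T})"
        by (intro measurable_restrict_space1 borel_measurable_indicator) simp
      ultimately show "v \<in> borel_measurable (lebesgue_on {0..T})"
        unfolding v_def by (rule borel_measurable_scaleR[rotated])
      show "norm (v s) \<le> C" if "s \<in> {0..T}" for s
        using C[OF that] norm_ge_zero[of "q s"] by (auto simp: v_def indicator_def simp del: norm_ge_zero)
    qed
    have eq: "(\<integral>s. u s \<bullet> v s \<partial>lebesgue_on {0..T}) = integral {0..t} (\<lambda>s. u s \<bullet> q s)" and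
      int: "(\<lambda>s. u s \<bullet> q s) integrable_on {0..t}" if u: "admissible u" for u
    proof -
      have int: "integrable (lebesgue_on {0..T}) (\<lambda>s. u s \<bullet> v s)"
        by (rule admissible_inner_integrable[OF u v_L2])
      have vq: "(\<lambda>s. u s \<bullet> v s) = (\<lambda>s. if s \<in> {0..t} then u s \<bullet> q s else 0)"
        by (auto simp: v_def indicator_def)
      have "(\<integral>s. u s \<bullet> v s \<partial>lebesgue_on {0..T}) = integral {0..T} (\<lambda>s. u s \<bullet> v s)"
        by (rule lebesgue_integral_eq_integral[OF int]) simp
      also have "\<dots> = integral {0..t} (\<lambda>s. u s \<bullet> q s)"
        unfolding vq integral_restrict_Int using t by (simp add: Int_absorb1)
      finally show "(\<integral>s. u s \<bullet> v s \<partial>lebesgue_on {0..T}) = integral {0..t} (\<lambda>s. u s \<bullet> q s)" .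
      have "(\<lambda>s. u s \<bullet> v s) integrable_on {0..T}"
        using integrable_on_lebesgue_on[OF int] by simp
      then show "(\<lambda>s. u s \<bullet> q s) integrable_on {0..t}"
        unfolding vq integrable_restrict_Int using t by (simp add: Int_absorb2)
    qed
    have "Z n t $ j = integral {0..t} (\<lambda>s. W n s \<bullet> q s) - integral {0..t} (\<lambda>s. w s \<bullet> q s)" for n
    proof -
      have "Z n t $ j = integral {0..t} (\<lambda>s. g n s $ j)"
        unfolding Z_def by (rule integral_component_eq_cart[OF g_int[OF t], symmetric])
      also have "(\<lambda>s. g n s $ j) = (\<lambda>s. W n s \<bullet> q s - w s \<bullet> q s)"
        by (simp add: g_def field_def q_def inner_vec_def)
      finally show ?thesis
        using int[OF W] int[OF w] by (simp add: Henstock_Kurzweil_Integration.integral_diff)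
    qed
    moreover have "(\<lambda>n. integral {0..t} (\<lambda>s. W n s \<bullet> q s) - integral {0..t} (\<lambda>s. w s \<bullet> q s)) \<longlonglongrightarrow> 0"
      using weak[OF v_L2] by (simp add: eq W w LIM_zero)
    ultimately show "(\<lambda>n. Z n t $ j) \<longlonglongrightarrow> 0 $ j" by simp
  qed
  have Z_cont: "continuous_on {0..T} (Z n)" for n
    unfolding Z_def using g_int[of T n] T by (intro indefinite_integral_continuous_1) auto
  have Z_bound: "norm (Z n t) \<le> 2 * (M * (1 + R)) * T" if "t \<in> {0..T}" for n t
  proof -
    have "norm (Z n t) \<le> integral {0..t} (\<lambda>_. 2 * (M * (1 + R)))"
      unfolding Z_def using that
      by (intro integral_norm_bound_integral g_int g_bound integrable_const_ivl) auto
    also have "\<dots> = 2 * (M * (1 + R)) * t" using that by simp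
    also have "\<dots> \<le> 2 * (M * (1 + R)) * T" using that M(1) R(1) by (intro mult_left_mono) auto
    finally show ?thesis .
  qed
  define r where "r = (\<lambda>n t. norm (X0 n - x0) + norm (Z n t))"
  define h where "h = (\<lambda>n t. norm (Y n t - x t))"
  have h_cont: "continuous_on {0..T} (h n)" and r_cont: "continuous_on {0..T} (r n)" for n
    unfolding h_def r_def using Yc xc Z_cont by (auto intro!: continuous_intros)
  have h_le: "h n t \<le> r n t + L * integral {0..t} (h n)" if t: "t \<in> {0..T}" for n t
  proof -
    let ?k = "\<lambda>s. field (W n s) (Y n s) - field (W n s) (x s)"
    have kI: "?k integrable_on {0..t}"
      using t by (intro integrable_diff field_integrable W Yc xc)
    have hI: "h n integrable_on {0..t}"
      using t by (intro integrable_continuous_interval continuous_on_subset[OF h_cont]) auto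
    have "Y n t - x t = (X0 n - x0) + (integral {0..t} (\<lambda>s. field (W n s) (Y n s)) - integral {0..t} (\<lambda>s. field (w s) (x s)))"
      using x Y t by (simp add: integral_solution_def)
    also have "integral {0..t} (\<lambda>s. field (W n s) (Y n s)) - integral {0..t} (\<lambda>s. field (w s) (x s)) = integral {0..t} ?k + Z n t"
      unfolding Z_def g_def
      using field_integrable[OF W Yc t, of n n] field_integrable[OF W xc t, of n] field_integrable[OF w xc t]
      by (simp add: Henstock_Kurzweil_Integration.integral_diff)
    finally have "h n t \<le> r n t + norm (integral {0..t} ?k)"
      unfolding h_def r_def
      using norm_triangle_ineq[of "X0 n - x0" "integral {0..t} ?k + Z n t"] norm_triangle_ineq[of "integral {0..t} ?k" "Z n t"] by simp
    also have "norm (integral {0..t} ?k) \<le> integral {0..t} (\<lambda>s. L * h n s)"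
    proof (rule integral_norm_bound_integral[OF kI])
      show "(\<lambda>s. L * h n s) integrable_on {0..t}" using hI by (rule integrable_on_mult_right)
      fix s assume "s \<in> {0..t}"
      with t have s: "s \<in> {0..T}" by auto
      then show "norm (?k s) \<le> L * h n s"
        unfolding h_def using xR[OF s] YR[OF s] by (intro L(2) WU) auto
    qed
    finally show ?thesis by simp
  qed
  have h_T: "h n T \<le> r n T + L * (exp (L * T) * integral {0..T} (r n))" for n
  proof -
    have "integral {0..T} (h n) \<le> exp (L * T) * integral {0..T} (r n)"
      by (rule gronwall_integral[OF h_cont r_cont _ _ h_le]) (use L T in \<open>auto simp: r_def\<close>)
    then have "L * integral {0..T} (h n) \<le> L * (exp (L * T) * integral {0..T} (r n))"
      using L(1) by (intro mult_left_mono) auto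
    then show ?thesis using h_le[of T n] T by simp
  qed
  have X0_norm: "(\<lambda>n. norm (X0 n - x0)) \<longlonglongrightarrow> 0"
    using X0(2) by (intro tendsto_norm_zero LIM_zero)
  have r_lim: "(\<lambda>n. r n t) \<longlonglongrightarrow> 0" if "t \<in> {0..T}" for t
    unfolding r_def using tendsto_add[OF X0_norm tendsto_norm_zero[OF Z_lim[OF that]]] by simp
  obtain D where D: "\<And>n. norm (X0 n - x0) \<le> D"
    using convergent_imp_Bseq[OF convergentI[OF X0_norm]] by (auto simp: Bseq_def)
  have "(\<lambda>n. integral {0..T} (r n)) \<longlonglongrightarrow> integral {0..T} (\<lambda>_. 0)"
  proof (rule dominated_convergence(2))
    show "r n integrable_on {0..T}" for n using r_cont by (rule integrable_continuous_interval)
    show "(\<lambda>_. D + 2 * (M * (1 + R)) * T) integrable_on {0..T}" by (rule integrable_const_ivl)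
    show "norm (r n t) \<le> D + 2 * (M * (1 + R)) * T" if "t \<in> {0..T}" for n t
      using add_mono[OF D Z_bound[OF that]] by (simp add: r_def)
  qed (rule r_lim)
  then have "(\<lambda>n. r n T + L * (exp (L * T) * integral {0..T} (r n))) \<longlonglongrightarrow> 0 + L * (exp (L * T) * 0)"
    using r_lim[of T] T by (intro tendsto_add tendsto_mult tendsto_const) auto
  then have lim: "(\<lambda>n. r n T + L * (exp (L * T) * integral {0..T} (r n))) \<longlonglongrightarrow> 0" by simp
  have "\<forall>n. norm (Y n T - x T) \<le> r n T + L * (exp (L * T) * integral {0..T} (r n))"
    using h_T by (simp add: h_def)
  from Lim_null_comparison[OF always_eventually[OF this] lim] show ?thesis
    by (rule LIM_zero_cancel)
qed

section \<open>Weak compactness of the control space\<close>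

lemma finite_measure_interval: "finite_measure (lebesgue_on {0..S::real})"
  by (intro finite_measureI) (simp add: emeasure_restrict_space emeasure_lborel_Icc_eq)

text \<open>The exceptional null set is repaired with a fixed value \<open>u0\<close> from
  \<open>U\<close>; closedness of \<open>U\<close> keeps the result measurable.\<close>

lemma control_representative:
  assumes "\<phi> \<in> controls T U"
  obtains w where "admissible w" "AE t in lebesgue_on {0..T}. rep \<phi> t = w t"
proof -
  obtain u0 where u0: "u0 \<in> U" using U(1) by blast
  have L2: "\<phi> \<in> L2 T" and ae: "AE t in lebesgue_on {0..T}. rep \<phi> t \<in> U"
    using assms by (auto simp: controls_def)
  define w where "w = (\<lambda>t. if rep \<phi> t \<in> U then rep \<phi> t else u0)"
  have m: "rep \<phi> \<in> borel_measurable (lebesgue_on {0..T})"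
    using rep_mem_L2(2)[OF L2] by (simp add: L2_fun_def)
  have "U \<in> sets borel" using compact_imp_closed[OF U(2)] by (rule borel_closed)
  from measurable_sets[OF m this]
  have sU: "{t \<in> space (lebesgue_on {0..T}). rep \<phi> t \<in> U} \<in> sets (lebesgue_on {0..T})"
    by (simp add: vimage_def Int_def conj_commute)
  have "w \<in> borel_measurable (lebesgue_on {0..T})"
    unfolding w_def by (rule measurable_If[OF m _ sU]) simp
  then have "admissible w" using u0 by (simp add: admissible_def w_def)
  moreover have "AE t in lebesgue_on {0..T}. rep \<phi> t = w t"
    using ae by eventually_elim (simp add: w_def)
  ultimately show ?thesis by (rule that)
qed

lemma L2_eq_class:
  fixes w :: "real \<Rightarrow> 'b::euclidean_space"
  assumes "w \<in> L2_fun T"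
  shows "L2_eq T `` {w} \<in> L2 T" "AE t in lebesgue_on {0..T}. rep (L2_eq T `` {w}) t = w t"
proof -
  show in_L2: "L2_eq T `` {w} \<in> L2 T" using assms by (simp add: L2_def quotientI)
  have "(w, rep (L2_eq T `` {w})) \<in> L2_eq T" using rep_mem_L2(1)[OF in_L2] by simp
  moreover have "AE t in lebesgue_on {0..T}. u t = v t" if "(u, v) \<in> L2_eq T" for u v :: "real \<Rightarrow> 'b"
    using that by (simp add: L2_eq_def)
  ultimately have "AE t in lebesgue_on {0..T}. w t = rep (L2_eq T `` {w}) t" by blast
  then show "AE t in lebesgue_on {0..T}. rep (L2_eq T `` {w}) t = w t"
    by eventually_elim simp
qed

lemma L2_eqI:
  assumes "\<phi> \<in> L2 T" "\<psi> \<in> L2 T" "AE t in lebesgue_on {0..T}. rep \<phi> t = rep \<psi> t"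
  shows "\<phi> = \<psi>"
proof (rule quotient_eqI[OF L2_eq_equiv])
  show "\<phi> \<in> L2_fun T // L2_eq T" "\<psi> \<in> L2_fun T // L2_eq T" using assms by (auto simp: L2_def)
  show "rep \<phi> \<in> \<phi>" "rep \<psi> \<in> \<psi>" using rep_mem_L2 assms by blast+
  show "(rep \<phi>, rep \<psi>) \<in> L2_eq T" using rep_mem_L2(2)[OF assms(1)] rep_mem_L2(2)[OF assms(2)] assms(3) by (simp add: L2_eq_def)
qed

lemma admissible_L2_fun:
  assumes "admissible w" shows "w \<in> L2_fun T"
proof -
  obtain B where B: "B \<ge> 0" "\<And>u. u \<in> U \<Longrightarrow> norm u \<le> B" by (rule control_bound) blast
  show ?thesis
    using assms B(2) by (intro bounded_measurable_L2_fun[where C = B]) (auto simp: admissible_def)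
qed

lemma admissible_class:
  assumes "admissible w"
  shows "L2_eq T `` {w} \<in> controls T U" "AE t in lebesgue_on {0..T}. rep (L2_eq T `` {w}) t = w t"
proof -
  note * = L2_eq_class[OF admissible_L2_fun[OF assms]]
  show "AE t in lebesgue_on {0..T}. rep (L2_eq T `` {w}) t = w t" by (rule *)
  then have "AE t in lebesgue_on {0..T}. rep (L2_eq T `` {w}) t \<in> U"
    using assms by (auto simp: admissible_def elim: eventually_mono)
  then show "L2_eq T `` {w} \<in> controls T U" using * by (simp add: controls_def)
qed

lemma L2_fun_mono_AE_integral:
  fixes u v u' v' :: "real \<Rightarrow> 'b::euclidean_space"
  assumes "AE t in lebesgue_on {0..T}. u t = u' t" "AE t in lebesgue_on {0..T}. v t = v' t"
    "u \<in> L2_fun T" "u' \<in> L2_fun T" "v \<in> L2_fun T" "v' \<in> L2_fun T"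
  shows "(\<integral>t. u t \<bullet> v t \<partial>lebesgue_on {0..T}) = (\<integral>t. u' t \<bullet> v' t \<partial>lebesgue_on {0..T})"
proof (rule integral_cong_AE)
  show "(\<lambda>t. u t \<bullet> v t) \<in> borel_measurable (lebesgue_on {0..T})" "(\<lambda>t. u' t \<bullet> v' t) \<in> borel_measurable (lebesgue_on {0..T})"
    using assms by (auto simp: L2_fun_def)
  show "AE t in lebesgue_on {0..T}. u t \<bullet> v t = u' t \<bullet> v' t"
    using assms(1,2) by eventually_elim simp
qed

definition control_top :: "(real \<Rightarrow> real^'m) set topology" where
  "control_top = subtopology (weak_L2 T) (controls T U)"

lemma topspace_control_top: "topspace control_top = controls T U"
  by (auto simp: control_top_def topspace_weak_L2 controls_def)

lemma controls_subset_L2: "controls T U \<subseteq> L2 T"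
  by (auto simp: controls_def)

lemma continuous_map_L2_inner:
  assumes "\<gamma> \<in> L2 T"
  shows "continuous_map control_top euclideanreal (\<lambda>\<phi>. L2_inner T \<phi> \<gamma>)"
  unfolding continuous_map_def
proof (intro conjI allI impI)
  fix S :: "real set" assume "openin euclideanreal S"
  then have "openin (weak_L2 T) {\<phi> \<in> L2 T. L2_inner T \<phi> \<gamma> \<in> S}"
    unfolding weak_L2_def using assms by (intro topology_generated_by_Basis) auto
  then have "openin control_top (controls T U \<inter> {\<phi> \<in> L2 T. L2_inner T \<phi> \<gamma> \<in> S})"
    unfolding control_top_def by (simp add: openin_subtopology_Int2)
  moreover have "controls T U \<inter> {\<phi> \<in> L2 T. L2_inner T \<phi> \<gamma> \<in> S} = {\<phi> \<in> topspace control_top. L2_inner T \<phi> \<gamma> \<in> S}"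
    using controls_subset_L2 by (auto simp: topspace_control_top)
  ultimately show "openin control_top {\<phi> \<in> topspace control_top. L2_inner T \<phi> \<gamma> \<in> S}" by simp
qed auto

lemma continuous_map_inner_fun:
  assumes v: "v \<in> L2_fun T"
  shows "continuous_map control_top euclideanreal (\<lambda>\<phi>. \<integral>t. rep \<phi> t \<bullet> v t \<partial>lebesgue_on {0..T})"
proof (rule continuous_map_eq[OF continuous_map_L2_inner[OF L2_eq_class(1)[OF v]]])
  fix \<phi> assume "\<phi> \<in> topspace control_top"
  then have "\<phi> \<in> L2 T" using controls_subset_L2 by (auto simp: topspace_control_top)
  then show "L2_inner T \<phi> (L2_eq T `` {v}) = (\<integral>t. rep \<phi> t \<bullet> v t \<partial>lebesgue_on {0..T})"
    unfolding L2_inner_def using L2_eq_class[OF v] rep_mem_L2 v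
    by (intro L2_fun_mono_AE_integral) auto
qed

lemma continuous_map_into_control_top:
  assumes g: "g \<in> topspace Z \<rightarrow> controls T U"
    and cont: "\<And>v. v \<in> L2_fun T \<Longrightarrow> continuous_map Z euclideanreal (\<lambda>z. \<integral>t. rep (g z) t \<bullet> v t \<partial>lebesgue_on {0..T})"
  shows "continuous_map Z control_top g"
  unfolding control_top_def
proof (rule continuous_map_into_subtopology)
  show "continuous_map Z (weak_L2 T) g"
    unfolding weak_L2_def
  proof (rule continuous_on_generated_topo)
    fix S :: "(real \<Rightarrow> real^'m) set set" assume "S \<in> {{\<phi> \<in> L2 T. L2_inner T \<phi> \<gamma> \<in> S} |\<gamma> S. \<gamma> \<in> L2 T \<and> open S}"
    then obtain \<gamma> V where S: "S = {\<phi> \<in> L2 T. L2_inner T \<phi> \<gamma> \<in> V}" "\<gamma> \<in> L2 T" "open V" by blast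
    have "g -` S \<inter> topspace Z = {z \<in> topspace Z. (\<integral>t. rep (g z) t \<bullet> rep \<gamma> t \<partial>lebesgue_on {0..T}) \<in> V}"
      using g controls_subset_L2 by (auto simp: S L2_inner_def)
    then show "openin Z (g -` S \<inter> topspace Z)"
      using cont[OF rep_mem_L2(2)[OF S(2)]] S(3) by (simp add: continuous_map_def)
  next
    have "g ` topspace Z \<subseteq> L2 T" using g controls_subset_L2 by auto
    then show "g ` topspace Z \<subseteq> \<Union> {{\<phi> \<in> L2 T. L2_inner T \<phi> \<gamma> \<in> S} |\<gamma> S. \<gamma> \<in> L2 T \<and> open S}"
      by (simp only: topspace_weak_L2[unfolded weak_L2_def topology_generated_by_topspace])
  qed
qed (use g in auto)

text \<open>These turn out to be exactly the primitives of admissible controls. Constraining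
  difference quotients instead of derivatives makes the conditions closed under pointwise
  convergence. The value 0 outside \<open>{0..T}\<close> confines the remaining coordinates to a
  compact set.\<close>

definition primitives :: "(real \<Rightarrow> real^'m) set" where
  "primitives = {y. (\<forall>t. t \<notin> {0..T} \<longrightarrow> y t = 0) \<and> y 0 = 0 \<and>
     (\<forall>s t. 0 \<le> s \<and> s < t \<and> t \<le> T \<longrightarrow> (y t - y s) /\<^sub>R (t - s) \<in> U)}"

lemma primitives_Lipschitz:
  assumes B: "\<And>u. u \<in> U \<Longrightarrow> norm u \<le> B" and y: "y \<in> primitives" and st: "s \<in> {0..T}" "t \<in> {0..T}"
  shows "norm (y t - y s) \<le> B * \<bar>t - s\<bar>"
proof -
  have *: "norm (y t - y s) \<le> B * (t - s)" if "0 \<le> s" "s < t" "t \<le> T" for s t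
  proof -
    have "norm ((y t - y s) /\<^sub>R (t - s)) \<le> B" using y that by (intro B) (auto simp: primitives_def)
    from mult_left_mono[OF this, of "t - s"] show ?thesis
      using that by (simp add: mult.commute mult.assoc[symmetric])
  qed
  consider "s < t" | "s = t" | "t < s" by linarith
  then show ?thesis
    using *[of s t] *[of t s] st by cases (auto simp: norm_minus_commute)
qed

text \<open>Functions carry the product topology, so compactness is that of a closed subset of a
  product of balls (Tychonoff). The radius \<open>B * T\<close> is the largest distance a curve of
  speed at most \<open>B\<close> can reach from 0.\<close>

lemma compact_primitives: "compact primitives"
proof -
  obtain B where B: "B \<ge> 0" "\<And>u. u \<in> U \<Longrightarrow> norm u \<le> B" by (rule control_bound) blast
  have "compact (PiE UNIV (\<lambda>_::real. cball (0::real^'m) (B * T)))"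
    using compactin_PiE[of "\<lambda>_::real. euclidean :: (real^'m) topology" UNIV "\<lambda>_. cball 0 (B * T)"]
    by (simp add: euclidean_product_topology)
  moreover have "closed primitives"
  proof -
    have ev: "continuous_on UNIV (\<lambda>y::real \<Rightarrow> real^'m. y t)" for t by simp
    have "closed {y::real \<Rightarrow> real^'m. y t = 0}" for t
      using closed_vimage[of "{0}", OF _ ev[of t]] by (simp add: vimage_def)
    moreover have "closed {y::real \<Rightarrow> real^'m. (y t - y s) /\<^sub>R (t - s) \<in> U}" for s t
    proof -
      have "continuous_on UNIV (\<lambda>y::real \<Rightarrow> real^'m. (y t - y s) /\<^sub>R (t - s))"
        by (intro continuous_intros ev)
      from closed_vimage[OF compact_imp_closed[OF U(2)] this] show ?thesis by (simp add: vimage_def)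
    qed
    ultimately show ?thesis
      unfolding primitives_def by (intro closed_Collect_conj closed_Collect_all closed_Collect_imp) auto
  qed
  moreover have "primitives \<subseteq> PiE UNIV (\<lambda>_. cball 0 (B * T))"
  proof
    fix y assume y: "y \<in> primitives"
    have "norm (y t) \<le> B * T" for t
    proof (cases "t \<in> {0..T}")
      case True
      then have "norm (y t - y 0) \<le> B * \<bar>t - 0\<bar>"
        using T by (intro primitives_Lipschitz B(2) y) auto
      also have "\<dots> \<le> B * T" using True B(1) by (intro mult_left_mono) auto
      finally show ?thesis using y by (simp add: primitives_def)
    next
      case False
      then show ?thesis using y B(1) T by (simp add: primitives_def)
    qed
    then show "y \<in> PiE UNIV (\<lambda>_. cball 0 (B * T))" by auto
  qed
  ultimately show ?thesis
    by (metis compact_Int_closed inf.absorb_iff2)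
qed

lemma admissible_integrable:
  assumes "admissible w"
  shows "w integrable_on {0..T}" "integrable (lebesgue_on {0..T}) w"
proof -
  obtain B where B: "B \<ge> 0" "\<And>u. u \<in> U \<Longrightarrow> norm u \<le> B" by (rule control_bound) blast
  show i: "integrable (lebesgue_on {0..T}) w"
    using assms B(2) finite_measure_interval[of T] by (intro finite_measure.integrable_const_bound[where B = B]) (auto simp: admissible_def)
  show "w integrable_on {0..T}"
    using integrable_on_lebesgue_on[OF i] by simp
qed

text \<open>A difference quotient of the primitive is an average of the control; this is where
  convexity of \<open>U\<close> enters.\<close>

lemma primitive_of_admissible:
  assumes w: "admissible w"
  shows "(\<lambda>t. if t \<in> {0..T} then integral {0..t} w else 0) \<in> primitives"
proof -
  have "(integral {0..t} w - integral {0..s} w) /\<^sub>R (t - s) \<in> U" if st: "0 \<le> s" "s < t" "t \<le> T" for s t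
  proof -
    have i: "w integrable_on {0..t}" "w integrable_on {s..t}"
      using admissible_integrable(1)[OF w] st by (auto intro: integrable_on_subinterval)
    have "integral {0..t} w - integral {0..s} w = integral {s..t} w"
      using Henstock_Kurzweil_Integration.integral_combine[of 0 s t w] st i by (simp add: algebra_simps)
    then show ?thesis
      using w average_in_closed_convex[OF compact_imp_closed[OF U(2)] U(3) i(2) st(2)] by (simp add: admissible_def)
  qed
  then show ?thesis using T by (auto simp: primitives_def)
qed

text \<open>The converse: the curve is Lipschitz, hence has a density, which is almost everywhere
  the derivative of the curve and so a limit of quotients in the closed set
  \<open>U\<close>.\<close>

lemma primitive_has_density:
  assumes y: "y \<in> primitives"
  obtains w where "admissible w" "\<And>t. t \<in> {0..T} \<Longrightarrow> integral {0..t} w = y t"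
proof -
  obtain B where B: "B \<ge> 0" "\<And>u. u \<in> U \<Longrightarrow> norm u \<le> B" by (rule control_bound) blast
  obtain u0 where u0: "u0 \<in> U" using U(1) by blast
  \<comment> \<open>A curve in \<open>primitives\<close> may jump to 0 past \<open>T\<close>;
    clamping the time makes it Lipschitz on the whole line.\<close>
  define p where "p = (\<lambda>t. max 0 (min T t))"
  have p: "p t \<in> {0..T}" "\<bar>p t - p s\<bar> \<le> \<bar>t - s\<bar>" "t \<in> {0..T} \<Longrightarrow> p t = t" for s t
    using T by (auto simp: p_def max_def min_def)
  have "norm (y (p t) - y (p s)) \<le> B * \<bar>t - s\<bar>" for s t
    using order.trans[OF primitives_Lipschitz[OF B(2) y p(1) p(1)] mult_left_mono[OF p(2) B(1)]] by blast
  from Lipschitz_has_density[OF this] obtain g where g: "g \<in> borel_measurable borel"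
    "\<And>a b. a \<le> b \<Longrightarrow> (g has_integral (y (p b) - y (p a))) {a..b}" by metis
  have gI: "g integrable_on {0..T}" using g(2)[of 0 T] T by auto
  have g_eq: "integral {0..t} g = y t" if "t \<in> {0..T}" for t
    using integral_unique[OF g(2)[of 0 t]] that T p(3)[of 0] p(3)[of t] y by (auto simp: primitives_def)
  have "AE t in lebesgue_on {0..T}. t \<in> {0..T}" by (simp add: AE_restrict_space_iff)
  with indefinite_integral_has_vector_derivative_AE[OF gI]
  have gU: "AE t in lebesgue_on {0..T}. g t \<in> U"
  proof eventually_elim
    case (elim t)
    then have "(y has_vector_derivative g t) (at t within {0..T})"
      using g_eq by (intro has_vector_derivative_transform[OF elim(2) _ elim(1)]) auto
    then show ?case
      by (rule has_vector_derivative_in_closed[OF _ elim(2) T compact_imp_closed[OF U(2)]])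
        (use y in \<open>auto simp: primitives_def\<close>)
  qed
  define w where "w = (\<lambda>t. if g t \<in> U then g t else u0)"
  have ae: "AE t in lebesgue_on {0..T}. g t = w t"
    using gU by eventually_elim (simp add: w_def)
  have "U \<in> sets borel" using compact_imp_closed[OF U(2)] by (rule borel_closed)
  from measurable_sets[OF g(1) this] have sU: "{t \<in> space borel. g t \<in> U} \<in> sets borel"
    by (simp add: vimage_def)
  have "w \<in> borel_measurable borel"
    unfolding w_def by (rule measurable_If[OF g(1) _ sU]) simp
  then have "w \<in> borel_measurable (lebesgue_on {0..T})"
    by (intro measurable_restrict_space1 measurable_completion) simp
  then have w: "admissible w" using u0 by (simp add: admissible_def w_def)
  moreover have "integral {0..t} w = y t" if t: "t \<in> {0..T}" for t
  proof -
    have "AE s in lebesgue. s \<notin> {s \<in> {0..T}. g s \<noteq> w s}"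
      using ae by (auto simp: AE_restrict_space_iff elim: eventually_mono)
    then have "negligible {s \<in> {0..T}. g s \<noteq> w s}"
      by (simp add: negligible_iff_null_sets completion.null_sets_iff_AE)
    then have "integral {0..t} w = integral {0..t} g"
      by (rule integral_spike) (use t in auto)
    then show ?thesis using g_eq[OF t] by simp
  qed
  ultimately show ?thesis by (rule that)
qed

section \<open>Weak continuity of the passage from primitives to controls\<close>

definition density_of :: "(real \<Rightarrow> real^'m) \<Rightarrow> real \<Rightarrow> real^'m" where
  "density_of y = (SOME w. admissible w \<and> (\<forall>t\<in>{0..T}. integral {0..t} w = y t))"

lemma density_of:
  assumes "y \<in> primitives"
  shows "admissible (density_of y)" "t \<in> {0..T} \<Longrightarrow> integral {0..t} (density_of y) = y t"
proof -
  have "\<exists>w. admissible w \<and> (\<forall>t\<in>{0..T}. integral {0..t} w = y t)"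
    using primitive_has_density[OF assms] by metis
  from someI_ex[OF this] show "admissible (density_of y)" "t \<in> {0..T} \<Longrightarrow> integral {0..t} (density_of y) = y t"
    by (auto simp: density_of_def)
qed

text \<open>The weak pairing with \<open>v\<close>, read as a function of the primitive. Its
  continuity for every integrable \<open>v\<close> is what makes the control depend continuously on
  its primitive.\<close>

definition pairing :: "(real \<Rightarrow> real^'m) \<Rightarrow> (real \<Rightarrow> real^'m) \<Rightarrow> real" where
  "pairing v y = (\<integral>t. density_of y t \<bullet> v t \<partial>lebesgue_on {0..T})"

lemma density_inner_integrable:
  assumes v: "integrable (lebesgue_on {0..T}) v" and w: "admissible w"
  shows "integrable (lebesgue_on {0..T}) (\<lambda>t. w t \<bullet> v t)"
proof -
  obtain B where B: "B \<ge> 0" "\<And>u. u \<in> U \<Longrightarrow> norm u \<le> B" by (rule control_bound) blast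
  have "integrable (lebesgue_on {0..T}) (\<lambda>t. B * norm (v t))" using v by simp
  then show ?thesis
  proof (rule Bochner_Integration.integrable_bound)
    show "(\<lambda>t. w t \<bullet> v t) \<in> borel_measurable (lebesgue_on {0..T})"
      using v w by (auto simp: admissible_def)
    have "\<bar>w t \<bullet> v t\<bar> \<le> B * norm (v t)" for t
      using order.trans[OF Cauchy_Schwarz_ineq2 mult_right_mono[OF B(2)]] w by (auto simp: admissible_def)
    then show "AE t in lebesgue_on {0..T}. norm (w t \<bullet> v t) \<le> norm (B * norm (v t))"
      using B(1) by auto
  qed
qed

lemma pairing_add:
  assumes "integrable (lebesgue_on {0..T}) v" "integrable (lebesgue_on {0..T}) v'" "y \<in> primitives"
  shows "pairing (\<lambda>t. v t + v' t) y = pairing v y + pairing v' y"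
  using assms density_of(1)[OF assms(3)]
  by (simp add: pairing_def inner_add_right density_inner_integrable)

text \<open>Controls are bounded by \<open>B\<close>, so pairings with \<open>s i\<close> and
  \<open>v\<close> differ by at most \<open>B\<close> times the \<open>L^1\<close> distance,
  uniformly over all primitives. A uniform limit of continuous functions is continuous.\<close>

lemma pairing_continuous_limit:
  assumes cont: "\<And>i::nat. continuous_on primitives (pairing (s i))"
    and s: "\<And>i. integrable (lebesgue_on {0..T}) (s i)" and v: "integrable (lebesgue_on {0..T}) v"
    and lim: "\<And>t. t \<in> {0..T} \<Longrightarrow> (\<lambda>i. s i t) \<longlonglongrightarrow> v t"
    and h: "integrable (lebesgue_on {0..T}) h" and bnd: "\<And>i t. t \<in> {0..T} \<Longrightarrow> norm (s i t) \<le> h t"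
  shows "continuous_on primitives (pairing v)"
proof -
  obtain B where B: "B \<ge> 0" "\<And>u. u \<in> U \<Longrightarrow> norm u \<le> B" by (rule control_bound) blast
  have "(\<lambda>i. \<integral>t. norm (s i t - v t) \<partial>lebesgue_on {0..T}) \<longlonglongrightarrow> (\<integral>t. 0 \<partial>lebesgue_on {0..T})"
  proof (rule integral_dominated_convergence[where w = "\<lambda>t. h t + norm (v t)"])
    show "AE t in lebesgue_on {0..T}. (\<lambda>i. norm (s i t - v t)) \<longlonglongrightarrow> 0"
      by (intro AE_I2 tendsto_norm_zero LIM_zero lim) simp
    show "AE t in lebesgue_on {0..T}. norm (norm (s i t - v t)) \<le> h t + norm (v t)" for i
      by (intro AE_I2) (auto intro!: order.trans[OF norm_triangle_ineq4] bnd)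
  qed (use s v h in auto)
  then have L1: "(\<lambda>i. B * (\<integral>t. norm (s i t - v t) \<partial>lebesgue_on {0..T})) \<longlonglongrightarrow> 0"
    by (intro tendsto_mult_right_zero) simp
  have bound: "\<bar>pairing (s i) y - pairing v y\<bar> \<le> B * (\<integral>t. norm (s i t - v t) \<partial>lebesgue_on {0..T})"
    if y: "y \<in> primitives" for i y
  proof -
    note w = density_of(1)[OF y]
    have "pairing (s i) y - pairing v y = (\<integral>t. density_of y t \<bullet> (s i t - v t) \<partial>lebesgue_on {0..T})"
      unfolding pairing_def using density_inner_integrable[OF s w] density_inner_integrable[OF v w]
      by (simp add: inner_diff_right)
    also have "\<bar>\<dots>\<bar> \<le> (\<integral>t. B * norm (s i t - v t) \<partial>lebesgue_on {0..T})"
      unfolding real_norm_def[symmetric]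
    proof (rule Bochner_Integration.integral_norm_bound_integral)
      have sv: "integrable (lebesgue_on {0..T}) (\<lambda>t. s i t - v t)" using s v by simp
      then show "integrable (lebesgue_on {0..T}) (\<lambda>t. density_of y t \<bullet> (s i t - v t))"
        by (rule density_inner_integrable[OF _ w])
      show "integrable (lebesgue_on {0..T}) (\<lambda>t. B * norm (s i t - v t))" using sv by simp
      show "norm (density_of y t \<bullet> (s i t - v t)) \<le> B * norm (s i t - v t)" for t
        using order.trans[OF Cauchy_Schwarz_ineq2 mult_right_mono[OF B(2)]] w by (auto simp: admissible_def)
    qed
    finally show ?thesis by simp
  qed
  have "uniform_limit primitives (\<lambda>i. pairing (s i)) (pairing v) sequentially"
  proof (rule uniform_limitI)
    fix e :: real assume "e > 0"
    from order_tendstoD(2)[OF L1 this]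
    show "\<forall>\<^sub>F i in sequentially. \<forall>y\<in>primitives. dist (pairing (s i) y) (pairing v y) < e"
    proof eventually_elim
      case (elim i)
      then show ?case using bound[of _ i] by (auto simp: dist_real_def intro: le_less_trans)
    qed
  qed
  then show ?thesis
    by (rule uniform_limit_theorem[rotated]) (simp_all add: cont)
qed

lemma indicator_integrable:
  fixes c :: "real^'m"
  assumes "A \<in> sets lebesgue"
  shows "integrable (lebesgue_on {0..T}) (\<lambda>t. indicator A t *\<^sub>R c)"
proof (rule finite_measure.integrable_const_bound[OF finite_measure_interval, where B = "norm c"])
  have "(indicator A :: real \<Rightarrow> real) \<in> borel_measurable (lebesgue_on {0..T})"
    using assms by (intro measurable_restrict_space1 borel_measurable_indicator)
  then show "(\<lambda>t. indicator A t *\<^sub>R c) \<in> borel_measurable (lebesgue_on {0..T})" by simp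
qed (auto simp: indicator_def)

text \<open>This pairing evaluates the curve at the single time \<open>min a T\<close>, and
  evaluations are continuous in the product topology.\<close>

lemma pairing_atMost_continuous: "continuous_on primitives (pairing (\<lambda>t. indicator {..a} t *\<^sub>R c))"
proof -
  have eq: "pairing (\<lambda>t. indicator {..a} t *\<^sub>R c) y = (if a < 0 then 0 else y (min a T) \<bullet> c)"
    if y: "y \<in> primitives" for y
  proof -
    note w = density_of(1)[OF y]
    have i: "integrable (lebesgue_on {0..T}) (\<lambda>t. density_of y t \<bullet> (indicator {..a} t *\<^sub>R c))"
      by (rule density_inner_integrable[OF indicator_integrable w]) simp
    have "pairing (\<lambda>t. indicator {..a} t *\<^sub>R c) y = integral {0..T} (\<lambda>t. density_of y t \<bullet> (indicator {..a} t *\<^sub>R c))"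
      unfolding pairing_def by (rule lebesgue_integral_eq_integral[OF i]) simp
    also have "(\<lambda>t. density_of y t \<bullet> (indicator {..a} t *\<^sub>R c)) = (\<lambda>t. if t \<in> {..a} then density_of y t \<bullet> c else 0)"
      by (auto simp: indicator_def)
    also have "integral {0..T} \<dots> = integral ({..a} \<inter> {0..T}) (\<lambda>t. density_of y t \<bullet> c)"
      by (rule integral_restrict_Int)
    also have "\<dots> = (if a < 0 then 0 else y (min a T) \<bullet> c)"
    proof (cases "a < 0")
      case True
      then have "{..a} \<inter> {0..T} = {}" by auto
      then show ?thesis using True by simp
    next
      case False
      then have m: "min a T \<in> {0..T}" "{..a} \<inter> {0..T} = {0..min a T}" using T by auto
      have "density_of y integrable_on {0..min a T}"
        using admissible_integrable(1)[OF w] by (rule integrable_on_subinterval) auto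
      then have "integral {0..min a T} (\<lambda>t. density_of y t \<bullet> c) = integral {0..min a T} (density_of y) \<bullet> c"
        using integral_linear[OF _ bounded_linear_inner_left[of c], of "density_of y" "{0..min a T}"] by (simp add: o_def)
      then show ?thesis using False density_of(2)[OF y m(1)] m(2) by simp
    qed
    finally show ?thesis .
  qed
  have "continuous_on primitives (\<lambda>y. if a < 0 then 0 else y (min a T) \<bullet> c)"
    by (cases "a < 0") (auto intro!: continuous_intros intro: continuous_on_subset[OF continuous_on_product_coordinates])
  then show ?thesis by (rule continuous_on_eq) (simp add: eq)
qed

text \<open>The Borel sets with continuous pairing form a Dynkin system that contains the
  half-lines, an intersection-stable generator.\<close>

lemma pairing_borel_continuous:
  assumes "A \<in> sets borel"
  shows "continuous_on primitives (pairing (\<lambda>t. indicator A t *\<^sub>R c))"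
proof -
  have "Int_stable (range (\<lambda>a::real. {..a}))"
    by (auto simp: Int_stable_def)
  moreover have "range (\<lambda>a::real. {..a}) \<subseteq> Pow UNIV" by simp
  moreover have "A \<in> sigma_sets UNIV (range (\<lambda>a::real. {..a}))"
    using assms by (simp add: borel_eq_atMost)
  ultimately show ?thesis
  proof (induction A rule: sigma_sets_induct_disjoint)
    case (basic A)
    then show ?case using pairing_atMost_continuous by auto
  next
    case empty
    then show ?case by (simp add: pairing_def)
  next
    case (compl A)
    then have A: "A \<in> sets borel" by (simp add: borel_eq_atMost)
    \<comment> \<open>The half-line up to \<open>T\<close> replaces the whole line: both have the
      same trace on \<open>{0..T}\<close>.\<close>
    have "pairing (\<lambda>t. indicator (UNIV - A) t *\<^sub>R c) y
        = pairing (\<lambda>t. indicator {..T} t *\<^sub>R c) y - pairing (\<lambda>t. indicator A t *\<^sub>R c) y"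
      if y: "y \<in> primitives" for y
    proof -
      have "pairing (\<lambda>t. indicator {..T} t *\<^sub>R c) y
          = pairing (\<lambda>t. indicator (UNIV - A) t *\<^sub>R c + indicator A t *\<^sub>R c) y"
        unfolding pairing_def by (intro Bochner_Integration.integral_cong) (auto simp: indicator_def)
      also have "\<dots> = pairing (\<lambda>t. indicator (UNIV - A) t *\<^sub>R c) y + pairing (\<lambda>t. indicator A t *\<^sub>R c) y"
        using A y by (intro pairing_add indicator_integrable) auto
      finally show ?thesis by simp
    qed
    moreover have "continuous_on primitives (\<lambda>y. pairing (\<lambda>t. indicator {..T} t *\<^sub>R c) y - pairing (\<lambda>t. indicator A t *\<^sub>R c) y)"
      using compl pairing_atMost_continuous by (intro continuous_on_diff) auto
    ultimately show ?case by (metis (no_types, lifting) continuous_on_eq)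
  next
    case (union A)
    then have A: "A i \<in> sets borel" for i by (auto simp: borel_eq_atMost)
    \<comment> \<open>Finite disjoint unions give sums of pairings; the countable union is an
      \<open>L^1\<close> limit dominated by the constant \<open>norm c\<close>.\<close>
    define s where "s = (\<lambda>n t. indicator (\<Union>i<n. A i) t *\<^sub>R c)"
    have s_cont: "continuous_on primitives (pairing (s n))" for n
    proof (induction n)
      case (Suc n)
      have "pairing (s (Suc n)) y = pairing (s n) y + pairing (\<lambda>t. indicator (A n) t *\<^sub>R c) y"
        if y: "y \<in> primitives" for y
      proof -
        have "A n \<inter> (\<Union>i<n. A i) = {}"
        proof (rule equals0I)
          fix t assume "t \<in> A n \<inter> (\<Union>i<n. A i)"
          then obtain i where "i < n" "t \<in> A n" "t \<in> A i" by auto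
          then show False using disjoint_family_onD[OF union(1), of n i] by auto
        qed
        then have "s (Suc n) = (\<lambda>t. s n t + indicator (A n) t *\<^sub>R c)"
          by (auto simp: s_def lessThan_Suc indicator_def fun_eq_iff)
        moreover have "integrable (lebesgue_on {0..T}) (s n)"
          unfolding s_def using A by (intro indicator_integrable) auto
        moreover have "integrable (lebesgue_on {0..T}) (\<lambda>t. indicator (A n) t *\<^sub>R c)"
          using A by (intro indicator_integrable) auto
        ultimately show ?thesis using pairing_add[OF _ _ y] by (simp only:)
      qed
      moreover have "continuous_on primitives (\<lambda>y. pairing (s n) y + pairing (\<lambda>t. indicator (A n) t *\<^sub>R c) y)"
        by (intro continuous_on_add Suc union)
      ultimately show ?case by (metis (no_types, lifting) continuous_on_eq)
    qed (simp add: s_def pairing_def)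
    show ?case
    proof (rule pairing_continuous_limit[OF s_cont, where h = "\<lambda>_. norm c"])
      show "integrable (lebesgue_on {0..T}) (s i)" for i
        unfolding s_def using A by (intro indicator_integrable) auto
      show "integrable (lebesgue_on {0..T}) (\<lambda>t. indicator (\<Union> (range A)) t *\<^sub>R c)"
        using A by (intro indicator_integrable) auto
      show "integrable (lebesgue_on {0..T}) (\<lambda>_. norm c)"
        using finite_measure_interval[of T] by (simp add: finite_measure.integrable_const)
      show "norm (s i t) \<le> norm c" for i t by (auto simp: s_def indicator_def)
      show "(\<lambda>n. s n t) \<longlonglongrightarrow> indicator (\<Union> (range A)) t *\<^sub>R c" for t
        unfolding s_def by (intro tendsto_intros LIMSEQ_indicator_UN)
    qed
  qed
qed

text \<open>From Borel indicators to Lebesgue indicators by discarding a null set, then to sums and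
  dominated limits.\<close>

lemma pairing_continuous:
  assumes "integrable (lebesgue_on {0..T}) v"
  shows "continuous_on primitives (pairing v)"
  using assms
proof (induction rule: integrable_induct)
  case (base A c)
  then have "A \<in> sets lebesgue" by (simp add: sets_restrict_space_iff)
  then obtain S N N' where S: "A = S \<union> N" "N \<subseteq> N'" "N' \<in> null_sets lborel" "S \<in> sets borel"
    by (rule sets_completionE) auto
  have "AE t in lebesgue. t \<notin> N'" using S(3) by (intro AE_not_in null_sets_completionI)
  then have ae: "AE t in lebesgue_on {0..T}. t \<notin> N'" by (auto simp: AE_restrict_space_iff elim: eventually_mono)
  have "pairing (\<lambda>t. indicator A t *\<^sub>R c) y = pairing (\<lambda>t. indicator S t *\<^sub>R c) y" if y: "y \<in> primitives" for y
    unfolding pairing_def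
  proof (rule integral_cong_AE)
    show "(\<lambda>t. density_of y t \<bullet> indicator A t *\<^sub>R c) \<in> borel_measurable (lebesgue_on {0..T})"
      "(\<lambda>t. density_of y t \<bullet> indicator S t *\<^sub>R c) \<in> borel_measurable (lebesgue_on {0..T})"
      using \<open>A \<in> sets lebesgue\<close> S(4)
      by (intro borel_measurable_integrable density_inner_integrable indicator_integrable density_of(1) y; simp)+
    show "AE t in lebesgue_on {0..T}. density_of y t \<bullet> indicator A t *\<^sub>R c = density_of y t \<bullet> indicator S t *\<^sub>R c"
      using ae by eventually_elim (use S in \<open>auto simp: indicator_def\<close>)
  qed
  then show ?case
    using pairing_borel_continuous[OF S(4), of c] by (metis (no_types, lifting) continuous_on_eq)
next
  case (add v v')
  have "continuous_on primitives (\<lambda>y. pairing v y + pairing v' y)"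
    by (intro continuous_on_add add)
  then show ?case by (rule continuous_on_eq) (simp add: pairing_add add)
next
  case (lim v s)
  show ?case
    by (rule pairing_continuous_limit[where s = s and h = "\<lambda>t. 2 * norm (v t)"]) (use lim in auto)
qed

text \<open>The space of controls is the image of the compact set of primitives under a map that the
  pairings show to be weakly continuous.\<close>

lemma compact_space_control_top: "compact_space control_top"
proof -
  define D where "D = (\<lambda>y. L2_eq T `` {density_of y})"
  have "continuous_map (top_of_set primitives) control_top D"
  proof (rule continuous_map_into_control_top)
    show "D \<in> topspace (top_of_set primitives) \<rightarrow> controls T U"
      using admissible_class(1)[OF density_of(1)] by (auto simp: D_def)
    fix v :: "real \<Rightarrow> real^'m" assume v: "v \<in> L2_fun T"
    have "integrable (lebesgue_on {0..T}) v"
    proof (rule Bochner_Integration.integrable_bound)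
      show "integrable (lebesgue_on {0..T}) (\<lambda>t. 1 + (norm (v t))\<^sup>2)"
        using v finite_measure_interval[of T] by (auto simp: L2_fun_def finite_measure.integrable_const)
      have "norm (v t) \<le> 1 + (norm (v t))\<^sup>2" for t
        using zero_le_power2[of "norm (v t) - 1"] norm_ge_zero[of "v t"]
        unfolding power2_diff power_one mult_1_right by linarith
      then show "AE t in lebesgue_on {0..T}. norm (v t) \<le> norm (1 + (norm (v t))\<^sup>2)" by auto
    qed (use v in \<open>simp add: L2_fun_def\<close>)
    then have "continuous_on primitives (pairing v)" by (rule pairing_continuous)
    moreover have "pairing v y = (\<integral>t. rep (D y) t \<bullet> v t \<partial>lebesgue_on {0..T})" if y: "y \<in> primitives" for y
    proof -
      note w = density_of(1)[OF y]
      have "AE t in lebesgue_on {0..T}. density_of y t = rep (D y) t"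
        using admissible_class(2)[OF w] by (auto simp: D_def elim: eventually_mono)
      moreover have "rep (D y) \<in> L2_fun T"
        unfolding D_def using rep_mem_L2(2) L2_eq_class(1)[OF admissible_L2_fun[OF w]] by blast
      ultimately show ?thesis
        unfolding pairing_def using admissible_L2_fun[OF w] v by (intro L2_fun_mono_AE_integral) auto
    qed
    ultimately show "continuous_map (top_of_set primitives) euclideanreal (\<lambda>y. \<integral>t. rep (D y) t \<bullet> v t \<partial>lebesgue_on {0..T})"
      by (simp add: continuous_on_eq)
  qed
  moreover have "compact_space (top_of_set primitives)"
    using compact_primitives by (simp add: compact_space_subtopology)
  moreover have "D ` primitives = controls T U"
  proof (intro equalityI subsetI)
    fix \<phi> assume \<phi>: "\<phi> \<in> controls T U"
    then obtain w where w: "admissible w" "AE t in lebesgue_on {0..T}. rep \<phi> t = w t"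
      by (rule control_representative)
    define y where "y = (\<lambda>t. if t \<in> {0..T} then integral {0..t} w else 0)"
    have y: "y \<in> primitives" unfolding y_def by (rule primitive_of_admissible[OF w(1)])
    note d = density_of(1)[OF y]
    \<comment> \<open>Surjectivity: a control and the density chosen for its primitive have the same
      integrals, so differentiating both shows that they agree almost everywhere.\<close>
    have eq: "integral {0..t} w = integral {0..t} (density_of y)" if "t \<in> {0..T}" for t
      using density_of(2)[OF y that] that by (simp add: y_def)
    have "AE t in lebesgue_on {0..T}. t \<in> {0..T}" by (simp add: AE_restrict_space_iff)
    with indefinite_integral_has_vector_derivative_AE[OF admissible_integrable(1)[OF w(1)]]
      indefinite_integral_has_vector_derivative_AE[OF admissible_integrable(1)[OF d]]
    have "AE t in lebesgue_on {0..T}. w t = density_of y t"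
    proof eventually_elim
      case (elim t)
      have "((\<lambda>t. integral {0..t} w) has_vector_derivative density_of y t) (at t within {0..T})"
        using eq by (intro has_vector_derivative_transform[OF elim(3) _ elim(2)]) auto
      then show ?case
        using elim(1,3) T by (intro vector_derivative_unique_within_closed_interval[of 0 T]) auto
    qed
    with w(2) admissible_class(2)[OF d] have "AE t in lebesgue_on {0..T}. rep \<phi> t = rep (D y) t"
      unfolding D_def by eventually_elim simp
    then have "\<phi> = D y"
      using \<phi> admissible_class(1)[OF d] controls_subset_L2 by (intro L2_eqI) (auto simp: D_def)
    then show "\<phi> \<in> D ` primitives" using y by blast
  qed (use admissible_class(1)[OF density_of(1)] in \<open>auto simp: D_def\<close>)
  ultimately show ?thesis
    using image_compactin[of "top_of_set primitives" primitives control_top D]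
    by (simp add: compact_space_def topspace_control_top)
qed

end

section \<open>Compact spaces as continuous images of compact sets of reals\<close>

lemma ternary_tail_bound:
  fixes b :: "nat \<Rightarrow> bool"
  shows "summable (\<lambda>k. of_bool (b k) * (2 / 3 ^ Suc k) :: real)"
    "(\<Sum>k. of_bool (b (k + n)) * (2 / 3 ^ Suc (k + n)) :: real) \<le> 1 / 3 ^ n"
proof -
  have geo: "summable (\<lambda>k. 2 / 3 ^ Suc (k + n) :: real)" for n
  proof -
    have "summable (\<lambda>k. (2 / 3 ^ Suc n) * (1 / 3) ^ k :: real)"
      by (intro summable_mult summable_geometric) simp
    then show ?thesis by (simp add: power_add power_divide mult_ac)
  qed
  show "summable (\<lambda>k. of_bool (b k) * (2 / 3 ^ Suc k) :: real)"
    by (rule summable_comparison_test'[OF geo[of 0], of 0]) auto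
  have "(\<Sum>k. of_bool (b (k + n)) * (2 / 3 ^ Suc (k + n)) :: real) \<le> (\<Sum>k. 2 / 3 ^ Suc (k + n))"
    by (intro suminf_le geo summable_comparison_test'[OF geo[of n], of 0]) auto
  also have "\<dots> = (2 / 3 ^ Suc n) * (\<Sum>k. (1 / 3) ^ k)"
    by (subst suminf_mult[symmetric]) (auto simp: power_add power_divide mult_ac intro!: summable_geometric)
  also have "\<dots> = 1 / 3 ^ n" by (subst suminf_geometric) (auto simp: field_simps)
  finally show "(\<Sum>k. of_bool (b (k + n)) * (2 / 3 ^ Suc (k + n)) :: real) \<le> 1 / 3 ^ n" .
qed

text \<open>The Cantor set parametrization. Injectivity turns a compact set of digit sequences into
  a homeomorphic compact set of reals.\<close>

definition ternary :: "(nat \<Rightarrow> bool) \<Rightarrow> real" where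
  "ternary b = (\<Sum>k. of_bool (b k) * (2 / 3 ^ Suc k))"

text \<open>Base 2 reaches every number in the half-open unit interval; the injectivity lost by it
  is supplied by \<open>ternary\<close>.\<close>

definition binary :: "(nat \<Rightarrow> bool) \<Rightarrow> real" where
  "binary b = (\<Sum>k. of_bool (b k) * (1 / 2 ^ Suc k))"

lemma continuous_on_of_bool_coordinate:
  "continuous_on S (\<lambda>b::nat \<Rightarrow> bool. of_bool (b k) :: real)"
proof -
  have "continuous_on UNIV (\<lambda>x::bool. of_bool x :: real)"
    by (simp add: continuous_on_discrete)
  from continuous_on_compose2[OF this continuous_on_subset[OF continuous_on_product_coordinates]]
  show ?thesis by auto
qed

lemma continuous_on_digit_series:
  assumes "summable a" "\<And>k. a k \<ge> (0::real)"
  shows "continuous_on S (\<lambda>b::nat \<Rightarrow> bool. \<Sum>k. of_bool (b k) * a k)"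
proof (rule uniform_limit_theorem[OF always_eventually])
  show "uniform_limit S (\<lambda>n b. \<Sum>k<n. of_bool (b k) * a k) (\<lambda>b. \<Sum>k. of_bool (b k) * a k) sequentially"
    using assms by (intro Weierstrass_m_test[where M = a]) auto
  show "\<forall>n. continuous_on S (\<lambda>b::nat \<Rightarrow> bool. \<Sum>k<n. of_bool (b k) * a k)"
    by (intro allI continuous_on_sum continuous_on_mult continuous_on_of_bool_coordinate continuous_on_const)
qed simp

lemma continuous_on_ternary: "continuous_on S ternary"
  unfolding ternary_def using ternary_tail_bound(1)[of "\<lambda>_. True"]
  by (intro continuous_on_digit_series) auto

lemma summable_binary: "summable (\<lambda>k. 1 / 2 ^ Suc k :: real)"
  using summable_mult[OF summable_geometric[of "1 / 2 :: real"], of "1 / 2"] by (simp add: power_divide)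

lemma continuous_on_binary: "continuous_on S binary"
  unfolding binary_def by (intro continuous_on_digit_series summable_binary) auto

text \<open>At the first index \<open>n\<close> where the sequences differ, one gains
  \<open>2 / 3 ^ Suc n\<close>, while all later digits of the other amount to at most
  \<open>1 / 3 ^ Suc n\<close>.\<close>

lemma inj_ternary: "inj ternary"
proof (rule injI, rule ccontr)
  fix b c assume eq: "ternary b = ternary c" and ne: "b \<noteq> c"
  have lt: "ternary c < ternary b"
    if n: "\<And>k. k < n \<Longrightarrow> b k = c k" "b n" "\<not> c n" for b c n
  proof -
    have split: "ternary d = (\<Sum>k. of_bool (d (k + Suc n)) * (2 / 3 ^ Suc (k + Suc n)))
        + (\<Sum>k<Suc n. of_bool (d k) * (2 / 3 ^ Suc k))" for d
      unfolding ternary_def by (rule suminf_split_initial_segment[OF ternary_tail_bound(1)])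
    have "(\<Sum>k<n. of_bool (b k) * (2 / 3 ^ Suc k)) = (\<Sum>k<n. of_bool (c k) * (2 / 3 ^ Suc k) :: real)"
      using n(1) by (intro sum.cong) auto
    moreover have "0 \<le> (\<Sum>k. of_bool (b (k + Suc n)) * (2 / 3 ^ Suc (k + Suc n)) :: real)"
      by (intro suminf_nonneg summable_ignore_initial_segment[OF ternary_tail_bound(1)]) auto
    moreover have "(1::real) / 3 ^ Suc n < 2 / 3 ^ Suc n" by (intro divide_strict_right_mono) auto
    ultimately show ?thesis
      using split[of b] split[of c] n(2,3) ternary_tail_bound(2)[of c "Suc n"] by simp
  qed
  have "\<exists>n. b n \<noteq> c n" using ne by auto
  then obtain n where "b n \<noteq> c n" and "\<And>k. k < n \<Longrightarrow> b k = c k"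
    using exists_least_iff[of "\<lambda>n. b n \<noteq> c n"] by blast
  then show False using lt[of n b c] lt[of n c b] eq by (cases "b n") auto
qed

text \<open>The digits are the parities of \<open>\<lfloor>2 ^ Suc k * x\<rfloor>\<close>, so the
  partial sums are the dyadic truncations of \<open>x\<close>. The bound \<open>x < 1\<close> makes
  the empty partial sum correct.\<close>

lemma binary_surj:
  assumes "0 \<le> x" "x < (1::real)"
  obtains b where "binary b = x"
proof -
  define b where "b = (\<lambda>k. odd \<lfloor>2 ^ Suc k * x\<rfloor>)"
  have step: "\<lfloor>2 * y\<rfloor> = 2 * \<lfloor>y\<rfloor> + of_bool (odd \<lfloor>2 * y\<rfloor>)" for y :: real
  proof -
    have "2 * \<lfloor>y\<rfloor> \<le> \<lfloor>2 * y\<rfloor>" "\<lfloor>2 * y\<rfloor> \<le> 2 * \<lfloor>y\<rfloor> + 1" by linarith+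
    then show ?thesis by (auto elim: evenE oddE)
  qed
  have partial: "(\<Sum>k<n. of_bool (b k) * (1 / 2 ^ Suc k)) = real_of_int \<lfloor>2 ^ n * x\<rfloor> / 2 ^ n" for n
  proof (induction n)
    case 0
    then show ?case using assms by (simp add: floor_eq_iff)
  next
    case (Suc n)
    have "real_of_int \<lfloor>2 ^ Suc n * x\<rfloor> = 2 * real_of_int \<lfloor>2 ^ n * x\<rfloor> + of_bool (b n)"
      using arg_cong[OF step[of "2 ^ n * x"], of real_of_int]
      unfolding of_int_add of_int_mult of_int_numeral of_int_of_bool b_def power_Suc mult.assoc .
    then show ?case using Suc by (simp add: field_simps)
  qed
  have "(\<lambda>n. real_of_int \<lfloor>2 ^ n * x\<rfloor> / 2 ^ n) \<longlonglongrightarrow> x"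
  proof (rule tendsto_sandwich[OF always_eventually always_eventually])
    show "\<forall>n. x - (1 / 2) ^ n \<le> real_of_int \<lfloor>2 ^ n * x\<rfloor> / 2 ^ n"
    proof
      fix n
      have "2 ^ n * x - 1 \<le> real_of_int \<lfloor>2 ^ n * x\<rfloor>" by linarith
      from divide_right_mono[OF this, of "2 ^ n"]
      show "x - (1 / 2) ^ n \<le> real_of_int \<lfloor>2 ^ n * x\<rfloor> / 2 ^ n" by (simp add: diff_divide_distrib power_divide)
    qed
    show "\<forall>n. real_of_int \<lfloor>2 ^ n * x\<rfloor> / 2 ^ n \<le> x" by (simp add: field_simps)
    have "(\<lambda>n. x - (1 / 2) ^ n) \<longlonglongrightarrow> x - 0" by (intro tendsto_intros LIMSEQ_power_zero) auto
    then show "(\<lambda>n. x - (1 / 2) ^ n) \<longlonglongrightarrow> x" by simp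
  qed simp
  then have "(\<lambda>k. of_bool (b k) * (1 / 2 ^ Suc k)) sums x"
    unfolding sums_def partial .
  then have "binary b = x" by (simp add: binary_def sums_iff)
  then show ?thesis by (rule that)
qed

lemma compact_UNIV_bool_sequences: "compact (UNIV :: (nat \<Rightarrow> bool) set)"
  using compactin_PiE[of "\<lambda>_::nat. euclidean :: bool topology" UNIV "\<lambda>_. UNIV"]
  by (simp add: euclidean_product_topology finite_imp_compact)

text \<open>The coordinates \<open>h\<close> embed \<open>X\<close> into a countable product of unit intervals, which is a
  continuous image of the Cantor set; the preimage of \<open>X\<close> there is the required compact set.\<close>

lemma compact_space_continuous_image_of_reals:
  fixes h :: "nat \<Rightarrow> 'a \<Rightarrow> real"
  assumes X: "compact_space X" and h: "\<And>i. continuous_map X euclideanreal (h i)"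
    and sep: "\<And>x y. \<lbrakk>x \<in> topspace X; y \<in> topspace X; \<And>i. h i x = h i y\<rbrakk> \<Longrightarrow> x = y"
  obtains C :: "real set" and g where "compact C" "continuous_map (top_of_set C) X g" "g ` C = topspace X"
proof -
  \<comment> \<open>Since \<open>arctan\<close> has modulus below \<open>pi / 2 < 2\<close>, the
    coordinates are squeezed injectively into the unit interval.\<close>
  define h' where "h' = (\<lambda>i x. arctan (h i x) / 4 + 1 / 2)"
  have h'_range: "0 \<le> h' i x" "h' i x < 1" for i x
    using arctan_lbound[of "h i x"] arctan_ubound[of "h i x"] pi_less_4 by (auto simp: h'_def)
  have h'_eq: "h' i x = h' i y \<longleftrightarrow> h i x = h i y" for i x y by (simp add: h'_def arctan_eq_iff)
  have h'_cont: "continuous_map X euclideanreal (h' i)" for i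
  proof -
    have "continuous_map euclideanreal euclideanreal (\<lambda>r. arctan r / 4 + 1 / 2)"
      by (simp add: continuous_intros)
    from continuous_map_compose[OF h this] show ?thesis by (simp add: h'_def o_def)
  qed
  define H where "H = (\<lambda>x i. h' i x)"
  have H_cont: "continuous_map X euclidean H"
    using continuous_map_coordinatewise_then_product[of UNIV X "\<lambda>_. euclideanreal" H] h'_cont
    by (simp add: H_def euclidean_product_topology)
  have H_inj: "inj_on H (topspace X)"
    using sep h'_eq by (auto simp: inj_on_def H_def fun_eq_iff)
  have "compactin euclidean (H ` topspace X)"
    using image_compactin[OF _ H_cont] X by (auto simp: compact_space_def)
  then have K: "compact (H ` topspace X)" by simp
  \<comment> \<open>\<open>prod_encode\<close> splits one digit sequence into countably many, one
    for each coordinate.\<close>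
  define \<beta> where "\<beta> = (\<lambda>b i. binary (\<lambda>j. b (prod_encode (i, j))))"
  have \<beta>_cont: "continuous_on S \<beta>" for S
    unfolding \<beta>_def
  proof (rule continuous_on_coordinatewise_then_product)
    fix i
    have "continuous_on S (\<lambda>b j. b (prod_encode (i, j)) :: bool)"
      by (intro continuous_on_coordinatewise_then_product continuous_on_subset[OF continuous_on_product_coordinates]) auto
    from continuous_on_compose2[OF continuous_on_binary this] 
    show "continuous_on S (\<lambda>b. binary (\<lambda>j. b (prod_encode (i, j))))" by auto
  qed
  have \<beta>_surj: "\<exists>b. \<beta> b = H x" for x
  proof -
    have "\<exists>b. binary b = h' i x" for i using binary_surj[OF h'_range] by metis
    then obtain b where b: "\<And>i. binary (b i) = h' i x" by metis
    have "\<beta> (\<lambda>n. b (fst (prod_decode n)) (snd (prod_decode n))) = H x"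
      by (simp add: \<beta>_def H_def b)
    then show ?thesis by blast
  qed
  define D where "D = \<beta> -` (H ` topspace X)"
  have "closed D"
    unfolding D_def by (rule closed_vimage[OF compact_imp_closed[OF K] \<beta>_cont])
  then have D: "compact D" using compact_Int_closed[OF compact_UNIV_bool_sequences, of D] by simp
  define C where "C = ternary ` D"
  have "compact C" unfolding C_def by (rule compact_continuous_image[OF continuous_on_ternary D])
  define \<tau> where "\<tau> = inv_into D ternary"
  have \<tau>: "continuous_on C \<tau>" unfolding C_def \<tau>_def
    using inj_ternary by (intro continuous_on_inv continuous_on_ternary D) (auto intro: inv_into_f_f inj_on_subset)
  have \<tau>_image: "\<tau> ` C = D"
    unfolding \<tau>_def C_def using inj_ternary by (intro inv_into_image_cancel) (auto intro: inj_on_subset)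
  define g where "g = (\<lambda>c. inv_into (topspace X) H (\<beta> (\<tau> c)))"
  have inv_cont: "continuous_map (top_of_set (H ` topspace X)) X (inv_into (topspace X) H)"
  proof -
    have "homeomorphic_map X (top_of_set (H ` topspace X)) H"
    proof (rule continuous_imp_homeomorphic_map)
      show "Hausdorff_space (top_of_set (H ` topspace X))"
        by (rule Hausdorff_space_subtopology) simp
      show "continuous_map X (top_of_set (H ` topspace X)) H"
        using H_cont by (simp add: continuous_map_in_subtopology)
    qed (use H_inj X in auto)
    then obtain k where k: "homeomorphic_maps X (top_of_set (H ` topspace X)) H k"
      by (auto simp: homeomorphic_map_maps)
    then have "continuous_map (top_of_set (H ` topspace X)) X k" and kH: "\<And>x. x \<in> topspace X \<Longrightarrow> k (H x) = x"
      by (auto simp: homeomorphic_maps_def)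
    then show ?thesis
      using H_inj by (elim continuous_map_eq) (auto simp: inv_into_f_f)
  qed
  have "continuous_map (top_of_set C) (top_of_set (H ` topspace X)) (\<lambda>c. \<beta> (\<tau> c))"
    using continuous_on_compose2[OF \<beta>_cont \<tau>, of UNIV] \<tau>_image by (auto simp: D_def continuous_map_in_subtopology)
  from continuous_map_compose[OF this inv_cont] have g_cont: "continuous_map (top_of_set C) X g"
    by (simp add: g_def o_def)
  have "g ` C = topspace X"
  proof -
    have "g ` C = inv_into (topspace X) H ` (\<beta> ` D)" by (simp add: g_def \<tau>_image[symmetric] image_image)
    also have "\<beta> ` D = H ` topspace X"
    proof -
      have "H ` topspace X \<subseteq> range \<beta>" using \<beta>_surj by (metis image_subsetI rangeI)
      then show ?thesis by (auto simp: D_def image_vimage_eq)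
    qed
    finally show ?thesis using H_inj by simp
  qed
  with \<open>compact C\<close> g_cont show ?thesis by (rule that)
qed

section \<open>Narrow compactness of probability measures\<close>

lemma openin_in_sets_borel_of:
  assumes "openin X S" shows "S \<in> sets (borel_of X)"
  unfolding borel_of_def using assms
  by (subst sets_measure_of) (auto dest: openin_subset intro: sigma_sets.Basic)

lemma closedin_in_sets_borel_of:
  assumes "closedin X S" shows "S \<in> sets (borel_of X)"
proof -
  have "openin X (topspace X - S)" using assms by (simp add: closedin_def)
  from sets.Diff[OF sets.top openin_in_sets_borel_of[OF this]]
  show ?thesis using closedin_subset[OF assms] by (simp add: space_borel_of double_diff)
qed

lemma measurable_borel_ofI:
  assumes "f \<in> space M \<rightarrow> topspace X" "\<And>S. openin X S \<Longrightarrow> f -` S \<inter> space M \<in> sets M"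
  shows "f \<in> measurable M (borel_of X)"
  unfolding borel_of_def by (rule measurable_measure_of) (use assms in \<open>auto dest: openin_subset\<close>)

lemma continuous_map_measurable:
  assumes "continuous_map X Y f"
  shows "f \<in> measurable (borel_of X) (borel_of Y)"
proof (rule measurable_borel_ofI)
  show "f \<in> space (borel_of X) \<rightarrow> topspace Y"
    using continuous_map_funspace[OF assms] by (simp add: space_borel_of)
  fix S assume "openin Y S"
  then have "openin X {x \<in> topspace X. f x \<in> S}" using assms by (simp add: continuous_map_def)
  moreover have "f -` S \<inter> space (borel_of X) = {x \<in> topspace X. f x \<in> S}" by (auto simp: space_borel_of)
  ultimately show "f -` S \<inter> space (borel_of X) \<in> sets (borel_of X)"
    by (simp add: openin_in_sets_borel_of)
qed

lemma continuous_map_euclidean_measurable: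
  fixes f :: "'a \<Rightarrow> 'b::topological_space"
  assumes "continuous_map X euclidean f"
  shows "f \<in> borel_measurable (borel_of X)"
  using continuous_map_measurable[OF assms] by (simp add: borel_of_euclidean)

text \<open>Fibres of \<open>h\<close> are compact, so each has a least element. Choosing it makes
  sublevel sets of the section images of compact sets \<open>C \<inter> {..a}\<close>, hence
  closed.\<close>

lemma measurable_section:
  fixes C :: "real set"
  assumes C: "compact C" and h: "continuous_map (top_of_set C) Y h" and Y: "Hausdorff_space Y"
  obtains s where "s \<in> borel_measurable (borel_of Y)" "\<And>y. y \<in> h ` C \<Longrightarrow> s y \<in> C \<and> h (s y) = y"
proof -
  have closed: "closedin Y (h ` (C \<inter> A))" if "closed A" for A
  proof -
    have "compactin (top_of_set C) (C \<inter> A)"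
      using C that by (simp add: compactin_subtopology compact_Int_closed)
    from image_compactin[OF this h] show ?thesis by (rule compactin_imp_closedin[OF Y])
  qed
  define F where "F = (\<lambda>y. {c \<in> C. h c = y})"
  have F_min: "\<exists>c\<in>F y. \<forall>c'\<in>F y. c \<le> c'" if y: "y \<in> h ` C" for y
  proof -
    have "y \<in> topspace Y" using y closedin_subset[OF closed[of UNIV]] by auto
    then have "closedin Y {y}" by (rule closedin_Hausdorff_singleton[OF Y])
    from closedin_continuous_map_preimage[OF h this] have "closedin (top_of_set C) (F y)"
      by (simp add: F_def)
    then have "compact (F y)" using C closedin_compact by blast
    moreover have "F y \<noteq> {}" using y by (auto simp: F_def)
    ultimately show ?thesis by (rule compact_attains_inf)
  qed
  define s where "s = (\<lambda>y. if y \<in> h ` C then SOME c. c \<in> F y \<and> (\<forall>c'\<in>F y. c \<le> c') else 0)"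
  have s: "s y \<in> F y" "\<And>c. c \<in> F y \<Longrightarrow> s y \<le> c" if "y \<in> h ` C" for y
    using someI_ex[OF F_min[OF that, unfolded Bex_def]] that by (auto simp: s_def)
  have "s \<in> borel_measurable (borel_of Y)"
  proof (subst borel_measurable_iff_le, intro allI)
    fix a
    \<comment> \<open>Off the image of \<open>h\<close> the section has the default value 0; those
      points join the sublevel set exactly when \<open>0 \<le> a\<close>.\<close>
    have "{y \<in> space (borel_of Y). s y \<le> a} = h ` (C \<inter> {..a}) \<union> (if 0 \<le> a then topspace Y - h ` (C \<inter> UNIV) else {})"
    proof (intro equalityI subsetI)
      fix y assume y: "y \<in> {y \<in> space (borel_of Y). s y \<le> a}"
      show "y \<in> h ` (C \<inter> {..a}) \<union> (if 0 \<le> a then topspace Y - h ` (C \<inter> UNIV) else {})"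
      proof (cases "y \<in> h ` C")
        case True
        then have "s y \<in> C \<inter> {..a}" "h (s y) = y" using s(1)[OF True] y by (auto simp: F_def)
        then show ?thesis by (metis UnI1 imageI)
      next
        case False
        then show ?thesis using y by (auto simp: s_def space_borel_of)
      qed
    next
      fix y assume y: "y \<in> h ` (C \<inter> {..a}) \<union> (if 0 \<le> a then topspace Y - h ` (C \<inter> UNIV) else {})"
      show "y \<in> {y \<in> space (borel_of Y). s y \<le> a}"
      proof (cases "y \<in> h ` C")
        case True
        then obtain c where "c \<in> C" "c \<le> a" "h c = y" using y by (auto split: if_splits)
        then have "s y \<le> a" using s(2)[OF True, of c] by (auto simp: F_def)
        then show ?thesis using True closedin_subset[OF closed[of UNIV]] by (auto simp: space_borel_of)
      next
        case False
        then show ?thesis using y by (auto simp: s_def space_borel_of split: if_splits)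
      qed
    qed
    moreover have "h ` (C \<inter> {..a}) \<in> sets (borel_of Y)" "topspace Y - h ` (C \<inter> UNIV) \<in> sets (borel_of Y)"
      by (intro closedin_in_sets_borel_of openin_in_sets_borel_of openin_diff openin_topspace closed; simp)+
    ultimately show "{y \<in> space (borel_of Y). s y \<le> a} \<in> sets (borel_of Y)" by auto
  qed
  moreover have "s y \<in> C \<and> h (s y) = y" if "y \<in> h ` C" for y
    using s(1)[OF that] by (simp add: F_def)
  ultimately show ?thesis by (rule that)
qed

text \<open>Continuity of \<open>g\<close> is known on \<open>C\<close> only; composition with Borel
  maps on the whole line requires a value elsewhere.\<close>

lemma measurable_extension:
  fixes C :: "real set"
  assumes C: "compact C" and g: "continuous_map (top_of_set C) X g" and x0: "x0 \<in> topspace X"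
  shows "(\<lambda>c. if c \<in> C then g c else x0) \<in> measurable borel (borel_of X)"
proof (rule measurable_borel_ofI)
  show "(\<lambda>c. if c \<in> C then g c else x0) \<in> space borel \<rightarrow> topspace X"
    using continuous_map_funspace[OF g] x0 by auto
  fix S assume S: "openin X S"
  have "openin (top_of_set C) {c \<in> C. g c \<in> S}" using g S by (simp add: continuous_map_def)
  then obtain V where "open V" "{c \<in> C. g c \<in> S} = C \<inter> V" by (auto simp: openin_open)
  then have "{c \<in> C. g c \<in> S} \<in> sets borel" using C by (simp add: compact_imp_closed)
  moreover have "(\<lambda>c. if c \<in> C then g c else x0) -` S \<inter> space borel
      = {c \<in> C. g c \<in> S} \<union> (if x0 \<in> S then - C else {})"
    by (auto split: if_splits)
  moreover have "- C \<in> sets borel" using C by (simp add: compact_imp_closed borel_comp)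
  ultimately show "(\<lambda>c. if c \<in> C then g c else x0) -` S \<inter> space borel \<in> sets borel" by simp
qed

lemma prob_measuresD:
  assumes "P \<in> prob_measures X"
  shows "prob_space P" "sets P = sets (borel_of X)" "space P = topspace X"
  using assms sets_eq_imp_space_eq[of P "borel_of X"] by (auto simp: prob_measures_def space_borel_of)

lemma prob_measures_distr:
  assumes "prob_space M" "Z \<in> measurable M (borel_of X)"
  shows "distr M (borel_of X) Z \<in> prob_measures X"
  using prob_space.prob_space_distr[OF assms] by (simp add: prob_measures_def)

lemma topspace_nonempty_of_prob_measure:
  assumes "P \<in> prob_measures X" shows "topspace X \<noteq> {}"
  using prob_space.not_empty[OF prob_measuresD(1)[OF assms]] prob_measuresD(3)[OF assms] by simp

text \<open>\<open>\<mu>\<close> is pushed to \<open>C\<close> by a Borel section of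
  \<open>E \<circ> g\<close> and on to \<open>X\<close> by \<open>g\<close>. Following this by
  \<open>E\<close> is the identity on the image of \<open>E\<close>, where \<open>\<mu>\<close>
  lives.\<close>

lemma lift_prob_measure:
  fixes E :: "'a \<Rightarrow> 'b::euclidean_space" and C :: "real set"
  assumes C: "compact C" and g: "continuous_map (top_of_set C) X g" "g ` C = topspace X"
    and E: "continuous_map X euclidean E"
    and \<mu>: "prob_space \<mu>" "sets \<mu> = sets borel" and supp: "AE y in \<mu>. y \<in> E ` topspace X"
  obtains P where "P \<in> prob_measures X" "distr P borel E = \<mu>"
proof -
  have "topspace X \<noteq> {}"
  proof
    assume "topspace X = {}"
    with supp have "AE y in \<mu>. False" by simp
    with \<mu>(1) show False using prob_space.AE_False by blast
  qed
  then obtain x0 where x0: "x0 \<in> topspace X" by blast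
  have "continuous_map (top_of_set C) euclidean (E \<circ> g)" by (rule continuous_map_compose[OF g(1) E])
  from measurable_section[OF C this] obtain s where s: "s \<in> borel_measurable borel"
    "\<And>y. y \<in> (E \<circ> g) ` C \<Longrightarrow> s y \<in> C \<and> (E \<circ> g) (s y) = y"
    by (auto simp: borel_of_euclidean)
  define g' where "g' = (\<lambda>c. if c \<in> C then g c else x0)"
  have g': "g' \<in> measurable borel (borel_of X)"
    unfolding g'_def by (rule measurable_extension[OF C g(1) x0])
  have s\<mu>: "s \<in> borel_measurable \<mu>" using s(1) measurable_cong_sets[OF \<mu>(2) refl] by blast
  have gs: "(\<lambda>y. g' (s y)) \<in> measurable \<mu> (borel_of X)" by (rule measurable_compose[OF s\<mu> g'])
  have Em: "E \<in> borel_measurable (borel_of X)" by (rule continuous_map_euclidean_measurable[OF E])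
  have "distr (distr \<mu> (borel_of X) (\<lambda>y. g' (s y))) borel E = distr \<mu> borel (\<lambda>y. E (g' (s y)))"
    using distr_distr[OF Em gs] by (simp add: o_def)
  also have "\<dots> = distr \<mu> borel (\<lambda>y. y)"
  proof (rule distr_cong_AE)
    have "E ` topspace X = (E \<circ> g) ` C" using g(2) unfolding g(2)[symmetric] by (simp add: image_comp)
    with supp show "AE y in \<mu>. E (g' (s y)) = y"
      using s(2) by (auto simp: g'_def elim!: eventually_mono)
  qed (use measurable_compose[OF gs Em] \<mu>(2) in \<open>auto simp: measurable_ident_sets\<close>)
  also have "\<dots> = \<mu>" by (rule distr_id2[OF \<mu>(2)[symmetric], unfolded id_def]) 
  finally show ?thesis using that prob_measures_distr[OF \<mu>(1) gs] by blast
qed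

text \<open>Helly's selection theorem on the parameter set \<open>C\<close>, combined with Skorohod's
  representation theorem: narrow compactness of the probability measures on \<open>X\<close>, with the
  convergence realised almost surely.\<close>

lemma skorohod_subsequence:
  fixes C :: "real set"
  assumes C: "compact C" and g: "continuous_map (top_of_set C) X g" "g ` C = topspace X"
    and X: "Hausdorff_space X" and P: "\<And>n::nat. P n \<in> prob_measures X"
  obtains r and M :: "real measure" and Z Z0 where
    "strict_mono (r :: nat \<Rightarrow> nat)" "prob_space M"
    "\<And>n. Z n \<in> measurable M (borel_of X)" "Z0 \<in> measurable M (borel_of X)"
    "\<And>n. distr M (borel_of X) (Z n) = P (r n)"
    "AE \<omega> in M. limitin X (\<lambda>n. Z n \<omega>) (Z0 \<omega>) sequentially"
proof -
  obtain x0 where x0: "x0 \<in> topspace X" using topspace_nonempty_of_prob_measure[OF P[of 0]] by blast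
  obtain s where s: "s \<in> borel_measurable (borel_of X)" "\<And>y. y \<in> topspace X \<Longrightarrow> s y \<in> C \<and> g (s y) = y"
    using measurable_section[OF C g(1) X] g(2) by metis
  define g' where "g' = (\<lambda>c. if c \<in> C then g c else x0)"
  have g': "g' \<in> measurable borel (borel_of X)"
    unfolding g'_def by (rule measurable_extension[OF C g(1) x0])
  have sP: "s \<in> borel_measurable (P n)" for n
    using s(1) measurable_cong_sets[OF prob_measuresD(2)[OF P] refl] by blast
  define \<mu> where "\<mu> = (\<lambda>n. distr (P n) borel s)"
  have rd: "real_distribution (\<mu> n)" for n
    using prob_space.prob_space_distr[OF prob_measuresD(1)[OF P] sP]
    by (simp add: \<mu>_def real_distribution_def real_distribution_axioms_def)
  have \<mu>C: "AE c in \<mu> n. c \<in> C" for n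
    unfolding \<mu>_def
  proof (subst AE_distr_iff[OF sP])
    show "{x \<in> space borel. x \<in> C} \<in> sets borel" using C by (simp add: compact_imp_closed)
    show "AE x in P n. s x \<in> C" using s(2) prob_measuresD(3)[OF P] by (intro AE_I2) auto
  qed
  have "tight \<mu>"
  proof -
    obtain K where K: "\<And>c. c \<in> C \<Longrightarrow> \<bar>c\<bar> \<le> K" using compact_imp_bounded[OF C] by (auto simp: bounded_iff)
    \<comment> \<open>The margin 1 puts \<open>C\<close> strictly above the open left end of the
      interval and makes the interval nonempty.\<close>
    define K' where "K' = \<bar>K\<bar> + 1"
    have "measure (\<mu> n) {- K'<..K'} = 1" for n
    proof -
      interpret real_distribution "\<mu> n" by (rule rd)
      have "AE c in \<mu> n. c \<in> {- K'<..K'}"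
        using \<mu>C[of n] by eventually_elim (use K in \<open>fastforce simp: K'_def abs_le_iff\<close>)
      then show ?thesis by (subst prob_eq_1) auto
    qed
    then show ?thesis unfolding tight_def
      by (intro conjI allI impI rd exI[of _ "- K'"] exI[of _ "K'"]) (auto simp: K'_def)
  qed
  from tight_imp_convergent_subsubsequence[OF this strict_mono_id]
  obtain r M0 where r: "strict_mono r" and M0: "real_distribution M0" and conv: "weak_conv_m (\<mu> \<circ> r) M0"
    by (auto simp: comp_def id_def)
  have rd': "real_distribution ((\<mu> \<circ> r) n)" for n using rd by simp
  obtain M :: "real measure" and Y Y0 where "prob_space M \<and> (\<forall>n. Y n \<in> borel_measurable M) \<and>
      (\<forall>n. distr M borel (Y n) = (\<mu> \<circ> r) n) \<and> Y0 \<in> measurable M lborel \<and> distr M borel Y0 = M0 \<and>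
      (\<forall>x\<in>space M. (\<lambda>n. Y n x) \<longlonglongrightarrow> Y0 x)"
    using Skorohod[OF rd' M0 conv] by (elim exE) (rule that)
  then have M: "prob_space M" and Y: "\<And>n. Y n \<in> borel_measurable M"
    and dY: "\<And>n. distr M borel (Y n) = \<mu> (r n)" and Y0: "Y0 \<in> borel_measurable M"
    and lim: "\<And>\<omega>. \<omega> \<in> space M \<Longrightarrow> (\<lambda>n. Y n \<omega>) \<longlonglongrightarrow> Y0 \<omega>"
    by simp_all
  have "AE \<omega> in M. Y n \<omega> \<in> C" for n
  proof -
    have "AE c in distr M borel (Y n). c \<in> C" using \<mu>C[of "r n"] by (simp only: dY)
    then show ?thesis using AE_distr_iff[OF Y, of "\<lambda>c. c \<in> C"] C by (simp add: compact_imp_closed)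
  qed
  then have ae: "AE \<omega> in M. \<forall>n. Y n \<omega> \<in> C" by (simp add: AE_all_countable)
  have Z: "(\<lambda>\<omega>. g' (Y n \<omega>)) \<in> measurable M (borel_of X)" for n by (rule measurable_compose[OF Y g'])
  have Z0: "(\<lambda>\<omega>. g' (Y0 \<omega>)) \<in> measurable M (borel_of X)" by (rule measurable_compose[OF Y0 g'])
  have dist: "distr M (borel_of X) (\<lambda>\<omega>. g' (Y n \<omega>)) = P (r n)" for n
  proof -
    have "distr M (borel_of X) (\<lambda>\<omega>. g' (Y n \<omega>)) = distr (distr M borel (Y n)) (borel_of X) g'"
      using distr_distr[OF g' Y] by (simp add: o_def)
    also have "\<dots> = distr (distr (P (r n)) borel s) (borel_of X) g'" by (simp only: dY \<mu>_def)
    also have "\<dots> = distr (P (r n)) (borel_of X) (\<lambda>x. g' (s x))"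
      using distr_distr[OF g' sP] by (simp add: o_def)
    also have "\<dots> = distr (P (r n)) (P (r n)) (\<lambda>x. x)"
      using s(2) prob_measuresD[OF P] by (intro distr_cong) (auto simp: g'_def)
    also have "\<dots> = P (r n)" by (rule distr_id[unfolded id_def])
    finally show ?thesis .
  qed
  have "AE \<omega> in M. limitin X (\<lambda>n. g' (Y n \<omega>)) (g' (Y0 \<omega>)) sequentially"
  proof -
    have "AE \<omega> in M. \<omega> \<in> space M" by (rule AE_space)
    with ae show ?thesis
    proof eventually_elim
      case (elim \<omega>)
      then have inC: "\<And>n. Y n \<omega> \<in> C" by simp
      moreover have l: "(\<lambda>n. Y n \<omega>) \<longlonglongrightarrow> Y0 \<omega>" using lim elim by simp
      \<comment> \<open>Skorohod's limit variable is only known to be real; closedness of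
        \<open>C\<close> puts it where \<open>g\<close> is continuous.\<close>
      ultimately have Y0C: "Y0 \<omega> \<in> C"
        using closed_sequentially[OF compact_imp_closed[OF C], of "\<lambda>n. Y n \<omega>"] by simp
      have "limitin (top_of_set C) (\<lambda>n. Y n \<omega>) (Y0 \<omega>) sequentially"
        using l inC Y0C by (simp add: limitin_subtopology)
      from continuous_map_limit[OF g(1) this]
      show ?case using inC Y0C by (simp add: g'_def o_def)
    qed
  qed
  with r M Z Z0 dist show ?thesis by (rule that)
qed

lemma narrow_conv_of_AE_limit:
  assumes M: "prob_space M" and Z: "\<And>n. Z n \<in> measurable M (borel_of X)" "Z0 \<in> measurable M (borel_of X)"
    and P: "\<And>n. distr M (borel_of X) (Z n) = P n" 
    and lim: "AE \<omega> in M. limitin X (\<lambda>n. Z n \<omega>) (Z0 \<omega>) sequentially"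
  shows "narrow_conv X P (distr M (borel_of X) Z0)"
  unfolding narrow_conv_def
proof (intro allI impI, elim conjE)
  fix \<phi> assume \<phi>: "continuous_map X euclideanreal \<phi>" and b: "bounded (\<phi> ` topspace X)"
  obtain K where K: "\<And>x. x \<in> topspace X \<Longrightarrow> \<bar>\<phi> x\<bar> \<le> K" using b by (auto simp: bounded_iff)
  have m: "\<phi> \<in> borel_measurable (borel_of X)" by (rule continuous_map_euclidean_measurable[OF \<phi>])
  have eq: "integral\<^sup>L (distr M (borel_of X) z) \<phi> = (\<integral>\<omega>. \<phi> (z \<omega>) \<partial>M)"
    if "z \<in> measurable M (borel_of X)" for z by (rule integral_distr[OF that m])
  have "(\<lambda>n. \<integral>\<omega>. \<phi> (Z n \<omega>) \<partial>M) \<longlonglongrightarrow> (\<integral>\<omega>. \<phi> (Z0 \<omega>) \<partial>M)"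
  proof (rule integral_dominated_convergence[where w = "\<lambda>_. K"])
    show "AE \<omega> in M. (\<lambda>n. \<phi> (Z n \<omega>)) \<longlonglongrightarrow> \<phi> (Z0 \<omega>)"
      using lim
    proof eventually_elim
      case (elim \<omega>)
      from continuous_map_limit[OF \<phi> elim] show ?case by (simp add: o_def)
    qed
    show "AE \<omega> in M. norm (\<phi> (Z n \<omega>)) \<le> K" for n
      using measurable_space[OF Z(1)] by (intro AE_I2) (auto simp: space_borel_of intro!: K)
    show "integrable M (\<lambda>_. K)" using M by (simp add: prob_space.finite_measure finite_measure.integrable_const)
  qed (use measurable_compose[OF Z(1) m] measurable_compose[OF Z(2) m] in auto)
  then show "(\<lambda>n. integral\<^sup>L (P n) \<phi>) \<longlonglongrightarrow> integral\<^sup>L (distr M (borel_of X) Z0) \<phi>"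
    using eq[OF Z(2)] eq[OF Z(1)] by (simp add: P[symmetric])
qed

section \<open>The state-control space\<close>

context control_system begin

abbreviation "state_top \<equiv> state_control_top T U \<Omega>"

lemma state_top_eq: "state_top = prod_topology (top_of_set \<Omega>) control_top"
  by (simp add: state_control_top_def control_top_def)

lemma continuous_map_fst_state: "continuous_map state_top euclidean fst"
proof -
  have "continuous_map state_top (top_of_set \<Omega>) fst"
    unfolding state_top_eq by (rule continuous_map_fst)
  then show ?thesis by (simp add: continuous_map_in_subtopology)
qed

lemma continuous_map_inner_state:
  assumes "v \<in> L2_fun T"
  shows "continuous_map state_top euclideanreal (\<lambda>z. \<integral>t. rep (snd z) t \<bullet> v t \<partial>lebesgue_on {0..T})"
proof -
  have "continuous_map state_top control_top snd"
    unfolding state_top_eq by (rule continuous_map_snd)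
  from continuous_map_compose[OF this continuous_map_inner_fun[OF assms]] show ?thesis
    by (simp add: o_def)
qed

lemma compact_space_state_top: "compact_space state_top"
  unfolding state_top_eq using compact_space_control_top Omega(2)
  by (simp add: compact_space_prod_topology compact_space_subtopology)

text \<open>Pairing a control with it reads off the \<open>j\<close>-th component of the primitive
  at the rational time \<open>q\<close>.\<close>

definition test_fun :: "rat \<Rightarrow> 'm \<Rightarrow> real \<Rightarrow> real^'m" where
  "test_fun q j t = indicator {0..real_of_rat q} t *\<^sub>R axis j 1"

lemma test_fun_L2: "test_fun q j \<in> L2_fun T"
proof (rule bounded_measurable_L2_fun[where C = 1])
  have "(indicator {0..real_of_rat q} :: real \<Rightarrow> real) \<in> borel_measurable (lebesgue_on {0..T})"
    by (intro measurable_restrict_space1 borel_measurable_indicator) simp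
  then show "test_fun q j \<in> borel_measurable (lebesgue_on {0..T})"
    unfolding test_fun_def by (rule borel_measurable_scaleR) simp
qed (auto simp: test_fun_def indicator_def)

text \<open>Equal pairings mean primitives that agree at rational times, by continuity at all times;
  their derivatives, the controls, then agree almost everywhere.\<close>

lemma controls_separated:
  assumes \<phi>: "\<phi> \<in> controls T U" and \<psi>: "\<psi> \<in> controls T U"
    and eq: "\<And>q j. (\<integral>t. rep \<phi> t \<bullet> test_fun q j t \<partial>lebesgue_on {0..T}) = (\<integral>t. rep \<psi> t \<bullet> test_fun q j t \<partial>lebesgue_on {0..T})"
  shows "\<phi> = \<psi>"
proof -
  obtain w where w: "admissible w" "AE t in lebesgue_on {0..T}. rep \<phi> t = w t"
    using control_representative[OF \<phi>] by metis
  obtain w' where w': "admissible w'" "AE t in lebesgue_on {0..T}. rep \<psi> t = w' t"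
    using control_representative[OF \<psi>] by metis
  have prim: "(\<integral>t. rep \<theta> t \<bullet> test_fun q j t \<partial>lebesgue_on {0..T}) = integral {0..real_of_rat q} u $ j"
    if u: "admissible u" "AE t in lebesgue_on {0..T}. rep \<theta> t = u t" and \<theta>: "\<theta> \<in> controls T U"
      and q: "real_of_rat q \<in> {0..T}" for \<theta> u q j
  proof -
    have "(\<integral>t. rep \<theta> t \<bullet> test_fun q j t \<partial>lebesgue_on {0..T}) = (\<integral>t. u t \<bullet> test_fun q j t \<partial>lebesgue_on {0..T})"
      using u \<theta> controls_subset_L2 rep_mem_L2(2) test_fun_L2 admissible_L2_fun[OF u(1)]
      by (intro L2_fun_mono_AE_integral) auto
    also have "\<dots> = integral {0..T} (\<lambda>t. u t \<bullet> test_fun q j t)"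
      by (rule lebesgue_integral_eq_integral[OF admissible_inner_integrable[OF u(1) test_fun_L2]]) simp
    also have "(\<lambda>t. u t \<bullet> test_fun q j t) = (\<lambda>t. if t \<in> {0..real_of_rat q} then u t $ j else 0)"
      by (auto simp: test_fun_def indicator_def inner_axis)
    also have "integral {0..T} \<dots> = integral {0..real_of_rat q} (\<lambda>t. u t $ j)"
      unfolding integral_restrict_Int using q by (simp add: Int_absorb2)
    also have "\<dots> = integral {0..real_of_rat q} u $ j"
      using q by (intro integral_component_eq_cart integrable_on_subinterval[OF admissible_integrable(1)[OF u(1)]]) auto
    finally show ?thesis .
  qed
  define D where "D = (\<lambda>t. integral {0..t} w - integral {0..t} w')"
  have D_cont: "continuous_on {0..T} D"
    unfolding D_def using w(1) w'(1) by (intro continuous_intros indefinite_integral_continuous_1 admissible_integrable)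
  have D_rat: "D t = 0" if t: "t \<in> {0<..<T} \<inter> \<rat>" for t
  proof -
    obtain q where q: "t = real_of_rat q" using t by (auto elim: Rats_cases)
    have "integral {0..t} w $ j = integral {0..t} w' $ j" for j
      using prim[OF w \<phi>, of q j] prim[OF w' \<psi>, of q j] eq[of q j] t by (simp add: q)
    then show ?thesis by (simp add: D_def vec_eq_iff)
  qed
  have D0: "D t = 0" if t: "t \<in> {0..T}" for t
  proof -
    have cl: "closure ({0<..<T} \<inter> \<rat>) = {0..T}"
      using T by (subst closure_open_Int_superset) (auto simp: Rats_closure_real)
    show ?thesis
      by (rule continuous_constant_on_closure[of "{0<..<T} \<inter> \<rat>" D]) (use D_cont D_rat t cl in auto)
  qed
  have "AE t in lebesgue_on {0..T}. t \<in> {0..T}" by (simp add: AE_restrict_space_iff)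
  with indefinite_integral_has_vector_derivative_AE[OF admissible_integrable(1)[OF w(1)]]
    indefinite_integral_has_vector_derivative_AE[OF admissible_integrable(1)[OF w'(1)]]
  have "AE t in lebesgue_on {0..T}. w t = w' t"
  proof eventually_elim
    case (elim t)
    have "((\<lambda>t. integral {0..t} w) has_vector_derivative w' t) (at t within {0..T})"
      using D0 by (intro has_vector_derivative_transform[OF elim(3) _ elim(2)]) (simp add: D_def)
    then show ?case
      using elim(1,3) T by (intro vector_derivative_unique_within_closed_interval[of 0 T]) auto
  qed
  with w(2) w'(2) have "AE t in lebesgue_on {0..T}. rep \<phi> t = rep \<psi> t"
    by eventually_elim simp
  then show ?thesis using \<phi> \<psi> controls_subset_L2 by (intro L2_eqI) auto
qed

text \<open>The \<open>CARD('d)\<close> components of the initial point and the countably many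
  pairings are numbered by the naturals through \<open>from_nat\<close>, which yields one separating
  sequence.\<close>

definition coordinate :: "nat \<Rightarrow> (real^'d) \<times> (real \<Rightarrow> real^'m) set \<Rightarrow> real" where
  "coordinate n z = (case (from_nat n :: 'd + rat \<times> 'm) of Inl i \<Rightarrow> fst z $ i
     | Inr (q, j) \<Rightarrow> \<integral>t. rep (snd z) t \<bullet> test_fun q j t \<partial>lebesgue_on {0..T})"

lemma coordinate_continuous: "continuous_map state_top euclideanreal (coordinate n)"
proof (cases "from_nat n :: 'd + rat \<times> 'm")
  case (Inl i)
  have "continuous_map euclidean euclideanreal (\<lambda>x::real^'d. x $ i)" by (simp add: continuous_intros)
  from continuous_map_compose[OF continuous_map_fst_state this] show ?thesis
    by (simp add: coordinate_def[abs_def] Inl o_def)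
next
  case (Inr p)
  obtain q j where "p = (q, j)" by (cases p)
  then show ?thesis using continuous_map_inner_state[OF test_fun_L2[of q j]]
    by (simp add: coordinate_def[abs_def] Inr)
qed

lemma coordinate_separating:
  assumes "x \<in> topspace state_top" "y \<in> topspace state_top" and eq: "\<And>n. coordinate n x = coordinate n y"
  shows "x = y"
proof -
  have "fst x $ i = fst y $ i" for i
    using eq[of "to_nat (Inl i :: 'd + rat \<times> 'm)"] by (simp add: coordinate_def)
  moreover have "snd x = snd y"
  proof (rule controls_separated)
    show "snd x \<in> controls T U" "snd y \<in> controls T U" using assms by (auto simp: topspace_state_control_top)
    show "(\<integral>t. rep (snd x) t \<bullet> test_fun q j t \<partial>lebesgue_on {0..T}) = (\<integral>t. rep (snd y) t \<bullet> test_fun q j t \<partial>lebesgue_on {0..T})" for q j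
      using eq[of "to_nat (Inr (q, j) :: 'd + rat \<times> 'm)"] by (simp add: coordinate_def)
  qed
  ultimately show ?thesis by (simp add: prod_eq_iff vec_eq_iff)
qed

lemma Hausdorff_state_top: "Hausdorff_space state_top"
proof (rule Hausdorff_space_injective_preimage)
  show "continuous_map state_top euclidean (\<lambda>x n. coordinate n x)"
    using continuous_map_coordinatewise_then_product[of UNIV state_top "\<lambda>_. euclideanreal" "\<lambda>x n. coordinate n x"] coordinate_continuous
    by (simp add: euclidean_product_topology)
  show "inj_on (\<lambda>x n. coordinate n x) (topspace state_top)"
    using coordinate_separating by (auto simp: inj_on_def fun_eq_iff)
qed simp

lemma state_top_parametrization:
  obtains C :: "real set" and g where "compact C" "continuous_map (top_of_set C) state_top g" "g ` C = topspace state_top"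
  by (rule compact_space_continuous_image_of_reals[where h = coordinate,
        OF compact_space_state_top coordinate_continuous coordinate_separating])

lemma limitin_state_top:
  assumes "limitin state_top z l sequentially"
  shows "(\<lambda>n. fst (z n)) \<longlonglongrightarrow> fst l"
    "v \<in> L2_fun T \<Longrightarrow> (\<lambda>n. \<integral>t. rep (snd (z n)) t \<bullet> v t \<partial>lebesgue_on {0..T}) \<longlonglongrightarrow> (\<integral>t. rep (snd l) t \<bullet> v t \<partial>lebesgue_on {0..T})"
  using continuous_map_limit[OF continuous_map_fst_state assms] continuous_map_limit[OF continuous_map_inner_state assms]
  by (auto simp: o_def)

lemma endpoint_sequentially_continuous:
  assumes z: "\<And>n. z n \<in> topspace state_top" and lim: "limitin state_top z l sequentially"
  shows "(\<lambda>n. endpoint T f0 f (z n)) \<longlonglongrightarrow> endpoint T f0 f l"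
proof -
  have l: "l \<in> topspace state_top" using lim by (rule limitin_topspace)
  \<comment> \<open>For each point of the space one representative and one trajectory are fixed, so
    that the sequence and its limit use the same choice.\<close>
  have "\<exists>q. admissible (fst q) \<and> (AE t in lebesgue_on {0..T}. rep (snd p) t = fst q t) \<and>
      integral_solution (fst p) (fst q) (snd q)"
    if p: "p \<in> topspace state_top" for p
  proof -
    have p: "snd p \<in> controls T U" "fst p \<in> \<Omega>" using p by (auto simp: topspace_state_control_top)
    obtain w where w: "admissible w" "AE t in lebesgue_on {0..T}. rep (snd p) t = w t"
      using control_representative[OF p(1)] .
    moreover obtain x where "integral_solution (fst p) w x" using integral_solution_exists[OF p(2) w(1)] .
    ultimately show ?thesis by (intro exI[of _ "(w, x)"]) simp
  qed
  then have "\<forall>p\<in>topspace state_top. \<exists>q. admissible (fst q) \<and>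
      (AE t in lebesgue_on {0..T}. rep (snd p) t = fst q t) \<and> integral_solution (fst p) (fst q) (snd q)" ..
  from bchoice[OF this] obtain q where q: "\<forall>p\<in>topspace state_top. admissible (fst (q p)) \<and>
      (AE t in lebesgue_on {0..T}. rep (snd p) t = fst (q p) t) \<and> integral_solution (fst p) (fst (q p)) (snd (q p))" ..
  define w where "w = (\<lambda>p. fst (q p))"
  define x where "x = (\<lambda>p. snd (q p))"
  have wx: "admissible (w p)" "AE t in lebesgue_on {0..T}. rep (snd p) t = w p t" "integral_solution (fst p) (w p) (x p)"
    if "p \<in> topspace state_top" for p
    using q that by (auto simp: w_def x_def)
  have ep: "endpoint T f0 f p = x p T" if "p \<in> topspace state_top" for p
    using endpoint_eq[OF wx(1,2,3)[OF that]] by simp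
  have "(\<lambda>n. x (z n) T) \<longlonglongrightarrow> x l T"
  proof (rule endpoint_tendsto[OF _ limitin_state_top(1)[OF lim] _ wx(1)[OF z] wx(1)[OF l] _ wx(3)[OF z] wx(3)[OF l]])
    show "fst (z n) \<in> \<Omega>" "fst l \<in> \<Omega>" for n using z[of n] l by (auto simp: topspace_state_control_top)
    fix v :: "real \<Rightarrow> real^'m" assume v: "v \<in> L2_fun T"
    have "(\<integral>t. rep (snd p) t \<bullet> v t \<partial>lebesgue_on {0..T}) = (\<integral>t. w p t \<bullet> v t \<partial>lebesgue_on {0..T})"
      if p: "p \<in> topspace state_top" for p
    proof (rule L2_fun_mono_AE_integral[OF wx(2)[OF p] _ _ admissible_L2_fun[OF wx(1)[OF p]] v v])
      have "snd p \<in> L2 T" using p controls_subset_L2 by (auto simp: topspace_state_control_top)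
      then show "rep (snd p) \<in> L2_fun T" by (rule rep_mem_L2)
    qed simp
    then show "(\<lambda>n. \<integral>t. w (z n) t \<bullet> v t \<partial>lebesgue_on {0..T}) \<longlonglongrightarrow> (\<integral>t. w l t \<bullet> v t \<partial>lebesgue_on {0..T})"
      using limitin_state_top(2)[OF lim v] z l by simp
  qed
  then show ?thesis using ep z l by simp
qed

text \<open>Sequential continuity is continuity on the set \<open>C\<close> of reals. It descends to
  \<open>X\<close> because \<open>g\<close>, a continuous surjection from a compact space onto a
  Hausdorff space, is a quotient map.\<close>

lemma endpoint_continuous: "continuous_map state_top euclidean (endpoint T f0 f)"
proof -
  obtain C :: "real set" and g where C: "compact C" and g: "continuous_map (top_of_set C) state_top g" "g ` C = topspace state_top"
    by (rule state_top_parametrization)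
  have q: "quotient_map (top_of_set C) state_top g"
    using C g Hausdorff_state_top
    by (intro continuous_imp_quotient_map) (auto simp: compact_space_subtopology)
  have "continuous_on C (endpoint T f0 f \<circ> g)"
    unfolding continuous_on_sequentially
  proof (intro allI impI ballI, elim conjE)
    fix c l assume l: "l \<in> C" and c: "\<forall>n. c n \<in> C" and lim: "c \<longlonglongrightarrow> l"
    have "limitin (top_of_set C) c l sequentially" using l c lim by (simp add: limitin_subtopology)
    from continuous_map_limit[OF g(1) this] have "limitin state_top (g \<circ> c) (g l) sequentially" .
    from endpoint_sequentially_continuous[OF _ this] c g(2)
    show "((endpoint T f0 f \<circ> g) \<circ> c) \<longlonglongrightarrow> (endpoint T f0 f \<circ> g) l" by (auto simp: o_def)
  qed
  then have "continuous_map (top_of_set C) euclidean (endpoint T f0 f \<circ> g)" by simp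
  then show ?thesis by (rule continuous_compose_quotient_map[OF q])
qed

text \<open>Expansion of the squared distance of \<open>\<phi>\<close> and \<open>\<psi>\<close>.
  The left side is weakly continuous and affine in \<open>\<phi>\<close>, with equality for
  \<open>\<psi> = \<phi>\<close>; so the energy is a supremum of weakly continuous
  functions.\<close>

lemma energy_lower_bound:
  assumes "\<phi> \<in> controls T U" "\<psi> \<in> controls T U"
  shows "2 * (\<integral>t. rep \<phi> t \<bullet> rep \<psi> t \<partial>lebesgue_on {0..T}) - energy T \<psi> \<le> energy T \<phi>"
proof -
  have L2: "rep \<phi> \<in> L2_fun T" "rep \<psi> \<in> L2_fun T" using assms controls_subset_L2 rep_mem_L2(2) by auto
  have int: "integrable (lebesgue_on {0..T}) (\<lambda>t. rep \<phi> t \<bullet> rep \<psi> t)"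
  proof (rule Bochner_Integration.integrable_bound)
    show "integrable (lebesgue_on {0..T}) (\<lambda>t. (norm (rep \<phi> t))\<^sup>2 + (norm (rep \<psi> t))\<^sup>2)"
      using L2 by (auto simp: L2_fun_def)
    show "(\<lambda>t. rep \<phi> t \<bullet> rep \<psi> t) \<in> borel_measurable (lebesgue_on {0..T})"
      using L2 by (auto simp: L2_fun_def)
    have "\<bar>a \<bullet> b\<bar> \<le> (norm a)\<^sup>2 + (norm b)\<^sup>2" for a b :: "real^'m"
      using Cauchy_Schwarz_ineq2[of a b] sum_squares_bound[of "norm a" "norm b"]
        mult_nonneg_nonneg[OF norm_ge_zero[of a] norm_ge_zero[of b]] by linarith
    then show "AE t in lebesgue_on {0..T}. norm (rep \<phi> t \<bullet> rep \<psi> t) \<le> norm ((norm (rep \<phi> t))\<^sup>2 + (norm (rep \<psi> t))\<^sup>2)"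
      by (auto simp: abs_of_nonneg)
  qed
  have "0 \<le> (\<integral>t. (norm (rep \<phi> t - rep \<psi> t))\<^sup>2 \<partial>lebesgue_on {0..T})" by simp
  also have "(\<lambda>t. (norm (rep \<phi> t - rep \<psi> t))\<^sup>2)
      = (\<lambda>t. ((norm (rep \<phi> t))\<^sup>2 + (norm (rep \<psi> t))\<^sup>2) - 2 * (rep \<phi> t \<bullet> rep \<psi> t))"
    by (simp add: power2_norm_eq_inner inner_diff_left inner_diff_right inner_commute fun_eq_iff)
  also have "(\<integral>t. \<dots> t \<partial>lebesgue_on {0..T}) = energy T \<phi> + energy T \<psi> - 2 * (\<integral>t. rep \<phi> t \<bullet> rep \<psi> t \<partial>lebesgue_on {0..T})"
    using L2 int by (simp add: energy_def L2_fun_def)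
  finally show ?thesis by simp
qed

lemma energy_self: "(\<integral>t. rep \<phi> t \<bullet> rep \<phi> t \<partial>lebesgue_on {0..T}) = energy T \<phi>"
  by (simp add: energy_def power2_norm_eq_inner)

lemma energy_nonneg: "0 \<le> energy T \<phi>"
  by (simp add: energy_def)

lemma energy_bound:
  obtains K where "\<And>\<phi>. \<phi> \<in> controls T U \<Longrightarrow> energy T \<phi> \<le> K"
proof -
  obtain B where B: "B \<ge> 0" "\<And>u. u \<in> U \<Longrightarrow> norm u \<le> B" by (rule control_bound) blast
  have "energy T \<phi> \<le> B\<^sup>2 * T" if \<phi>: "\<phi> \<in> controls T U" for \<phi>
  proof -
    have "energy T \<phi> \<le> (\<integral>t. B\<^sup>2 \<partial>lebesgue_on {0..T})"
      unfolding energy_def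
    proof (rule integral_mono_AE)
      show "integrable (lebesgue_on {0..T}) (\<lambda>t. (norm (rep \<phi> t))\<^sup>2)"
        using \<phi> controls_subset_L2 rep_mem_L2(2)[of \<phi> T] by (auto simp: L2_fun_def)
      show "integrable (lebesgue_on {0..T}) (\<lambda>t. B\<^sup>2)"
        using finite_measure_interval[of T] by (simp add: finite_measure.integrable_const)
      have "AE t in lebesgue_on {0..T}. rep \<phi> t \<in> U" using \<phi> by (simp add: controls_def)
      then show "AE t in lebesgue_on {0..T}. (norm (rep \<phi> t))\<^sup>2 \<le> B\<^sup>2"
        by eventually_elim (auto intro!: power_mono B)
    qed
    also have "\<dots> = B\<^sup>2 * T" using T by (simp add: measure_restrict_space)
    finally show ?thesis .
  qed
  then show ?thesis by (rule that)
qed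

text \<open>A sublevel set of the energy is the intersection of the closed sublevel sets of its
  affine minorants. The control \<open>\<psi>0\<close> only ensures that the intersection is over a
  nonempty family.\<close>

lemma energy_measurable: "(\<lambda>z. energy T (snd z)) \<in> borel_measurable (borel_of state_top)"
proof (subst borel_measurable_iff_le, intro allI)
  fix a
  let ?F = "\<lambda>\<psi> z. 2 * (\<integral>t. rep (snd z) t \<bullet> rep \<psi> t \<partial>lebesgue_on {0..T}) - energy T \<psi>"
  obtain \<psi>0 where \<psi>0: "\<psi>0 \<in> controls T U"
  proof -
    obtain u where "u \<in> U" using U(1) by blast
    then have "admissible (\<lambda>_. u)" by (simp add: admissible_def)
    from admissible_class(1)[OF this] show ?thesis by (rule that)
  qed
  have "closedin state_top {z \<in> topspace state_top. ?F \<psi> z \<in> {..a}}" if \<psi>: "\<psi> \<in> controls T U" for \<psi>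
  proof (rule closedin_continuous_map_preimage)
    have "rep \<psi> \<in> L2_fun T" using \<psi> controls_subset_L2 rep_mem_L2(2) by auto
    from continuous_map_inner_state[OF this] show "continuous_map state_top euclideanreal (?F \<psi>)"
      by (intro continuous_map_diff continuous_map_real_mult continuous_map_const[THEN iffD2]) auto
  qed simp
  then have "closedin state_top (\<Inter>\<psi>\<in>controls T U. {z \<in> topspace state_top. ?F \<psi> z \<in> {..a}})"
    using \<psi>0 by (intro closedin_INT) auto
  moreover have "(\<Inter>\<psi>\<in>controls T U. {z \<in> topspace state_top. ?F \<psi> z \<in> {..a}}) = {z \<in> space (borel_of state_top). energy T (snd z) \<le> a}"
  proof (intro equalityI subsetI)
    fix z assume z: "z \<in> (\<Inter>\<psi>\<in>controls T U. {z \<in> topspace state_top. ?F \<psi> z \<in> {..a}})"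
    then have "z \<in> topspace state_top" using \<psi>0 by blast
    moreover from this have "snd z \<in> controls T U" by (auto simp: topspace_state_control_top)
    then have "?F (snd z) z \<le> a" using z by blast
    ultimately show "z \<in> {z \<in> space (borel_of state_top). energy T (snd z) \<le> a}"
      by (simp add: energy_self space_borel_of)
  next
    fix z assume z: "z \<in> {z \<in> space (borel_of state_top). energy T (snd z) \<le> a}"
    then have "snd z \<in> controls T U" by (auto simp: topspace_state_control_top space_borel_of)
    then have "?F \<psi> z \<le> a" if "\<psi> \<in> controls T U" for \<psi>
      using energy_lower_bound[OF _ that, of "snd z"] z by simp
    then show "z \<in> (\<Inter>\<psi>\<in>controls T U. {z \<in> topspace state_top. ?F \<psi> z \<in> {..a}})"
      using z by (simp add: space_borel_of)
  qed
  ultimately show "{z \<in> space (borel_of state_top). energy T (snd z) \<le> a} \<in> sets (borel_of state_top)"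
    by (simp add: closedin_in_sets_borel_of)
qed

text \<open>The minorant that touches the energy at the limit point converges along the
  sequence.\<close>

lemma energy_lsc:
  assumes z: "\<And>n. z n \<in> topspace state_top" and lim: "limitin state_top z l sequentially"
  shows "ennreal (energy T (snd l)) \<le> liminf (\<lambda>n. ennreal (energy T (snd (z n))))"
proof -
  have l: "snd l \<in> controls T U" using limitin_topspace[OF lim] by (auto simp: topspace_state_control_top)
  then have L2: "rep (snd l) \<in> L2_fun T" using controls_subset_L2 rep_mem_L2(2) by auto
  let ?a = "\<lambda>n. 2 * (\<integral>t. rep (snd (z n)) t \<bullet> rep (snd l) t \<partial>lebesgue_on {0..T}) - energy T (snd l)"
  have "?a \<longlonglongrightarrow> 2 * (\<integral>t. rep (snd l) t \<bullet> rep (snd l) t \<partial>lebesgue_on {0..T}) - energy T (snd l)"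
    by (intro tendsto_diff tendsto_mult tendsto_const limitin_state_top(2)[OF lim L2])
  then have "(\<lambda>n. ennreal (?a n)) \<longlonglongrightarrow> ennreal (energy T (snd l))"
    by (intro tendsto_ennrealI) (simp add: energy_self)
  then have "ennreal (energy T (snd l)) = liminf (\<lambda>n. ennreal (?a n))"
    by (simp add: lim_imp_Liminf)
  also have "\<dots> \<le> liminf (\<lambda>n. ennreal (energy T (snd (z n))))"
  proof (intro Liminf_mono always_eventually allI ennreal_leI energy_lower_bound l)
    show "snd (z n) \<in> controls T U" for n using z[of n] by (auto simp: topspace_state_control_top)
  qed
  finally show ?thesis .
qed

end

section \<open>Square-integrable densities\<close>

text \<open>Continuous functions that decrease to the indicator of a closed nonempty
  \<open>F\<close>.\<close>

definition cutoff :: "'b::metric_space set \<Rightarrow> nat \<Rightarrow> 'b \<Rightarrow> real" where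
  "cutoff F n x = max 0 (1 - real n * infdist x F)"

lemma cutoff_continuous: "continuous_on S (cutoff F n)"
  unfolding cutoff_def by (intro continuous_intros)

lemma cutoff_range: "0 \<le> cutoff F n x" "cutoff F n x \<le> 1"
  using infdist_nonneg[of x F] by (auto simp: cutoff_def)

lemma cutoff_tendsto_indicator:
  assumes F: "closed F" "F \<noteq> {}"
  shows "(\<lambda>n. cutoff F n x) \<longlonglongrightarrow> indicator F x"
proof (cases "x \<in> F")
  case True
  then show ?thesis by (simp add: cutoff_def)
next
  case False
  then have pos: "infdist x F > 0"
    using in_closed_iff_infdist_zero[OF F] infdist_nonneg[of x F] by (metis less_eq_real_def)
  have "\<forall>\<^sub>F n in sequentially. 1 / infdist x F \<le> real n"
    using filterlim_real_sequentially by (simp add: filterlim_at_top)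
  then have "\<forall>\<^sub>F n in sequentially. cutoff F n x = indicator F x"
    by eventually_elim (use pos False in \<open>auto simp: cutoff_def field_simps\<close>)
  then show ?thesis by (rule tendsto_eventually)
qed

text \<open>The index starts at \<open>Suc n\<close> since \<open>cutoff F 0\<close> is identically
  1 and has no bounded support.\<close>

lemma cutoff_support:
  assumes "cutoff F (Suc n) x \<noteq> 0" shows "infdist x F < 1"
proof -
  have "real (Suc n) * infdist x F < 1" using assms by (auto simp: cutoff_def max_def split: if_splits)
  moreover have "infdist x F \<le> real (Suc n) * infdist x F"
    using infdist_nonneg[of x F] by (simp add: mult_le_cancel_right1)
  ultimately show ?thesis by linarith
qed

text \<open>Cutoffs recover the measure of every closed set, and closed sets generate the Borel sets
  and are stable under intersection.\<close>

lemma finite_borel_measure_eqI: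
  fixes \<mu> \<nu> :: "'b::euclidean_space measure"
  assumes \<mu>: "finite_measure \<mu>" "sets \<mu> = sets borel" and \<nu>: "finite_measure \<nu>" "sets \<nu> = sets borel"
    and eq: "\<And>(\<phi> :: 'b \<Rightarrow> real) b. \<lbrakk>continuous_on UNIV \<phi>; \<And>x. \<bar>\<phi> x\<bar> \<le> b\<rbrakk> \<Longrightarrow> (\<integral>x. \<phi> x \<partial>\<mu>) = (\<integral>x. \<phi> x \<partial>\<nu>)"
  shows "\<mu> = \<nu>"
proof -
  have closed: "emeasure \<mu> F = emeasure \<nu> F" if F: "closed F" for F
  proof (cases "F = {}")
    case False
    have lim: "(\<lambda>n. \<integral>x. cutoff F n x \<partial>\<kappa>) \<longlonglongrightarrow> measure \<kappa> F"
      if \<kappa>: "finite_measure \<kappa>" "sets \<kappa> = sets borel" for \<kappa>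
    proof -
      have bm: "borel_measurable \<kappa> = borel_measurable borel" by (rule measurable_cong_sets[OF \<kappa>(2) refl])
      have "(\<lambda>n. \<integral>x. cutoff F n x \<partial>\<kappa>) \<longlonglongrightarrow> (\<integral>x. indicator F x \<partial>\<kappa>)"
      proof (rule integral_dominated_convergence[where w = "\<lambda>_. 1"])
        show "cutoff F n \<in> borel_measurable \<kappa>" for n
          unfolding bm by (rule borel_measurable_continuous_onI[OF cutoff_continuous])
        show "(indicator F :: 'b \<Rightarrow> real) \<in> borel_measurable \<kappa>" unfolding bm using F by simp
        show "AE x in \<kappa>. (\<lambda>n. cutoff F n x) \<longlonglongrightarrow> indicator F x"
          using cutoff_tendsto_indicator[OF F False] by simp
        show "AE x in \<kappa>. norm (cutoff F n x) \<le> 1" for n using cutoff_range[where F = F] by simp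
      qed (rule finite_measure.integrable_const[OF \<kappa>(1)])
      then show ?thesis using F \<kappa>(2) sets_eq_imp_space_eq[OF \<kappa>(2)] by simp
    qed
    have "(\<integral>x. cutoff F n x \<partial>\<mu>) = (\<integral>x. cutoff F n x \<partial>\<nu>)" for n
      using cutoff_range[where F = F] by (intro eq[of _ 1] cutoff_continuous) simp
    then have "measure \<mu> F = measure \<nu> F"
      using lim[OF \<mu>] lim[OF \<nu>] by (simp add: LIMSEQ_unique)
    then show ?thesis using \<mu>(1) \<nu>(1) by (simp add: finite_measure.emeasure_eq_measure)
  qed simp
  show ?thesis
  proof (rule measure_eqI_generator_eq[where E = "{F. closed F}" and \<Omega> = UNIV and A = "\<lambda>_. UNIV"])
    show "Int_stable {F :: 'b set. closed F}" by (auto simp: Int_stable_def)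
    show "sets \<mu> = sigma_sets UNIV {F. closed F}" "sets \<nu> = sigma_sets UNIV {F. closed F}"
      using \<mu>(2) \<nu>(2) by (simp_all add: borel_eq_closed)
    show "emeasure \<mu> UNIV \<noteq> \<infinity>" using \<mu>(1) by (simp add: finite_measure.emeasure_finite)
  qed (use closed in auto)
qed

lemma prob_density_facts:
  fixes \<nu> :: "'b::euclidean_space measure"
  assumes \<nu>: "prob_space \<nu>" "sets \<nu> = sets borel" and ac: "absolutely_continuous lborel \<nu>"
  obtains D where "D \<in> borel_measurable borel" "\<And>x. 0 \<le> D x" "\<nu> = density lborel (\<lambda>x. ennreal (D x))"
    "(\<integral>\<^sup>+x. (RN_deriv lborel \<nu> x)\<^sup>2 \<partial>lborel) = (\<integral>\<^sup>+x. ennreal ((D x)\<^sup>2) \<partial>lborel)"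
proof -
  have sets: "sets \<nu> = sets lborel" using \<nu>(2) by simp
  obtain D where D: "D \<in> borel_measurable lborel" "AE x in lborel. RN_deriv lborel \<nu> x = ennreal (D x)" "\<And>x. 0 \<le> D x"
    using sigma_finite_measure.real_RN_deriv[OF sigma_finite_lborel prob_space.finite_measure[OF \<nu>(1)] ac sets] by metis
  have "\<nu> = density lborel (RN_deriv lborel \<nu>)"
    using sigma_finite_measure.density_RN_deriv[OF sigma_finite_lborel ac] \<nu>(2) by simp
  also have "\<dots> = density lborel (\<lambda>x. ennreal (D x))"
    using D by (intro density_cong) auto
  finally have dens: "\<nu> = density lborel (\<lambda>x. ennreal (D x))" .
  have "(\<integral>\<^sup>+x. (RN_deriv lborel \<nu> x)\<^sup>2 \<partial>lborel) = (\<integral>\<^sup>+x. ennreal ((D x)\<^sup>2) \<partial>lborel)"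
    using D(2) by (intro nn_integral_cong_AE) (auto simp: ennreal_power D(3) elim!: eventually_mono)
  then show ?thesis using D dens by (intro that[of D]) auto
qed

text \<open>For a probability density \<open>D\<close> on \<open>R\<close> one has \<open>\<integral>\<^sub>R (D - 1/c)\<^sup>2 = \<integral> D\<^sup>2 - 1/c\<close>, where \<open>c\<close> is
  the volume of \<open>R\<close>. So the uniform density is the one of least \<open>L\<^sup>2\<close> norm, and every
  density of almost least norm is close to it.\<close>

lemma density_near_uniform:
  fixes \<nu> :: "'b::euclidean_space measure" and R :: "'b set"
  assumes R: "R \<in> sets borel" "0 < emeasure lborel R" "emeasure lborel R < \<infinity>"
    and \<nu>: "prob_space \<nu>" "sets \<nu> = sets borel" "AE x in \<nu>. x \<in> R" and ac: "absolutely_continuous lborel \<nu>"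
    and fin: "(\<integral>\<^sup>+x. (RN_deriv lborel \<nu> x)\<^sup>2 \<partial>lborel) = ennreal Q" "0 \<le> Q"
  defines "c \<equiv> measure lborel R"
  shows "1 / c \<le> Q"
    "\<lbrakk>\<phi> \<in> borel_measurable borel; \<And>x. \<bar>\<phi> x\<bar> \<le> b; s > 0\<rbrakk> \<Longrightarrow>
      \<bar>(\<integral>x. \<phi> x \<partial>\<nu>) - (\<integral>x. \<phi> x \<partial>uniform_measure lborel R)\<bar> \<le> b * ((s * (Q - 1 / c) + c / s) / 2)"
proof -
  obtain D where D: "D \<in> borel_measurable borel" "\<And>x. 0 \<le> D x" "\<nu> = density lborel (\<lambda>x. ennreal (D x))"
    and D2: "(\<integral>\<^sup>+x. (RN_deriv lborel \<nu> x)\<^sup>2 \<partial>lborel) = (\<integral>\<^sup>+x. ennreal ((D x)\<^sup>2) \<partial>lborel)"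
    by (rule prob_density_facts[OF \<nu>(1,2) ac]) blast
  have eR: "emeasure lborel R = ennreal c"
    using R(3) by (simp add: c_def emeasure_eq_ennreal_measure less_top)
  then have c: "c > 0" using R(2) by (simp add: ennreal_less_zero_iff)
  have D2_int: "integrable lborel (\<lambda>x. (D x)\<^sup>2)" and D2_val: "(\<integral>x. (D x)\<^sup>2 \<partial>lborel) = Q"
  proof -
    have *: "(\<integral>\<^sup>+x. ennreal ((D x)\<^sup>2) \<partial>lborel) = ennreal Q" using fin(1) D2 by simp
    show "integrable lborel (\<lambda>x. (D x)\<^sup>2)"
      by (rule integrableI_nn_integral_finite[OF _ _ *]) (use D in auto)
    show "(\<integral>x. (D x)\<^sup>2 \<partial>lborel) = Q"
      using D(1) fin(2) by (subst integral_eq_nn_integral) (auto simp: *)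
  qed
  have "(\<integral>\<^sup>+x. ennreal (D x) \<partial>lborel) = emeasure \<nu> UNIV"
    unfolding D(3) using D(1) by (simp add: emeasure_density)
  also have "\<dots> = ennreal 1"
    using prob_space.emeasure_space_1[OF \<nu>(1)] sets_eq_imp_space_eq[OF \<nu>(2)] by simp
  finally have nD: "(\<integral>\<^sup>+x. ennreal (D x) \<partial>lborel) = ennreal 1" .
  have D_int: "integrable lborel D" and D_val: "(\<integral>x. D x \<partial>lborel) = 1"
    using D nD by (auto intro!: integrableI_nn_integral_finite simp: integral_eq_nn_integral)
  have D_out: "AE x in lborel. x \<notin> R \<longrightarrow> D x = 0"
  proof -
    have "AE x in density lborel (\<lambda>x. ennreal (D x)). x \<in> R" using \<nu>(3) by (simp only: D(3)[symmetric])
    then have "AE x in lborel. 0 < ennreal (D x) \<longrightarrow> x \<in> R" using D(1) by (subst (asm) AE_density) auto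
    then show ?thesis by eventually_elim (use D(2) in \<open>auto simp: less_eq_real_def\<close>)
  qed
  define u where "u = (\<lambda>x. indicator R x / c :: real)"
  have u_meas: "u \<in> borel_measurable borel" unfolding u_def using R(1) by measurable
  have iR: "integrable lborel (indicator R :: _ \<Rightarrow> real)" using R by (intro integrable_real_indicator) auto
  \<comment> \<open>Off \<open>R\<close> both densities vanish, and on \<open>R\<close> the uniform
    one is constant, so the mixed term is a multiple of \<open>D\<close> and its integral is known
    from the total mass.\<close>
  have diff_eq: "AE x in lborel. (D x - u x)\<^sup>2 = (D x)\<^sup>2 - 2 / c * D x + indicator R x / c\<^sup>2"
    using D_out by eventually_elim (auto simp: u_def indicator_def power2_eq_square algebra_simps)
  have sq_int: "integrable lborel (\<lambda>x. (D x - u x)\<^sup>2)"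
    by (subst integrable_cong_AE[OF _ _ diff_eq]) (use D u_meas D2_int D_int iR R in auto)
  have "(\<integral>x. (D x - u x)\<^sup>2 \<partial>lborel) = (\<integral>x. (D x)\<^sup>2 - 2 / c * D x + indicator R x / c\<^sup>2 \<partial>lborel)"
    by (rule integral_cong_AE[OF _ _ diff_eq]) (use D u_meas R in auto)
  also have "\<dots> = Q - 2 / c * 1 + c / c\<^sup>2"
    using D2_int D_int iR R(1) by (simp add: D2_val D_val c_def)
  also have "\<dots> = Q - 1 / c" using c by (simp add: power2_eq_square field_simps)
  finally have sq_val: "(\<integral>x. (D x - u x)\<^sup>2 \<partial>lborel) = Q - 1 / c" .
  moreover have "0 \<le> (\<integral>x. (D x - u x)\<^sup>2 \<partial>lborel)" by simp
  ultimately show "1 / c \<le> Q" by simp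
  assume \<phi>: "\<phi> \<in> borel_measurable borel" "\<And>x. \<bar>\<phi> x\<bar> \<le> b" and s: "s > 0"
  have b: "b \<ge> 0" using \<phi>(2)[of undefined] by linarith
  have u_int: "integrable lborel u" unfolding u_def using iR by simp
  have \<nu>_val: "(\<integral>x. \<phi> x \<partial>\<nu>) = (\<integral>x. D x * \<phi> x \<partial>lborel)"
    unfolding D(3) using D \<phi>(1) by (subst integral_density) auto
  have m_val: "(\<integral>x. \<phi> x \<partial>uniform_measure lborel R) = (\<integral>x. u x * \<phi> x \<partial>lborel)"
  proof -
    have "uniform_measure lborel R = density lborel (\<lambda>x. ennreal (u x))"
      unfolding uniform_measure_def eR
    proof (rule density_cong)
      show "(\<lambda>x. indicator R x / ennreal c) \<in> borel_measurable lborel" using R(1) by measurable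
      have "1 / ennreal c = ennreal (1 / c)" using c by (metis divide_ennreal ennreal_1 zero_le_one)
      then show "AE x in lborel. indicator R x / ennreal c = ennreal (u x)"
        by (auto simp: u_def indicator_def)
    qed (use u_meas in simp)
    then show ?thesis using u_meas \<phi>(1) c by (simp add: integral_density u_def)
  qed
  have prod_int: "integrable lborel (\<lambda>x. h x * \<phi> x)" if h: "integrable lborel h" for h
  proof (rule Bochner_Integration.integrable_bound[OF integrable_mult_right[OF h, of b]])
    show "AE x in lborel. norm (h x * \<phi> x) \<le> norm (b * h x)"
      using \<phi>(2) b by (auto simp: abs_mult mult.commute[of b] intro!: mult_left_mono)
  qed (use h \<phi>(1) in auto)
  have "(\<integral>x. \<phi> x \<partial>\<nu>) - (\<integral>x. \<phi> x \<partial>uniform_measure lborel R) = (\<integral>x. (D x - u x) * \<phi> x \<partial>lborel)"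
    unfolding \<nu>_val m_val using prod_int[OF D_int] prod_int[OF u_int] by (simp add: left_diff_distrib)
  also have "\<bar>\<dots>\<bar> \<le> (\<integral>x. b * ((s * (D x - u x)\<^sup>2 + indicator R x / s) / 2) \<partial>lborel)"
  proof (rule order.trans[OF integral_abs_bound integral_mono_AE])
    show "integrable lborel (\<lambda>x. \<bar>(D x - u x) * \<phi> x\<bar>)"
      using prod_int[of "\<lambda>x. D x - u x"] D_int u_int by simp
    show "integrable lborel (\<lambda>x. b * ((s * (D x - u x)\<^sup>2 + indicator R x / s) / 2))"
      using sq_int iR by simp
    show "AE x in lborel. \<bar>(D x - u x) * \<phi> x\<bar> \<le> b * ((s * (D x - u x)\<^sup>2 + indicator R x / s) / 2)"
      using D_out
    proof eventually_elim
      case (elim x)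
      have "\<bar>D x - u x\<bar> \<le> (s * (D x - u x)\<^sup>2 + indicator R x / s) / 2"
      proof (cases "x \<in> R")
        case True
        \<comment> \<open>Young's inequality \<open>2 * \<bar>a\<bar> \<le> s * a^2 + 1 / s\<close>
          on \<open>R\<close>. The free parameter \<open>s\<close> is later taken large to make the
          volume term small while the excess \<open>Q - 1 / c\<close> tends to 0.\<close>
        have "0 \<le> (s * \<bar>D x - u x\<bar> - 1)\<^sup>2 / s" using s by simp
        also have "\<dots> = s * (D x - u x)\<^sup>2 - 2 * \<bar>D x - u x\<bar> + 1 / s"
          using s by (simp add: power2_eq_square field_simps abs_mult_self_eq)
        finally show ?thesis using True by simp
      next
        case False
        then show ?thesis using elim s by (simp add: u_def)
      qed
      then have "\<bar>D x - u x\<bar> * \<bar>\<phi> x\<bar> \<le> ((s * (D x - u x)\<^sup>2 + indicator R x / s) / 2) * b"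
        using \<phi>(2) order.trans[OF abs_ge_zero] by (intro mult_mono) blast+
      then show ?case by (simp add: abs_mult mult.commute)
    qed
  qed
  also have "\<dots> = b * ((s * (Q - 1 / c) + c / s) / 2)"
    using sq_int iR R(1) by (simp add: sq_val c_def)
  finally show "\<bar>(\<integral>x. \<phi> x \<partial>\<nu>) - (\<integral>x. \<phi> x \<partial>uniform_measure lborel R)\<bar> \<le> b * ((s * (Q - 1 / c) + c / s) / 2)" .
qed

lemma uniform_measure_density:
  fixes R :: "'b::euclidean_space set"
  assumes R: "R \<in> sets borel" "0 < emeasure lborel R" "emeasure lborel R < \<infinity>"
  shows "absolutely_continuous lborel (uniform_measure lborel R)"
    "(\<integral>\<^sup>+x. (RN_deriv lborel (uniform_measure lborel R) x)\<^sup>2 \<partial>lborel) = ennreal (1 / measure lborel R)"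
proof -
  define c where "c = measure lborel R"
  have eR: "emeasure lborel R = ennreal c"
    using R(3) by (simp add: c_def emeasure_eq_ennreal_measure less_top)
  then have c: "c > 0" using R(2) by (simp add: ennreal_less_zero_iff)
  have m: "(\<lambda>x. indicator R x / emeasure lborel R) \<in> borel_measurable lborel" using R(1) by measurable
  show "absolutely_continuous lborel (uniform_measure lborel R)"
    unfolding uniform_measure_def using m by (rule absolutely_continuousI_density)
  have "AE x in lborel. indicator R x / emeasure lborel R = RN_deriv lborel (uniform_measure lborel R) x"
    by (rule sigma_finite_measure.RN_deriv_unique[OF sigma_finite_lborel m]) (simp add: uniform_measure_def)
  then have "(\<integral>\<^sup>+x. (RN_deriv lborel (uniform_measure lborel R) x)\<^sup>2 \<partial>lborel) = (\<integral>\<^sup>+x. ennreal (1 / c\<^sup>2) * indicator R x \<partial>lborel)"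
  proof (intro nn_integral_cong_AE, eventually_elim)
    case (elim x)
    have "(indicator R x / emeasure lborel R)\<^sup>2 = ennreal (1 / c\<^sup>2) * indicator R x"
    proof (cases "x \<in> R")
      case True
      have "1 / ennreal c = ennreal (1 / c)" using c by (metis divide_ennreal ennreal_1 zero_le_one)
      then show ?thesis using True c by (simp add: eR ennreal_power power_divide)
    qed (simp add: eR)
    then show ?case using elim by simp
  qed
  also have "\<dots> = ennreal (1 / c\<^sup>2) * ennreal c" using R(1) by (simp add: nn_integral_cmult_indicator eR)
  also have "\<dots> = ennreal (1 / c)" using c by (simp add: ennreal_mult[symmetric] power2_eq_square)
  finally show "(\<integral>\<^sup>+x. (RN_deriv lborel (uniform_measure lborel R) x)\<^sup>2 \<partial>lborel) = ennreal (1 / measure lborel R)"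
    by (simp add: c_def)
qed

text \<open>On a compact null set \<open>F\<close>, test with \<open>t\<close> times cutoffs of
  \<open>F\<close>: the quadratic term disappears in the limit, so
  \<open>measure \<nu> F \<le> W / (2 * t)\<close> for every \<open>t > 0\<close>. Inner regularity
  extends this to all null sets.\<close>

lemma absolutely_continuous_of_quadratic_bound:
  fixes \<nu> :: "'b::euclidean_space measure"
  assumes \<nu>: "prob_space \<nu>" "sets \<nu> = sets borel"
    and bound: "\<And>(\<phi> :: 'b \<Rightarrow> real) b. \<lbrakk>continuous_on UNIV \<phi>; \<And>x. \<bar>\<phi> x\<bar> \<le> b; bounded {x. \<phi> x \<noteq> 0}\<rbrakk> \<Longrightarrow>
      2 * (\<integral>x. \<phi> x \<partial>\<nu>) - (\<integral>x. (\<phi> x)\<^sup>2 \<partial>lborel) \<le> W"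
  shows "absolutely_continuous lborel \<nu>"
proof -
  interpret \<nu>: prob_space \<nu> by (rule \<nu>(1))
  have bm: "borel_measurable \<nu> = borel_measurable borel" by (rule measurable_cong_sets[OF \<nu>(2) refl])
  have compact: "emeasure \<nu> F = 0" if F: "compact F" "emeasure lborel F = 0" for F
  proof (cases "F = {}")
    case False
    have ineq: "measure \<nu> F \<le> W / (2 * t)" if t: "t > 0" for t
    proof -
      define \<phi> where "\<phi> = (\<lambda>n x. t * cutoff F (Suc n) x)"
      have lim: "(\<lambda>n. cutoff F (Suc n) x) \<longlonglongrightarrow> indicator F x" for x
        using cutoff_tendsto_indicator[OF compact_imp_closed[OF F(1)] False] by (rule LIMSEQ_Suc)
      obtain K where K: "K > 0" "\<And>x. x \<in> F \<Longrightarrow> norm x \<le> K"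
        using compact_imp_bounded[OF F(1)] by (auto simp: bounded_pos)
      have supp: "norm x \<le> K + 1" if "cutoff F (Suc n) x \<noteq> 0" for n x
      proof -
        obtain y where "y \<in> F" "infdist x F = dist x y"
          using infdist_attains_inf[OF compact_imp_closed[OF F(1)] False] by metis
        then show ?thesis
          using cutoff_support[OF that] K(2)[of y] norm_triangle_ineq[of y "x - y"] by (simp add: dist_norm)
      qed
      have "2 * (\<integral>x. \<phi> n x \<partial>\<nu>) - (\<integral>x. (\<phi> n x)\<^sup>2 \<partial>lborel) \<le> W" for n
      proof (rule bound)
        show "continuous_on UNIV (\<phi> n)" unfolding \<phi>_def by (intro continuous_intros cutoff_continuous)
        show "\<bar>\<phi> n x\<bar> \<le> t" for x
          using cutoff_range[of F "Suc n" x] t by (simp add: \<phi>_def abs_mult mult_left_le)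
        show "bounded {x. \<phi> n x \<noteq> 0}"
          using supp[of n] by (intro boundedI[where B = "K + 1"]) (auto simp: \<phi>_def)
      qed
      moreover have "(\<lambda>n. 2 * (\<integral>x. \<phi> n x \<partial>\<nu>) - (\<integral>x. (\<phi> n x)\<^sup>2 \<partial>lborel)) \<longlonglongrightarrow> 2 * (t * measure \<nu> F) - 0"
      proof (intro tendsto_diff tendsto_mult tendsto_const)
        have "(\<lambda>n. \<integral>x. \<phi> n x \<partial>\<nu>) \<longlonglongrightarrow> (\<integral>x. t * indicator F x \<partial>\<nu>)"
        proof (rule integral_dominated_convergence[where w = "\<lambda>_. t"])
          show "\<phi> n \<in> borel_measurable \<nu>" for n
            unfolding bm \<phi>_def by (intro borel_measurable_times borel_measurable_const borel_measurable_continuous_onI[OF cutoff_continuous])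
          show "(\<lambda>x. t * indicator F x) \<in> borel_measurable \<nu>" unfolding bm using compact_imp_closed[OF F(1)] by simp
          show "AE x in \<nu>. (\<lambda>n. \<phi> n x) \<longlonglongrightarrow> t * indicator F x"
            unfolding \<phi>_def by (intro AE_I2 tendsto_mult tendsto_const lim)
          show "AE x in \<nu>. norm (\<phi> n x) \<le> t" for n
            using cutoff_range[of F "Suc n"] t by (simp add: \<phi>_def abs_mult mult_left_le)
        qed simp
        then show "(\<lambda>n. \<integral>x. \<phi> n x \<partial>\<nu>) \<longlonglongrightarrow> t * measure \<nu> F"
          using compact_imp_closed[OF F(1)] \<nu>(2) sets_eq_imp_space_eq[OF \<nu>(2)] by simp
        have "(\<lambda>n. \<integral>x. (\<phi> n x)\<^sup>2 \<partial>lborel) \<longlonglongrightarrow> (\<integral>x. (t * indicator F x)\<^sup>2 \<partial>lborel)"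
        proof (rule integral_dominated_convergence[where w = "\<lambda>x. t\<^sup>2 * indicator (cball 0 (K + 1)) x"])
          show "(\<lambda>x. (\<phi> n x)\<^sup>2) \<in> borel_measurable lborel" for n
            unfolding \<phi>_def by (intro borel_measurable_power borel_measurable_times borel_measurable_const)
              (simp add: borel_measurable_continuous_onI[OF cutoff_continuous])
          show "(\<lambda>x. (t * indicator F x)\<^sup>2) \<in> borel_measurable lborel" using compact_imp_closed[OF F(1)] by simp
          show "integrable lborel (\<lambda>x. t\<^sup>2 * indicator (cball (0::'b) (K + 1)) x)"
            by (intro integrable_mult_right integrable_real_indicator) (simp_all add: emeasure_lborel_cball_finite[unfolded infinity_ennreal_def])
          show "AE x in lborel. (\<lambda>n. (\<phi> n x)\<^sup>2) \<longlonglongrightarrow> (t * indicator F x)\<^sup>2"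
            unfolding \<phi>_def by (intro AE_I2 tendsto_power tendsto_mult tendsto_const lim)
          show "AE x in lborel. norm ((\<phi> n x)\<^sup>2) \<le> t\<^sup>2 * indicator (cball 0 (K + 1)) x" for n
          proof (rule AE_I2)
            fix x
            have "(cutoff F (Suc n) x)\<^sup>2 \<le> 1" using cutoff_range[of F "Suc n" x] by (simp add: power_le_one)
            then show "norm ((\<phi> n x)\<^sup>2) \<le> t\<^sup>2 * indicator (cball 0 (K + 1)) x"
              using supp[of n x] by (cases "cutoff F (Suc n) x = 0") (auto simp: \<phi>_def power_mult_distrib mult_left_le)
          qed
        qed
        moreover have "(\<integral>x. (t * indicator F x)\<^sup>2 \<partial>lborel) = 0"
        proof -
          have "AE x in lborel. x \<notin> F" using F compact_imp_closed[OF F(1)] by (intro AE_not_in) (auto simp: null_sets_def)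
          then have "AE x in lborel. (t * indicator F x)\<^sup>2 = 0" by eventually_elim simp
          then show ?thesis by (rule integral_eq_zero_AE)
        qed
        ultimately show "(\<lambda>n. \<integral>x. (\<phi> n x)\<^sup>2 \<partial>lborel) \<longlonglongrightarrow> 0" by simp
      qed
      ultimately have "2 * (t * measure \<nu> F) - 0 \<le> W" by (intro LIMSEQ_le_const2) auto
      then show ?thesis using t by (simp add: field_simps)
    qed
    have "measure \<nu> F \<le> 0"
    proof (rule tendsto_lowerbound)
      show "(\<lambda>n. W / (2 * real (Suc n))) \<longlonglongrightarrow> 0"
        using tendsto_mult_right_zero[OF LIMSEQ_inverse_real_of_nat, of "W / 2"] by (simp add: field_simps)
      show "\<forall>\<^sub>F n in sequentially. measure \<nu> F \<le> W / (2 * real (Suc n))"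
        by (intro always_eventually allI ineq) simp
    qed simp
    then show ?thesis by (simp add: \<nu>.emeasure_eq_measure measure_le_0_iff)
  qed simp
  show ?thesis
    unfolding absolutely_continuous_def
  proof
    fix N :: "'b set" assume N: "N \<in> null_sets lborel"
    then have Nb: "N \<in> sets borel" by auto
    have "emeasure \<nu> N = (SUP K\<in>{K. K \<subseteq> N \<and> compact K}. emeasure \<nu> K)"
      by (rule inner_regular[OF \<nu>(2) _ Nb]) simp
    also have "\<dots> = (SUP K\<in>{K. K \<subseteq> N \<and> compact K}. 0)"
    proof (intro SUP_cong refl)
      fix K assume K: "K \<in> {K. K \<subseteq> N \<and> compact K}"
      then have "emeasure lborel K \<le> emeasure lborel N" using Nb by (intro emeasure_mono) auto
      then have "emeasure lborel K = 0" using N by auto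
      then show "emeasure \<nu> K = 0" using K compact by auto
    qed
    finally have "emeasure \<nu> N = 0" by (simp add: SUP_constant bot_ennreal)
    then show "N \<in> null_sets \<nu>" using Nb \<nu>(2) by (auto simp: null_sets_def)
  qed
qed

text \<open>\<open>h\<close> is an almost everywhere limit of continuous functions, which are
  clamped to height \<open>m\<close> and cut off outside a ball so that they are admissible tests
  and dominated.\<close>

lemma quadratic_bound_borel:
  fixes \<nu> :: "'b::euclidean_space measure"
  assumes \<nu>: "prob_space \<nu>" "sets \<nu> = sets borel" and ac: "absolutely_continuous lborel \<nu>"
    and bound: "\<And>(\<phi> :: 'b \<Rightarrow> real) b. \<lbrakk>continuous_on UNIV \<phi>; \<And>x. \<bar>\<phi> x\<bar> \<le> b; bounded {x. \<phi> x \<noteq> 0}\<rbrakk> \<Longrightarrow>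
      2 * (\<integral>x. \<phi> x \<partial>\<nu>) - (\<integral>x. (\<phi> x)\<^sup>2 \<partial>lborel) \<le> W"
    and h: "h \<in> borel_measurable borel" "\<And>x. \<bar>h x\<bar> \<le> m" "\<And>x. norm x > r \<Longrightarrow> h x = 0" and r: "r \<ge> 0"
  shows "2 * (\<integral>x. h x \<partial>\<nu>) - (\<integral>x. (h x)\<^sup>2 \<partial>lborel) \<le> W"
proof -
  interpret \<nu>: prob_space \<nu> by (rule \<nu>(1))
  have bm: "borel_measurable \<nu> = borel_measurable borel" by (rule measurable_cong_sets[OF \<nu>(2) refl])
  have m: "m \<ge> 0" using h(2)[of undefined] by linarith
  have "h \<in> borel_measurable lebesgue" using h(1) by (intro measurable_completion) simp
  then have "h measurable_on UNIV" using lebesgue_measurable_imp_measurable_on[of h UNIV] by simp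
  then obtain N q where N: "negligible N" and q: "\<And>n. continuous_on UNIV (q n)"
    and q_lim: "\<And>x. x \<notin> N \<Longrightarrow> (\<lambda>n. q n x) \<longlonglongrightarrow> h x" by (auto simp: measurable_on_def)
  \<comment> \<open>Equal to 1 on the ball of radius \<open>r\<close>, where \<open>h\<close> lives,
    and to 0 beyond \<open>r + 1\<close>.\<close>
  define cut where "cut = (\<lambda>x::'b. max 0 (min 1 (r + 1 - norm x)))"
  define \<phi> where "\<phi> = (\<lambda>n x. cut x * max (- m) (min m (q n x)))"
  have \<phi>_cont: "continuous_on UNIV (\<phi> n)" for n
    unfolding \<phi>_def cut_def by (intro continuous_intros q)
  have cut_range: "0 \<le> cut x" "cut x \<le> 1" for x by (auto simp: cut_def)
  have \<phi>_bound: "\<bar>\<phi> n x\<bar> \<le> m" for n x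
  proof -
    have "\<bar>\<phi> n x\<bar> \<le> 1 * m" unfolding \<phi>_def abs_mult using cut_range[of x] m by (intro mult_mono) auto
    then show ?thesis by simp
  qed
  have \<phi>_supp: "norm x \<le> r + 1" if "\<phi> n x \<noteq> 0" for n x
    using that by (auto simp: \<phi>_def cut_def max_def min_def split: if_splits)
  have "N \<in> null_sets lebesgue" using N by (simp add: negligible_iff_null_sets)
  then have ae: "AE x in lborel. x \<notin> N"
    using AE_not_in AE_completion_iff by blast
  have \<phi>_lim: "(\<lambda>n. \<phi> n x) \<longlonglongrightarrow> h x" if "x \<notin> N" for x
  proof -
    have "(\<lambda>n. \<phi> n x) \<longlonglongrightarrow> cut x * max (- m) (min m (h x))"
      unfolding \<phi>_def by (intro tendsto_intros q_lim that)
    moreover have "cut x * max (- m) (min m (h x)) = h x"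
    proof (cases "norm x > r")
      case False
      then have "cut x = 1" by (simp add: cut_def)
      then show ?thesis using h(2)[of x] by (simp add: abs_le_iff)
    qed (use h(3) m in auto)
    ultimately show ?thesis by simp
  qed
  \<comment> \<open>The approximation converges off a Lebesgue null set; absolute continuity makes
    it null for \<open>\<nu>\<close> as well, so the linear term converges too.\<close>
  have ae\<nu>: "AE x in \<nu>. x \<notin> N"
    by (rule absolutely_continuous_AE[OF _ ac ae]) (simp add: \<nu>(2))
  have "2 * (\<integral>x. \<phi> n x \<partial>\<nu>) - (\<integral>x. (\<phi> n x)\<^sup>2 \<partial>lborel) \<le> W" for n
    using \<phi>_cont \<phi>_bound \<phi>_supp[of n] by (intro bound[of _ m] boundedI[where B = "r + 1"]) auto
  moreover have "(\<lambda>n. 2 * (\<integral>x. \<phi> n x \<partial>\<nu>) - (\<integral>x. (\<phi> n x)\<^sup>2 \<partial>lborel)) \<longlonglongrightarrow> 2 * (\<integral>x. h x \<partial>\<nu>) - (\<integral>x. (h x)\<^sup>2 \<partial>lborel)"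
  proof (intro tendsto_diff tendsto_mult tendsto_const)
    show "(\<lambda>n. \<integral>x. \<phi> n x \<partial>\<nu>) \<longlonglongrightarrow> (\<integral>x. h x \<partial>\<nu>)"
    proof (rule integral_dominated_convergence[where w = "\<lambda>_. m"])
      show "\<phi> n \<in> borel_measurable \<nu>" for n
        unfolding bm by (rule borel_measurable_continuous_onI[OF \<phi>_cont])
      show "h \<in> borel_measurable \<nu>" unfolding bm by (rule h)
      show "AE x in \<nu>. (\<lambda>n. \<phi> n x) \<longlonglongrightarrow> h x" using ae\<nu> by eventually_elim (rule \<phi>_lim)
    qed (use \<phi>_bound in auto)
    show "(\<lambda>n. \<integral>x. (\<phi> n x)\<^sup>2 \<partial>lborel) \<longlonglongrightarrow> (\<integral>x. (h x)\<^sup>2 \<partial>lborel)"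
    proof (rule integral_dominated_convergence[where w = "\<lambda>x. m\<^sup>2 * indicator (cball 0 (r + 1)) x"])
      show "(\<lambda>x. (\<phi> n x)\<^sup>2) \<in> borel_measurable lborel" for n
        using borel_measurable_continuous_onI[OF \<phi>_cont[of n]] by simp
      show "(\<lambda>x. (h x)\<^sup>2) \<in> borel_measurable lborel" using h(1) by simp
      show "integrable lborel (\<lambda>x. m\<^sup>2 * indicator (cball (0::'b) (r + 1)) x)"
        by (intro integrable_mult_right integrable_real_indicator) (simp_all add: emeasure_lborel_cball_finite[unfolded infinity_ennreal_def])
      show "AE x in lborel. (\<lambda>n. (\<phi> n x)\<^sup>2) \<longlonglongrightarrow> (h x)\<^sup>2"
        using ae by eventually_elim (intro tendsto_power \<phi>_lim)
      have "norm ((\<phi> n x)\<^sup>2) \<le> m\<^sup>2 * indicator (cball 0 (r + 1)) x" for n x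
        using \<phi>_supp[of n x] \<phi>_bound[of n x] m
        by (cases "\<phi> n x = 0") (auto simp: indicator_def abs_le_square_iff[symmetric])
      then show "AE x in lborel. norm ((\<phi> n x)\<^sup>2) \<le> m\<^sup>2 * indicator (cball 0 (r + 1)) x" for n by simp
    qed
  qed
  ultimately show ?thesis by (intro LIMSEQ_le_const2) auto
qed

text \<open>A Riesz representation in disguise: by duality the hypothesis bounds the \<open>L\<^sup>2\<close> norm of
  the density; it is tested with truncations of the density itself.\<close>

lemma L2_density_of_quadratic_bound:
  fixes \<nu> :: "'b::euclidean_space measure"
  assumes \<nu>: "prob_space \<nu>" "sets \<nu> = sets borel"
    and bound: "\<And>(\<phi> :: 'b \<Rightarrow> real) b. \<lbrakk>continuous_on UNIV \<phi>; \<And>x. \<bar>\<phi> x\<bar> \<le> b; bounded {x. \<phi> x \<noteq> 0}\<rbrakk> \<Longrightarrow>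
      2 * (\<integral>x. \<phi> x \<partial>\<nu>) - (\<integral>x. (\<phi> x)\<^sup>2 \<partial>lborel) \<le> W"
  shows "absolutely_continuous lborel \<nu>" "(\<integral>\<^sup>+x. (RN_deriv lborel \<nu> x)\<^sup>2 \<partial>lborel) \<le> ennreal W"
proof -
  show ac: "absolutely_continuous lborel \<nu>"
    by (rule absolutely_continuous_of_quadratic_bound[OF \<nu> bound])
  obtain D where D: "D \<in> borel_measurable borel" "\<And>x. 0 \<le> D x" "\<nu> = density lborel (\<lambda>x. ennreal (D x))"
    and D2: "(\<integral>\<^sup>+x. (RN_deriv lborel \<nu> x)\<^sup>2 \<partial>lborel) = (\<integral>\<^sup>+x. ennreal ((D x)\<^sup>2) \<partial>lborel)"
    by (rule prob_density_facts[OF \<nu> ac]) blast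
  \<comment> \<open>The density truncated in height and in space: a bounded test function that
    increases to \<open>D\<close>.\<close>
  define h where "h = (\<lambda>m x. min (D x) (real m) * indicator (cball 0 (real m)) x)"
  have h_meas: "h m \<in> borel_measurable borel" for m
    unfolding h_def using D(1) by (intro borel_measurable_times borel_measurable_min borel_measurable_indicator) auto
  have h_range: "0 \<le> h m x" "h m x \<le> real m" "h m x \<le> D x" for m x
    using D(2)[of x] by (auto simp: h_def indicator_def)
  have h_supp: "h m x = 0" if "norm x > real m" for m x using that by (simp add: h_def)
  have h_sq: "(\<integral>\<^sup>+x. ennreal ((h m x)\<^sup>2) \<partial>lborel) \<le> ennreal W" for m
  proof -
    have ball_int: "integrable lborel (\<lambda>x. C * indicator (cball (0::'b) (real m)) x)" for C :: real
      by (intro integrable_mult_right integrable_real_indicator) (simp_all add: emeasure_lborel_cball_finite[unfolded infinity_ennreal_def])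
    have sq_int: "integrable lborel (\<lambda>x. (h m x)\<^sup>2)"
    proof (rule Bochner_Integration.integrable_bound[OF ball_int[of "(real m)\<^sup>2"]])
      have "\<bar>(h m x)\<^sup>2\<bar> \<le> (real m)\<^sup>2 * indicator (cball 0 (real m)) x" for x
        using h_range[of m x] h_supp[of m x] by (auto simp: indicator_def intro!: power_mono)
      then show "AE x in lborel. norm ((h m x)\<^sup>2) \<le> norm ((real m)\<^sup>2 * indicator (cball 0 (real m)) x :: real)"
        by auto
    qed (use h_meas[of m] in simp)
    have D_int: "integrable lborel D"
    proof (rule integrableI_nn_integral_finite[where x = 1])
      have "(\<integral>\<^sup>+x. ennreal (D x) \<partial>lborel) = emeasure \<nu> UNIV"
        unfolding D(3) using D(1) by (simp add: emeasure_density)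
      then show "(\<integral>\<^sup>+x. ennreal (D x) \<partial>lborel) = ennreal 1"
        using prob_space.emeasure_space_1[OF \<nu>(1)] sets_eq_imp_space_eq[OF \<nu>(2)] by simp
    qed (use D in auto)
    have Dh_int: "integrable lborel (\<lambda>x. D x * h m x)"
    proof (rule Bochner_Integration.integrable_bound[OF integrable_mult_right[OF D_int, of "real m"]])
      show "AE x in lborel. norm (D x * h m x) \<le> norm (real m * D x)"
        using D(2) h_range[of m] by (auto simp: abs_mult mult.commute[of "real m"] intro!: mult_left_mono)
    qed (use D(1) h_meas[of m] in auto)
    have "(\<integral>x. h m x \<partial>\<nu>) = (\<integral>x. D x * h m x \<partial>lborel)"
      unfolding D(3) using D h_meas[of m] by (subst integral_density) auto
    \<comment> \<open>As \<open>h m \<le> D\<close>, the integral of \<open>h m\<close> against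
      \<open>\<nu>\<close> is at least that of its square. The quadratic bound then leaves a single
      copy of the square integral below \<open>W\<close>.\<close>
    moreover have "(\<integral>x. (h m x)\<^sup>2 \<partial>lborel) \<le> (\<integral>x. D x * h m x \<partial>lborel)"
      using sq_int Dh_int h_range[of m] by (intro integral_mono) (auto simp: power2_eq_square intro!: mult_right_mono)
    moreover have "2 * (\<integral>x. h m x \<partial>\<nu>) - (\<integral>x. (h m x)\<^sup>2 \<partial>lborel) \<le> W"
      by (rule quadratic_bound_borel[OF \<nu> ac bound h_meas, where m = "real m" and r = "real m"])
        (use h_range[of m] h_supp in auto)
    ultimately have "(\<integral>x. (h m x)\<^sup>2 \<partial>lborel) \<le> W" by linarith
    moreover have "(\<integral>\<^sup>+x. ennreal ((h m x)\<^sup>2) \<partial>lborel) = ennreal (\<integral>x. (h m x)\<^sup>2 \<partial>lborel)"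
      by (rule nn_integral_eq_integral[OF sq_int]) simp
    ultimately show ?thesis by (simp add: ennreal_leI)
  qed
  have lim: "(\<lambda>m. h m x) \<longlonglongrightarrow> D x" for x
  proof -
    obtain m0 where m0: "D x + norm x \<le> real m0" using real_arch_simple by blast
    have "\<forall>\<^sub>F m in sequentially. m0 \<le> m" by (rule eventually_ge_at_top)
    then have "\<forall>\<^sub>F m in sequentially. h m x = D x"
    proof eventually_elim
      case (elim m)
      then have "D x + norm x \<le> real m" using m0 by simp
      then show ?case using D(2)[of x] norm_ge_zero[of x] unfolding h_def by (simp del: norm_ge_zero)
    qed
    then show ?thesis by (rule tendsto_eventually)
  qed
  have "(\<integral>\<^sup>+x. ennreal ((D x)\<^sup>2) \<partial>lborel) = (\<integral>\<^sup>+x. liminf (\<lambda>m. ennreal ((h m x)\<^sup>2)) \<partial>lborel)"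
  proof (intro nn_integral_cong)
    fix x
    have "(\<lambda>m. ennreal ((h m x)\<^sup>2)) \<longlonglongrightarrow> ennreal ((D x)\<^sup>2)" by (intro tendsto_ennrealI tendsto_power lim)
    from lim_imp_Liminf[OF _ this]
    show "ennreal ((D x)\<^sup>2) = liminf (\<lambda>m. ennreal ((h m x)\<^sup>2))" by (simp only: trivial_limit_sequentially not_False_eq_True)
  qed
  also have "\<dots> \<le> liminf (\<lambda>m. \<integral>\<^sup>+x. ennreal ((h m x)\<^sup>2) \<partial>lborel)"
    using h_meas by (intro nn_integral_liminf) simp
  also have "\<dots> \<le> liminf (\<lambda>m::nat. ennreal W)"
    by (intro Liminf_mono always_eventually allI h_sq)
  also have "\<dots> = ennreal W" by (simp add: Liminf_const)
  finally show "(\<integral>\<^sup>+x. (RN_deriv lborel \<nu> x)\<^sup>2 \<partial>lborel) \<le> ennreal W" by (simp add: D2)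
qed

section \<open>Mollified measures\<close>

locale mollifier =
  fixes k :: "real^'d \<Rightarrow> real"
  assumes mollifier: "sym_pos_mollifier k"
begin

lemma k_continuous: "continuous_on S k"
proof -
  have "Ck 0 k" using mollifier unfolding sym_pos_mollifier_def by blast
  then show ?thesis by (auto intro: continuous_on_subset)
qed

lemma k_nonneg: "0 \<le> k y" and k_even: "k (- y) = k y" and k_integral: "(\<integral>y. k y \<partial>lborel) = 1"
  using mollifier by (auto simp: sym_pos_mollifier_def)

lemma k_measurable [measurable]: "k \<in> borel_measurable borel"
  by (rule borel_measurable_continuous_onI[OF k_continuous])

lemma k_integrable: "integrable lborel k"
  using k_integral not_integrable_integral_eq[of lborel k] by fastforce

lemma k_bounded: obtains B where "B > 0" "\<And>y. k y \<le> B"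
proof -
  let ?S = "closure {y. k y \<noteq> 0}"
  have "compact (k ` ?S)"
    using mollifier by (intro compact_continuous_image k_continuous) (simp add: sym_pos_mollifier_def)
  then obtain B where B: "\<And>y. y \<in> ?S \<Longrightarrow> \<bar>k y\<bar> \<le> B"
    using compact_imp_bounded by (fastforce simp: bounded_iff)
  have "k y \<le> \<bar>B\<bar> + 1" for y
  proof (cases "k y = 0")
    case False
    then have "y \<in> ?S" using closure_subset[of "{y. k y \<noteq> 0}"] by auto
    from B[OF this] show ?thesis by linarith
  qed simp
  then show ?thesis by (intro that[of "\<bar>B\<bar> + 1"]) auto
qed

section \<open>Scaled kernels and smeared test functions\<close>

abbreviation "ms \<equiv> mollifier_scaled k"

lemma ms_continuous: "continuous_on S (\<lambda>y. ms \<delta> (y - x))" "continuous_on S (\<lambda>x. ms \<delta> (y - x))"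
  unfolding mollifier_scaled_def divide_inverse
  by (intro continuous_intros continuous_on_compose2[OF k_continuous[of UNIV]]; simp)+

lemma ms_measurable [measurable]: "ms \<delta> \<in> borel_measurable borel"
  unfolding mollifier_scaled_def by measurable

lemma ms_nonneg: "\<delta> > 0 \<Longrightarrow> 0 \<le> ms \<delta> y"
  using k_nonneg by (simp add: mollifier_scaled_def)

lemma ms_even: "ms \<delta> (- y) = ms \<delta> y"
  using k_even by (simp add: mollifier_scaled_def)

lemma ms_commute: "ms \<delta> (y - x) = ms \<delta> (x - y)"
  using ms_even[of \<delta> "y - x"] by simp

lemma ms_bounded: assumes "\<delta> > 0" obtains B where "B > 0" "\<And>y. ms \<delta> y \<le> B"
proof -
  obtain B where B: "B > 0" "\<And>y. k y \<le> B" by (rule k_bounded) blast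
  show ?thesis
    using B assms by (intro that[of "B / \<delta> ^ CARD('d)"]) (auto simp: mollifier_scaled_def divide_right_mono)
qed

lemma ms_change_of_variables:
  fixes \<phi> :: "real^'d \<Rightarrow> real"
  assumes \<delta>: "\<delta> > 0" and \<phi>: "\<phi> \<in> borel_measurable borel"
  shows "(\<integral>y. \<phi> y * ms \<delta> (y - x) \<partial>lborel) = (\<integral>z. \<phi> (x + \<delta> *\<^sub>R z) * k z \<partial>lborel)"
    "integrable lborel (\<lambda>y. \<phi> y * ms \<delta> (y - x)) \<longleftrightarrow> integrable lborel (\<lambda>z. \<phi> (x + \<delta> *\<^sub>R z) * k z)"
proof -
  have l: "lborel = density (distr lborel borel (\<lambda>z. x + \<delta> *\<^sub>R z)) (\<lambda>_. ennreal (\<delta> ^ CARD('d)))"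
    using lborel_affine[of \<delta> x] \<delta> by simp
  let ?F = "\<lambda>y. \<phi> y * ms \<delta> (y - x)"
  let ?d = "distr lborel borel (\<lambda>z. x + \<delta> *\<^sub>R z)"
  have F: "?F \<in> borel_measurable borel" using \<phi> by measurable
  have eq: "(\<lambda>z. \<delta> ^ CARD('d) *\<^sub>R ?F (x + \<delta> *\<^sub>R z)) = (\<lambda>z. \<phi> (x + \<delta> *\<^sub>R z) * k z)"
    using \<delta> by (simp add: mollifier_scaled_def)
  have "(\<integral>y. ?F y \<partial>lborel) = (\<integral>y. \<delta> ^ CARD('d) *\<^sub>R ?F y \<partial>?d)"
    by (subst l, rule integral_density) (use F \<delta> in auto)
  also have "\<dots> = (\<integral>z. \<delta> ^ CARD('d) *\<^sub>R ?F (x + \<delta> *\<^sub>R z) \<partial>lborel)"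
    by (rule integral_distr) (use F in auto)
  finally show "(\<integral>y. ?F y \<partial>lborel) = (\<integral>z. \<phi> (x + \<delta> *\<^sub>R z) * k z \<partial>lborel)" unfolding eq .
  have "integrable lborel ?F \<longleftrightarrow> integrable ?d (\<lambda>y. \<delta> ^ CARD('d) *\<^sub>R ?F y)"
    by (subst l, rule integrable_density) (use F \<delta> in auto)
  also have "\<dots> \<longleftrightarrow> integrable lborel (\<lambda>z. \<delta> ^ CARD('d) *\<^sub>R ?F (x + \<delta> *\<^sub>R z))"
    by (rule integrable_distr_eq) (use F in auto)
  finally show "integrable lborel ?F \<longleftrightarrow> integrable lborel (\<lambda>z. \<phi> (x + \<delta> *\<^sub>R z) * k z)" unfolding eq .
qed

text \<open>For \<open>\<delta> > 0\<close> the convolution of \<open>\<phi>\<close> with the even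
  kernel at scale \<open>\<delta>\<close>, in rescaled variables. This form is meaningful at
  \<open>\<delta> = 0\<close>, where it returns \<open>\<phi>\<close>, so vanishing mollification
  becomes continuity in \<open>\<delta>\<close>.\<close>

definition smear :: "real \<Rightarrow> (real^'d \<Rightarrow> real) \<Rightarrow> real^'d \<Rightarrow> real" where
  "smear \<delta> \<phi> x = (\<integral>z. \<phi> (x + \<delta> *\<^sub>R z) * k z \<partial>lborel)"

lemma smear_integrable:
  assumes \<phi>: "\<phi> \<in> borel_measurable borel" "\<And>y. \<bar>\<phi> y\<bar> \<le> b"
  shows "integrable lborel (\<lambda>z. \<phi> (x + \<delta> *\<^sub>R z) * k z)"
proof (rule Bochner_Integration.integrable_bound[OF integrable_mult_right[OF k_integrable, of b]])
  have "b \<ge> 0" using \<phi>(2)[of undefined] by linarith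
  then show "AE z in lborel. norm (\<phi> (x + \<delta> *\<^sub>R z) * k z) \<le> norm (b * k z)"
    using \<phi>(2) k_nonneg by (auto simp: abs_mult intro!: mult_right_mono)
qed (use \<phi>(1) in measurable)

lemma smear_bound:
  assumes \<phi>: "\<phi> \<in> borel_measurable borel" "\<And>y. \<bar>\<phi> y\<bar> \<le> b"
  shows "\<bar>smear \<delta> \<phi> x\<bar> \<le> b"
proof -
  have "\<bar>smear \<delta> \<phi> x\<bar> \<le> (\<integral>z. \<bar>\<phi> (x + \<delta> *\<^sub>R z) * k z\<bar> \<partial>lborel)"
    unfolding smear_def by (rule integral_abs_bound)
  also have "\<dots> \<le> (\<integral>z. b * k z \<partial>lborel)"
  proof (rule integral_mono)
    show "integrable lborel (\<lambda>z. \<bar>\<phi> (x + \<delta> *\<^sub>R z) * k z\<bar>)"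
      using smear_integrable[OF \<phi>] by (rule integrable_abs)
    show "integrable lborel (\<lambda>z. b * k z)" using k_integrable by simp
    show "\<bar>\<phi> (x + \<delta> *\<^sub>R z) * k z\<bar> \<le> b * k z" for z
      using \<phi>(2) k_nonneg by (auto simp: abs_mult intro!: mult_right_mono)
  qed
  also have "\<dots> = b" by (simp add: k_integral)
  finally show ?thesis .
qed

lemma smear_tendsto:
  assumes \<phi>: "continuous_on UNIV \<phi>" "\<And>y. \<bar>\<phi> y\<bar> \<le> b" and x: "x \<longlonglongrightarrow> x0" and d: "d \<longlonglongrightarrow> d0"
  shows "(\<lambda>n. smear (d n) \<phi> (x n)) \<longlonglongrightarrow> smear d0 \<phi> x0"
  unfolding smear_def
proof (rule integral_dominated_convergence[where w = "\<lambda>z. b * k z"])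
  have [measurable]: "\<phi> \<in> borel_measurable borel" by (rule borel_measurable_continuous_onI[OF \<phi>(1)])
  show "(\<lambda>z. \<phi> (x0 + d0 *\<^sub>R z) * k z) \<in> borel_measurable lborel" by measurable
  show "(\<lambda>z. \<phi> (x n + d n *\<^sub>R z) * k z) \<in> borel_measurable lborel" for n by measurable
  show "AE z in lborel. (\<lambda>n. \<phi> (x n + d n *\<^sub>R z) * k z) \<longlonglongrightarrow> \<phi> (x0 + d0 *\<^sub>R z) * k z"
  proof (intro AE_I2 tendsto_mult tendsto_const)
    fix z
    have "(\<lambda>n. x n + d n *\<^sub>R z) \<longlonglongrightarrow> x0 + d0 *\<^sub>R z" by (intro tendsto_intros x d)
    then show "(\<lambda>n. \<phi> (x n + d n *\<^sub>R z)) \<longlonglongrightarrow> \<phi> (x0 + d0 *\<^sub>R z)"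
      by (rule continuous_on_tendsto_compose[OF \<phi>(1)]) auto
  qed
  show "integrable lborel (\<lambda>z. b * k z)" using k_integrable by simp
  show "AE z in lborel. norm (\<phi> (x n + d n *\<^sub>R z) * k z) \<le> b * k z" for n
    using \<phi>(2) k_nonneg by (auto simp: abs_mult intro!: mult_right_mono)
qed

lemma smear_0: "smear 0 \<phi> x = \<phi> x"
  by (simp add: smear_def k_integral)

lemma smear_measurable:
  assumes [measurable]: "\<phi> \<in> borel_measurable borel"
  shows "smear \<delta> \<phi> \<in> borel_measurable borel"
  unfolding smear_def[abs_def] by measurable

lemma smear_eq:
  assumes "\<delta> > 0" "\<phi> \<in> borel_measurable borel"
  shows "smear \<delta> \<phi> x = (\<integral>y. \<phi> y * ms \<delta> (y - x) \<partial>lborel)"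
  unfolding smear_def ms_change_of_variables(1)[OF assms] ..

lemma ms_integral: "\<delta> > 0 \<Longrightarrow> (\<integral>y. ms \<delta> (y - x) \<partial>lborel) = 1"
  and ms_integrable: "\<delta> > 0 \<Longrightarrow> integrable lborel (\<lambda>y. ms \<delta> (y - x))"
  using ms_change_of_variables[of \<delta> "\<lambda>_. 1" x] k_integral k_integrable by simp_all

lemma ms_mult_integrable:
  assumes "\<delta> > 0" "\<phi> \<in> borel_measurable borel" "\<And>y. \<bar>\<phi> y\<bar> \<le> b"
  shows "integrable lborel (\<lambda>y. \<phi> y * ms \<delta> (y - x))"
  using ms_change_of_variables(2)[OF assms(1,2)] smear_integrable[OF assms(2,3)] by simp

section \<open>Mollification of one probability measure\<close>

context
  fixes \<nu> :: "(real^'d) measure" and \<delta> :: real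
  assumes \<nu>: "prob_space \<nu>" "sets \<nu> = sets borel" and \<delta>: "\<delta> > 0"
begin

lemma ms_integrable_prob: "integrable \<nu> (\<lambda>x. ms \<delta> (y - x))"
proof -
  interpret prob_space \<nu> by (rule \<nu>(1))
  obtain B where B: "B > 0" "\<And>y. ms \<delta> y \<le> B" by (rule ms_bounded[OF \<delta>]) blast
  have "borel_measurable \<nu> = borel_measurable borel" by (rule measurable_cong_sets[OF \<nu>(2) refl])
  then show ?thesis
    using B ms_nonneg[OF \<delta>] by (intro integrable_const_bound[where B = B]) auto
qed

lemma mollify_nonneg: "0 \<le> mollify k \<delta> \<nu> y"
  unfolding mollify_def using ms_nonneg[OF \<delta>] by (intro integral_nonneg_AE) auto

lemma mollify_bounded: obtains B where "B > 0" "\<And>y. \<bar>mollify k \<delta> \<nu> y\<bar> \<le> B"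
proof -
  interpret prob_space \<nu> by (rule \<nu>(1))
  obtain B where B: "B > 0" "\<And>y. ms \<delta> y \<le> B" by (rule ms_bounded[OF \<delta>]) blast
  have "mollify k \<delta> \<nu> y \<le> B" for y
  proof -
    have "mollify k \<delta> \<nu> y \<le> (\<integral>x. B \<partial>\<nu>)"
      unfolding mollify_def using B by (intro integral_mono ms_integrable_prob) auto
    then show ?thesis by (simp add: prob_space)
  qed
  with mollify_nonneg show ?thesis using B by (intro that[of B]) auto
qed

lemma mollify_continuous: "continuous_on UNIV (mollify k \<delta> \<nu>)"
  unfolding continuous_on_sequentially
proof (intro allI ballI impI, elim conjE)
  fix y :: "nat \<Rightarrow> real^'d" and y0 assume y: "y \<longlonglongrightarrow> y0"
  interpret prob_space \<nu> by (rule \<nu>(1))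
  have bm: "borel_measurable \<nu> = borel_measurable borel" by (rule measurable_cong_sets[OF \<nu>(2) refl])
  obtain B where B: "B > 0" "\<And>y. ms \<delta> y \<le> B" by (rule ms_bounded[OF \<delta>]) blast
  show "(mollify k \<delta> \<nu> \<circ> y) \<longlonglongrightarrow> mollify k \<delta> \<nu> y0"
    unfolding mollify_def o_def
  proof (rule integral_dominated_convergence[where w = "\<lambda>_. B"])
    show "AE x in \<nu>. (\<lambda>n. ms \<delta> (y n - x)) \<longlonglongrightarrow> ms \<delta> (y0 - x)"
      using continuous_on_tendsto_compose[OF ms_continuous(1)[of UNIV] y] by auto
    show "AE x in \<nu>. norm (ms \<delta> (y n - x)) \<le> B" for n using B ms_nonneg[OF \<delta>] by auto
  qed (auto simp: bm)
qed

lemma mollify_measurable [measurable]: "mollify k \<delta> \<nu> \<in> borel_measurable borel"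
  by (rule borel_measurable_continuous_onI[OF mollify_continuous])

text \<open>Fubini's theorem: mollifying the measure is adjoint to smearing the test
  function.\<close>

lemma integral_mollify:
  assumes \<phi>: "\<phi> \<in> borel_measurable borel" "\<And>y. \<bar>\<phi> y\<bar> \<le> b"
  shows "integrable lborel (\<lambda>y. \<phi> y * mollify k \<delta> \<nu> y)"
    "(\<integral>y. \<phi> y * mollify k \<delta> \<nu> y \<partial>lborel) = (\<integral>x. smear \<delta> \<phi> x \<partial>\<nu>)"
proof -
  interpret \<nu>: prob_space \<nu> by (rule \<nu>(1))
  interpret P: pair_sigma_finite \<nu> "lborel :: (real^'d) measure"
    by (intro pair_sigma_finite.intro \<nu>.sigma_finite_measure sigma_finite_lborel)
  have sets: "sets (\<nu> \<Otimes>\<^sub>M lborel) = sets (borel \<Otimes>\<^sub>M (borel :: (real^'d) measure))"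
    using \<nu>(2) by (intro sets_pair_measure_cong) auto
  have bm: "borel_measurable \<nu> = borel_measurable borel" by (rule measurable_cong_sets[OF \<nu>(2) refl])
  have "(\<lambda>(x, y). \<phi> y * ms \<delta> (y - x)) \<in> borel_measurable (borel \<Otimes>\<^sub>M (borel :: (real^'d) measure))"
    using \<phi>(1) by measurable
  then have m: "(\<lambda>(x, y). \<phi> y * ms \<delta> (y - x)) \<in> borel_measurable (\<nu> \<Otimes>\<^sub>M lborel)"
    using measurable_cong_sets[OF sets refl] by blast
  have abs_eq: "(\<integral>y. norm (\<phi> y * ms \<delta> (y - x)) \<partial>lborel) = smear \<delta> (\<lambda>y. \<bar>\<phi> y\<bar>) x" for x
    using \<phi>(1) ms_nonneg[OF \<delta>] by (subst smear_eq[OF \<delta>]) (auto simp: abs_mult)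
  have int: "integrable (\<nu> \<Otimes>\<^sub>M lborel) (\<lambda>(x, y). \<phi> y * ms \<delta> (y - x))"
  proof (rule P.Fubini_integrable[OF m])
    show "integrable \<nu> (\<lambda>x. \<integral>y. norm (case (x, y) of (x, y) \<Rightarrow> \<phi> y * ms \<delta> (y - x)) \<partial>lborel)"
      unfolding prod.case abs_eq
      using smear_bound[of "\<lambda>y. \<bar>\<phi> y\<bar>" b] \<phi> smear_measurable[of "\<lambda>y. \<bar>\<phi> y\<bar>"]
      by (intro \<nu>.integrable_const_bound[where B = b]) (auto simp: bm)
    show "AE x in \<nu>. integrable lborel (\<lambda>y. case (x, y) of (x, y) \<Rightarrow> \<phi> y * ms \<delta> (y - x))"
      using ms_mult_integrable[OF \<delta> \<phi>] by simp
  qed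
  show "integrable lborel (\<lambda>y. \<phi> y * mollify k \<delta> \<nu> y)"
    using P.integrable_snd[OF int] by (simp add: mollify_def)
  show "(\<integral>y. \<phi> y * mollify k \<delta> \<nu> y \<partial>lborel) = (\<integral>x. smear \<delta> \<phi> x \<partial>\<nu>)"
    using P.Fubini_integral[OF int] by (simp add: mollify_def smear_eq[OF \<delta> \<phi>(1)])
qed

lemma mollify_square_integrable: "integrable lborel (\<lambda>y. (mollify k \<delta> \<nu> y)\<^sup>2)"
proof -
  obtain B where "\<And>y. \<bar>mollify k \<delta> \<nu> y\<bar> \<le> B" by (rule mollify_bounded) blast
  from integral_mollify(1)[OF mollify_measurable this] show ?thesis by (simp add: power2_eq_square)
qed

lemma final_eps_delta_eq:
  assumes "\<epsilon> > 0"
  shows "final_eps_delta k \<epsilon> \<delta> \<nu> = ennreal (1 / \<epsilon> * (\<integral>y. (mollify k \<delta> \<nu> y)\<^sup>2 \<partial>lborel))"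
proof -
  have "(\<integral>\<^sup>+y. ennreal (\<bar>mollify k \<delta> \<nu> y\<bar>\<^sup>2) \<partial>lborel) = ennreal (\<integral>y. (mollify k \<delta> \<nu> y)\<^sup>2 \<partial>lborel)"
    using nn_integral_eq_integral[OF mollify_square_integrable] by simp
  then show ?thesis using assms by (simp add: final_eps_delta_def ennreal_mult[symmetric])
qed

text \<open>Testing with \<open>\<phi>\<close> turns the quadratic functional into affine ones, which pass to the limit.\<close>

lemma quadratic_duality:
  assumes \<phi>: "\<phi> \<in> borel_measurable borel" "\<And>y. \<bar>\<phi> y\<bar> \<le> b" "integrable lborel (\<lambda>y. (\<phi> y)\<^sup>2)"
  shows "2 * (\<integral>x. smear \<delta> \<phi> x \<partial>\<nu>) - (\<integral>y. (\<phi> y)\<^sup>2 \<partial>lborel) \<le> (\<integral>y. (mollify k \<delta> \<nu> y)\<^sup>2 \<partial>lborel)"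
proof -
  note i = integral_mollify[OF \<phi>(1,2)]
  have "0 \<le> (\<integral>y. (\<phi> y - mollify k \<delta> \<nu> y)\<^sup>2 \<partial>lborel)" by simp
  also have "\<dots> = (\<integral>y. (\<phi> y)\<^sup>2 - 2 * (\<phi> y * mollify k \<delta> \<nu> y) + (mollify k \<delta> \<nu> y)\<^sup>2 \<partial>lborel)"
    by (simp add: power2_diff algebra_simps)
  also have "\<dots> = (\<integral>y. (\<phi> y)\<^sup>2 \<partial>lborel) - 2 * (\<integral>x. smear \<delta> \<phi> x \<partial>\<nu>) + (\<integral>y. (mollify k \<delta> \<nu> y)\<^sup>2 \<partial>lborel)"
    using i \<phi>(3) mollify_square_integrable by simp
  finally show ?thesis by simp
qed

text \<open>Jensen's inequality for the kernel, which is a probability density in \<open>x\<close>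
  for fixed \<open>y\<close> by evenness, followed by integration in \<open>y\<close>, where it is
  again a probability density. It lets a competitor for the mollified problem be valued by the
  unmollified penalty.\<close>

lemma final_eps_delta_le_final_eps:
  assumes \<epsilon>: "\<epsilon> > 0"
  shows "final_eps_delta k \<epsilon> \<delta> \<nu> \<le> final_eps \<epsilon> \<nu>"
proof (cases "absolutely_continuous lborel \<nu>")
  case ac: True
  obtain D where D: "D \<in> borel_measurable borel" "\<And>x. 0 \<le> D x" "\<nu> = density lborel (\<lambda>x. ennreal (D x))"
    and D2: "(\<integral>\<^sup>+x. (RN_deriv lborel \<nu> x)\<^sup>2 \<partial>lborel) = (\<integral>\<^sup>+x. ennreal ((D x)\<^sup>2) \<partial>lborel)"
    by (rule prob_density_facts[OF \<nu> ac]) blast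
  note [measurable] = D(1)
  obtain B where B: "B > 0" "\<And>y. ms \<delta> y \<le> B" by (rule ms_bounded[OF \<delta>]) blast
  have "(\<integral>\<^sup>+y. ennreal ((mollify k \<delta> \<nu> y)\<^sup>2) \<partial>lborel) \<le> (\<integral>\<^sup>+x. ennreal ((D x)\<^sup>2) \<partial>lborel)"
  proof (cases "(\<integral>\<^sup>+x. ennreal ((D x)\<^sup>2) \<partial>lborel) = \<infinity>")
    case False
    have D2_int: "integrable lborel (\<lambda>x. (D x)\<^sup>2)"
      using False by (intro integrableI_bounded) (auto simp: less_top)
    have jensen: "ennreal ((mollify k \<delta> \<nu> y)\<^sup>2) \<le> (\<integral>\<^sup>+x. ennreal (ms \<delta> (y - x) * (D x)\<^sup>2) \<partial>lborel)" for y
    proof -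
      define g where "g = mollify k \<delta> \<nu> y"
      have g_eq: "g = (\<integral>x. D x * ms \<delta> (y - x) \<partial>lborel)"
      proof -
        have "g = (\<integral>x. ms \<delta> (y - x) \<partial>density lborel (\<lambda>x. ennreal (D x)))"
          unfolding g_def mollify_def by (rule arg_cong[OF D(3)])
        then show ?thesis using D by (simp add: integral_density)
      qed
      have i1: "integrable lborel (\<lambda>x. D x * ms \<delta> (y - x))"
      proof -
        have "integrable (density lborel (\<lambda>x. ennreal (D x))) (\<lambda>x. ms \<delta> (y - x))"
          using ms_integrable_prob D(3) by simp
        then show ?thesis using D by (subst (asm) integrable_density) auto
      qed
      have i2: "integrable lborel (\<lambda>x. ms \<delta> (y - x) * (D x)\<^sup>2)"
      proof (rule Bochner_Integration.integrable_bound[OF integrable_mult_right[OF D2_int, of B]])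
        show "AE x in lborel. norm (ms \<delta> (y - x) * (D x)\<^sup>2) \<le> norm (B * (D x)\<^sup>2)"
          using B ms_nonneg[OF \<delta>] by (auto simp: abs_mult intro!: mult_right_mono)
      qed measurable
      have i3: "integrable lborel (\<lambda>x. ms \<delta> (y - x))" "(\<integral>x. ms \<delta> (y - x) \<partial>lborel) = 1"
        using ms_integrable[OF \<delta>, of y] ms_integral[OF \<delta>, of y] by (simp_all add: ms_commute[of \<delta> y])
      \<comment> \<open>Jensen's inequality as nonnegativity of the kernel-weighted variance of
        \<open>D\<close> around its mean \<open>g\<close>.\<close>
      have "0 \<le> (\<integral>x. ms \<delta> (y - x) * (D x - g)\<^sup>2 \<partial>lborel)"
        using ms_nonneg[OF \<delta>] by (intro integral_nonneg_AE) auto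
      also have "\<dots> = (\<integral>x. ms \<delta> (y - x) * (D x)\<^sup>2 - 2 * g * (D x * ms \<delta> (y - x)) + g\<^sup>2 * ms \<delta> (y - x) \<partial>lborel)"
        by (simp add: power2_diff algebra_simps)
      also have "\<dots> = (\<integral>x. ms \<delta> (y - x) * (D x)\<^sup>2 \<partial>lborel) - 2 * g * g + g\<^sup>2"
        using i1 i2 i3 by (simp add: g_eq[symmetric])
      finally have "g\<^sup>2 \<le> (\<integral>x. ms \<delta> (y - x) * (D x)\<^sup>2 \<partial>lborel)" by (simp add: power2_eq_square)
      moreover have "(\<integral>\<^sup>+x. ennreal (ms \<delta> (y - x) * (D x)\<^sup>2) \<partial>lborel) = ennreal (\<integral>x. ms \<delta> (y - x) * (D x)\<^sup>2 \<partial>lborel)"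
        using ms_nonneg[OF \<delta>] by (intro nn_integral_eq_integral i2) auto
      ultimately show ?thesis by (simp add: g_def ennreal_leI)
    qed
    have "(\<integral>\<^sup>+y. ennreal ((mollify k \<delta> \<nu> y)\<^sup>2) \<partial>lborel) \<le> (\<integral>\<^sup>+y. \<integral>\<^sup>+x. ennreal (ms \<delta> (y - x) * (D x)\<^sup>2) \<partial>lborel \<partial>lborel)"
      by (intro nn_integral_mono jensen)
    also have "\<dots> = (\<integral>\<^sup>+x. \<integral>\<^sup>+y. ennreal (ms \<delta> (y - x) * (D x)\<^sup>2) \<partial>lborel \<partial>lborel)"
      by (rule lborel_pair.Fubini'[symmetric]) measurable
    also have "\<dots> = (\<integral>\<^sup>+x. ennreal ((D x)\<^sup>2) \<partial>lborel)"
    proof (rule nn_integral_cong)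
      fix x
      have "(\<integral>\<^sup>+y. ennreal (ms \<delta> (y - x) * (D x)\<^sup>2) \<partial>lborel) = ennreal (\<integral>y. ms \<delta> (y - x) * (D x)\<^sup>2 \<partial>lborel)"
        using ms_nonneg[OF \<delta>] ms_integrable[OF \<delta>] by (intro nn_integral_eq_integral) auto
      also have "\<dots> = ennreal ((D x)\<^sup>2)" using ms_integral[OF \<delta>] by simp
      finally show "(\<integral>\<^sup>+y. ennreal (ms \<delta> (y - x) * (D x)\<^sup>2) \<partial>lborel) = ennreal ((D x)\<^sup>2)" .
    qed
    finally show ?thesis .
  qed simp
  then show ?thesis
    using ac by (simp add: final_eps_delta_def final_eps_def D2 mult_left_mono)
qed (simp add: final_eps_def)

end

end

section \<open>Vanishing penalization parameter\<close>

text \<open>The data through which the limit theorems see the control system: a space parametrized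
  by a compact set of reals, a bounded lower semicontinuous cost \<open>e\<close>, and a continuous
  end-point map \<open>E\<close>.\<close>

locale transport_problem =
  fixes X :: "'a topology" and e :: "'a \<Rightarrow> real" and E :: "'a \<Rightarrow> real^'d"
    and C :: "real set" and g :: "real \<Rightarrow> 'a" and K :: real
  assumes C: "compact C" and g: "continuous_map (top_of_set C) X g" "g ` C = topspace X"
    and Hausdorff: "Hausdorff_space X"
    and E_cont: "continuous_map X euclidean E"
    and e_meas: "e \<in> borel_measurable (borel_of X)"
    and e_nonneg: "\<And>z. 0 \<le> e z" and e_bound: "\<And>z. z \<in> topspace X \<Longrightarrow> e z \<le> K"
    and e_lsc: "\<And>z l. \<lbrakk>\<And>n. z n \<in> topspace X; limitin X z l sequentially\<rbrakk> \<Longrightarrow>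
       ennreal (e l) \<le> liminf (\<lambda>n. ennreal (e (z n)))"
begin

definition reach :: "(real^'d) set" where
  "reach = E ` topspace X"

definition cost :: "'a measure \<Rightarrow> ennreal" where
  "cost P = (\<integral>\<^sup>+z. ennreal (e z) \<partial>P)"

definition law :: "'a measure \<Rightarrow> (real^'d) measure" where
  "law P = distr P borel E"

lemma E_meas: "E \<in> borel_measurable (borel_of X)"
  by (rule continuous_map_euclidean_measurable[OF E_cont])

lemma compact_reach: "compact reach"
proof -
  have "compact_space X"
  proof -
    have "compactin X (g ` C)" using C by (intro image_compactin[OF _ g(1)]) (simp add: compactin_subtopology)
    then show ?thesis by (simp add: g(2) compact_space_def)
  qed
  then have "compactin euclidean reach"
    unfolding reach_def by (intro image_compactin[OF _ E_cont]) (simp add: compact_space_def)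
  then show ?thesis by simp
qed

lemma measurable_P:
  assumes "P \<in> prob_measures X" "f \<in> measurable (borel_of X) N" shows "f \<in> measurable P N"
  using assms(2) measurable_cong_sets[OF prob_measuresD(2)[OF assms(1)] refl] by blast

lemma law_prob:
  assumes P: "P \<in> prob_measures X"
  shows "prob_space (law P)" "sets (law P) = sets borel" "AE y in law P. y \<in> reach"
proof -
  note Em = measurable_P[OF P E_meas]
  show "prob_space (law P)" unfolding law_def by (rule prob_space.prob_space_distr[OF prob_measuresD(1)[OF P] Em])
  show "sets (law P) = sets borel" by (simp add: law_def)
  have "{y \<in> space borel. y \<in> reach} \<in> sets borel" using compact_imp_closed[OF compact_reach] by simp
  then show "AE y in law P. y \<in> reach"
    unfolding law_def using Em prob_measuresD(3)[OF P] by (subst AE_distr_iff) (auto simp: reach_def)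
qed

lemma integral_law:
  fixes F :: "real^'d \<Rightarrow> real"
  assumes P: "P \<in> prob_measures X" and F: "F \<in> borel_measurable borel"
  shows "(\<integral>y. F y \<partial>law P) = (\<integral>z. F (E z) \<partial>P)"
  unfolding law_def by (rule integral_distr[OF measurable_P[OF P E_meas] F])

definition cost_real :: "'a measure \<Rightarrow> real" where
  "cost_real P = (\<integral>z. e z \<partial>P)"

lemma e_integrable: "P \<in> prob_measures X \<Longrightarrow> integrable P e"
  using prob_measuresD(1,3)[of P X] e_nonneg e_bound measurable_P[OF _ e_meas]
  by (intro finite_measure.integrable_const_bound[where B = K]) (auto simp: prob_space.finite_measure intro!: AE_I2)

lemma cost_eq: "P \<in> prob_measures X \<Longrightarrow> cost P = ennreal (cost_real P)"
  unfolding cost_def cost_real_def using e_nonneg by (intro nn_integral_eq_integral e_integrable) auto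

lemma cost_real_nonneg: "0 \<le> cost_real P"
  unfolding cost_real_def using e_nonneg by (intro integral_nonneg_AE) auto

lemma cost_real_le: assumes P: "P \<in> prob_measures X" shows "cost_real P \<le> K"
proof -
  interpret prob_space P by (rule prob_measuresD(1)[OF P])
  have "cost_real P \<le> (\<integral>z. K \<partial>P)"
    unfolding cost_real_def using e_bound prob_measuresD(3)[OF P] by (intro integral_mono e_integrable P) auto
  then show ?thesis by (simp add: prob_space)
qed

text \<open>Convergence of the end-point laws tested with functions that may vary with
  \<open>n\<close>, provided they converge along convergent points. Smeared test functions with
  varying \<open>\<delta>\<close> are of this kind.\<close>

definition law_conv :: "(nat \<Rightarrow> 'a measure) \<Rightarrow> 'a measure \<Rightarrow> bool" where
  "law_conv P P' \<longleftrightarrow> (\<forall>(F :: nat \<Rightarrow> real^'d \<Rightarrow> real) F0 b. (\<forall>n. F n \<in> borel_measurable borel) \<longrightarrow>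
     F0 \<in> borel_measurable borel \<longrightarrow> (\<forall>n y. \<bar>F n y\<bar> \<le> b) \<longrightarrow>
     (\<forall>y y0. y \<longlonglongrightarrow> y0 \<longrightarrow> (\<lambda>n. F n (y n)) \<longlonglongrightarrow> F0 y0) \<longrightarrow>
     (\<lambda>n. \<integral>y. F n y \<partial>law (P n)) \<longlonglongrightarrow> (\<integral>y. F0 y \<partial>law P'))"

lemma law_convD:
  fixes F :: "nat \<Rightarrow> real^'d \<Rightarrow> real"
  assumes "law_conv P P'" "\<And>n. F n \<in> borel_measurable borel" "F0 \<in> borel_measurable borel" "\<And>n y. \<bar>F n y\<bar> \<le> b"
    "\<And>y y0. y \<longlonglongrightarrow> y0 \<Longrightarrow> (\<lambda>n. F n (y n)) \<longlonglongrightarrow> F0 y0"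
  shows "(\<lambda>n. \<integral>y. F n y \<partial>law (P n)) \<longlonglongrightarrow> (\<integral>y. F0 y \<partial>law P')"
  using assms unfolding law_conv_def by blast

text \<open>On a common probability space with almost sure convergence, semicontinuity of the cost
  is Fatou's lemma and convergence of the laws is dominated convergence.\<close>

lemma subsequence:
  assumes P: "\<And>n::nat. P n \<in> prob_measures X"
  obtains r P' where "strict_mono (r :: nat \<Rightarrow> nat)" "P' \<in> prob_measures X" "narrow_conv X (P \<circ> r) P'"
    "cost P' \<le> liminf (\<lambda>n. cost (P (r n)))"
    "law_conv (P \<circ> r) P'"
proof -
  obtain r and M :: "real measure" and Z Z0 where r: "strict_mono r" and M: "prob_space M"
    and Z: "\<And>n. Z n \<in> measurable M (borel_of X)" and Z0: "Z0 \<in> measurable M (borel_of X)"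
    and dist: "\<And>n. distr M (borel_of X) (Z n) = P (r n)"
    and lim: "AE \<omega> in M. limitin X (\<lambda>n. Z n \<omega>) (Z0 \<omega>) sequentially"
    by (rule skorohod_subsequence[OF C g Hausdorff, of P]) (rule P, rule that)
  interpret M: prob_space M by (rule M)
  define P' where "P' = distr M (borel_of X) Z0"
  have P': "P' \<in> prob_measures X" unfolding P'_def by (rule prob_measures_distr[OF M Z0])
  have ZX: "Z n \<omega> \<in> topspace X" if "\<omega> \<in> space M" for n \<omega>
    using measurable_space[OF Z that] by (simp add: space_borel_of)
  have nc: "narrow_conv X (P \<circ> r) P'"
    unfolding P'_def by (rule narrow_conv_of_AE_limit[OF M Z Z0 _ lim]) (simp add: dist)
  have lsc: "cost P' \<le> liminf (\<lambda>n. cost (P (r n)))"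
  proof -
    have em: "(\<lambda>z. ennreal (e z)) \<in> borel_measurable (borel_of X)" using e_meas by simp
    have c: "(\<integral>\<^sup>+z. ennreal (e z) \<partial>distr M (borel_of X) W) = (\<integral>\<^sup>+\<omega>. ennreal (e (W \<omega>)) \<partial>M)"
      if "W \<in> measurable M (borel_of X)" for W
      by (rule nn_integral_distr[OF that]) (simp add: em)
    have "cost P' = (\<integral>\<^sup>+\<omega>. ennreal (e (Z0 \<omega>)) \<partial>M)" unfolding cost_def P'_def by (rule c[OF Z0])
    also have "\<dots> \<le> (\<integral>\<^sup>+\<omega>. liminf (\<lambda>n. ennreal (e (Z n \<omega>))) \<partial>M)"
    proof (rule nn_integral_mono_AE)
      have "AE \<omega> in M. \<omega> \<in> space M" by (rule AE_space)
      with lim show "AE \<omega> in M. ennreal (e (Z0 \<omega>)) \<le> liminf (\<lambda>n. ennreal (e (Z n \<omega>)))"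
        by eventually_elim (rule e_lsc, rule ZX)
    qed
    also have "\<dots> \<le> liminf (\<lambda>n. \<integral>\<^sup>+\<omega>. ennreal (e (Z n \<omega>)) \<partial>M)"
      by (intro nn_integral_liminf measurable_compose[OF Z em])
    also have "\<dots> = liminf (\<lambda>n. cost (P (r n)))"
      unfolding cost_def dist[symmetric] using c[OF Z] by simp
    finally show ?thesis .
  qed
  have conv: "(\<lambda>n. \<integral>y. F n y \<partial>law (P (r n))) \<longlonglongrightarrow> (\<integral>y. F0 y \<partial>law P')"
    if F: "\<And>n. F n \<in> borel_measurable borel" "F0 \<in> borel_measurable borel" and b: "\<And>n y. \<bar>F n y\<bar> \<le> b"
      and conv: "\<And>y y0. y \<longlonglongrightarrow> y0 \<Longrightarrow> (\<lambda>n. F n (y n)) \<longlonglongrightarrow> F0 y0"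
    for F :: "nat \<Rightarrow> real^'d \<Rightarrow> real" and F0 b
  proof -
    have FE: "(\<lambda>z. G (E z)) \<in> borel_measurable (borel_of X)" if "G \<in> borel_measurable borel" for G :: "real^'d \<Rightarrow> real"
      by (rule measurable_compose[OF E_meas that])
    have i: "(\<integral>z. G (E z) \<partial>distr M (borel_of X) W) = (\<integral>\<omega>. G (E (W \<omega>)) \<partial>M)"
      if "W \<in> measurable M (borel_of X)" "G \<in> borel_measurable borel" for W and G :: "real^'d \<Rightarrow> real"
      by (rule integral_distr[OF that(1) FE[OF that(2)]])
    have "(\<lambda>n. \<integral>\<omega>. F n (E (Z n \<omega>)) \<partial>M) \<longlonglongrightarrow> (\<integral>\<omega>. F0 (E (Z0 \<omega>)) \<partial>M)"
    proof (rule integral_dominated_convergence[where w = "\<lambda>_. b"])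
      show "(\<lambda>\<omega>. F0 (E (Z0 \<omega>))) \<in> borel_measurable M" by (rule measurable_compose[OF Z0 FE[OF F(2)]])
      show "(\<lambda>\<omega>. F n (E (Z n \<omega>))) \<in> borel_measurable M" for n by (rule measurable_compose[OF Z FE[OF F(1)]])
      show "AE \<omega> in M. (\<lambda>n. F n (E (Z n \<omega>))) \<longlonglongrightarrow> F0 (E (Z0 \<omega>))"
        using lim
      proof eventually_elim
        case (elim \<omega>)
        from continuous_map_limit[OF E_cont elim] show ?case by (intro conv) (simp add: o_def)
      qed
    qed (use b in auto)
    then show ?thesis
      using i[OF Z0 F(2)] i[OF Z F(1)]
      unfolding integral_law[OF P F(1)] integral_law[OF P' F(2)] dist unfolding P'_def by simp
  qed
  have "law_conv (P \<circ> r) P'" unfolding law_conv_def o_def by (intro allI impI) (rule conv; blast)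
  then show ?thesis by (rule that[OF r P' nc lsc])
qed

lemma cost_real_limit_le:
  assumes P: "\<And>n::nat. P n \<in> prob_measures X" "P' \<in> prob_measures X" and lsc: "cost P' \<le> liminf (\<lambda>n. cost (P n))"
    and le: "\<And>n. cost_real (P n) \<le> v n" and v: "v \<longlonglongrightarrow> v0"
  shows "cost_real P' \<le> v0"
proof -
  have "0 \<le> v n" for n using cost_real_nonneg[of "P n"] le[of n] by linarith
  then have v0: "0 \<le> v0" by (intro LIMSEQ_le_const[OF v]) auto
  have "cost P' \<le> liminf (\<lambda>n. ennreal (v n))"
    using lsc by (rule order.trans) (intro Liminf_mono always_eventually allI, simp add: cost_eq P ennreal_leI le)
  also have "\<dots> = ennreal v0"
    by (rule lim_imp_Liminf[OF _ tendsto_ennrealI[OF v]]) simp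
  finally show ?thesis using v0 by (simp add: cost_eq P)
qed

lemma arg_min_le:
  assumes "is_arg_min F (\<lambda>Q. Q \<in> prob_measures X) P" "Q \<in> prob_measures X"
  shows "P \<in> prob_measures X" "(F P :: 'c::linorder) \<le> F Q"
  using assms by (auto simp: is_arg_min_def not_less)

section \<open>The uniform law as competitor and the limit in (i)\<close>

context
  assumes reach_pos: "0 < emeasure lborel reach"
begin

abbreviation "uniform_reach \<equiv> uniform_measure lborel reach"
abbreviation "vol \<equiv> measure lborel reach"

lemma reach_measure: "reach \<in> sets borel" "emeasure lborel reach < \<infinity>" "vol > 0"
proof -
  show "reach \<in> sets borel" using compact_imp_closed[OF compact_reach] by simp
  show fin: "emeasure lborel reach < \<infinity>" by (rule emeasure_compact_finite[OF compact_reach])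
  then have "emeasure lborel reach = ennreal vol" by (simp add: emeasure_eq_ennreal_measure less_top)
  then show "vol > 0" using reach_pos by (simp add: ennreal_less_zero_iff)
qed

lemma uniform_reach_prob: "prob_space uniform_reach" "AE y in uniform_reach. y \<in> reach"
proof -
  show "prob_space uniform_reach"
    using reach_pos reach_measure(2) by (intro prob_space_uniform_measure) auto
  show "AE y in uniform_reach. y \<in> reach"
    using reach_pos reach_measure(1,2) by (intro AE_uniform_measureI) auto
qed

lemma final_eps_uniform: "final_eps \<epsilon> uniform_reach = ennreal (1 / \<epsilon>) * ennreal (1 / vol)"
  using uniform_measure_density[OF reach_measure(1) reach_pos reach_measure(2)] by (simp add: final_eps_def)

lemma uniform_lift: obtains Q where "Q \<in> prob_measures X" "law Q = uniform_reach"
proof -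
  have "AE y in uniform_reach. y \<in> E ` topspace X"
    using uniform_reach_prob(2) by (simp only: reach_def)
  from lift_prob_measure[OF C g E_cont uniform_reach_prob(1) _ this]
  obtain Q where "Q \<in> prob_measures X" "distr Q borel E = uniform_reach" by auto
  then show ?thesis by (intro that) (simp_all add: law_def)
qed

text \<open>\<open>q\<close> is the squared \<open>L^2\<close> norm of the end-point density.
  Comparison with one uniform competitor makes it finite; then the comparison can be written in real
  numbers for all such competitors.\<close>

lemma eps_minimizer_bounds:
  assumes \<epsilon>: "\<epsilon> > 0" and min: "is_arg_min (\<lambda>P. cost P + final_eps \<epsilon> (law P)) (\<lambda>Q. Q \<in> prob_measures X) P"
  obtains q where "absolutely_continuous lborel (law P)" "0 \<le> q"
    "(\<integral>\<^sup>+x. (RN_deriv lborel (law P) x)\<^sup>2 \<partial>lborel) = ennreal q" "1 / vol \<le> q"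
    "\<And>Q. \<lbrakk>Q \<in> prob_measures X; law Q = uniform_reach\<rbrakk> \<Longrightarrow> cost_real P + q / \<epsilon> \<le> cost_real Q + 1 / (\<epsilon> * vol)"
proof -
  have P: "P \<in> prob_measures X" using min by (simp add: is_arg_min_def)
  have le: "ennreal (cost_real P) + final_eps \<epsilon> (law P) \<le> ennreal (cost_real Q + 1 / (\<epsilon> * vol))"
    if Q: "Q \<in> prob_measures X" "law Q = uniform_reach" for Q
  proof -
    have "cost P + final_eps \<epsilon> (law P) \<le> cost Q + final_eps \<epsilon> (law Q)" by (rule arg_min_le(2)[OF min Q(1)])
    also have "\<dots> = ennreal (cost_real Q + 1 / (\<epsilon> * vol))"
      using \<epsilon> reach_measure(3) cost_real_nonneg[of Q]
      by (simp add: cost_eq Q final_eps_uniform ennreal_mult[symmetric] ennreal_plus[symmetric] del: ennreal_plus)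
    finally show ?thesis by (simp add: cost_eq P)
  qed
  obtain Q0 where Q0: "Q0 \<in> prob_measures X" "law Q0 = uniform_reach" by (rule uniform_lift)
  have "final_eps \<epsilon> (law P) \<le> ennreal (cost_real P) + final_eps \<epsilon> (law P)" by simp
  also note le[OF Q0]
  finally have fin: "final_eps \<epsilon> (law P) < \<infinity>" by (rule order.strict_trans1) simp
  then have ac: "absolutely_continuous lborel (law P)" by (auto simp: final_eps_def split: if_splits)
  have I_fin: "(\<integral>\<^sup>+x. (RN_deriv lborel (law P) x)\<^sup>2 \<partial>lborel) < \<infinity>"
    using fin ac \<epsilon> by (auto simp: final_eps_def ennreal_mult_less_top)
  define q where "q = enn2real (\<integral>\<^sup>+x. (RN_deriv lborel (law P) x)\<^sup>2 \<partial>lborel)"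
  have q: "0 \<le> q" "(\<integral>\<^sup>+x. (RN_deriv lborel (law P) x)\<^sup>2 \<partial>lborel) = ennreal q"
    using I_fin by (simp_all add: q_def)
  have fe: "final_eps \<epsilon> (law P) = ennreal (q / \<epsilon>)"
    using ac q \<epsilon> by (simp add: final_eps_def ennreal_mult[symmetric])
  have "1 / vol \<le> q"
    by (rule density_near_uniform(1)[OF reach_measure(1) reach_pos reach_measure(2) law_prob[OF P] ac q(2,1)])
  moreover have "cost_real P + q / \<epsilon> \<le> cost_real Q + 1 / (\<epsilon> * vol)"
    if Q: "Q \<in> prob_measures X" "law Q = uniform_reach" for Q
    using le[OF Q] \<epsilon> q(1) cost_real_nonneg[of P] cost_real_nonneg[of Q] reach_measure(3)
    by (simp add: fe ennreal_plus[symmetric] del: ennreal_plus)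
  ultimately show ?thesis using ac q that by blast
qed

theorem eps_limit:
  assumes \<epsilon>: "\<And>n. \<epsilon> n > 0" "\<epsilon> \<longlonglongrightarrow> 0"
    and min: "\<And>n. is_arg_min (\<lambda>P. cost P + final_eps (\<epsilon> n) (law P)) (\<lambda>Q. Q \<in> prob_measures X) (P n)"
  shows "\<exists>P'\<in>prob_measures X. \<exists>r. strict_mono r \<and> narrow_conv X (P \<circ> r) P' \<and>
      is_arg_min (\<lambda>P. cost P + final_uniform reach (law P)) (\<lambda>Q. Q \<in> prob_measures X) P'"
    and "narrow_conv euclidean (\<lambda>n. law (P n)) uniform_reach"
proof -
  have P: "P n \<in> prob_measures X" for n using min[of n] by (simp add: is_arg_min_def)
  have "\<exists>q. absolutely_continuous lborel (law (P n)) \<and> 0 \<le> q \<and>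
      (\<integral>\<^sup>+x. (RN_deriv lborel (law (P n)) x)\<^sup>2 \<partial>lborel) = ennreal q \<and> 1 / vol \<le> q \<and>
      (\<forall>Q\<in>prob_measures X. law Q = uniform_reach \<longrightarrow> cost_real (P n) + q / \<epsilon> n \<le> cost_real Q + 1 / (\<epsilon> n * vol))" for n
    by (rule eps_minimizer_bounds[OF \<epsilon>(1) min]) blast
  then obtain q where ac: "\<And>n. absolutely_continuous lborel (law (P n))" and q0: "\<And>n. 0 \<le> q n"
    and q: "\<And>n. (\<integral>\<^sup>+x. (RN_deriv lborel (law (P n)) x)\<^sup>2 \<partial>lborel) = ennreal (q n)" and q1: "\<And>n. 1 / vol \<le> q n"
    and cmp: "\<And>n Q. \<lbrakk>Q \<in> prob_measures X; law Q = uniform_reach\<rbrakk> \<Longrightarrow>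
      cost_real (P n) + q n / \<epsilon> n \<le> cost_real Q + 1 / (\<epsilon> n * vol)" by metis
  obtain Q0 where Q0: "Q0 \<in> prob_measures X" "law Q0 = uniform_reach" by (rule uniform_lift)
  \<comment> \<open>Costs lie between 0 and \<open>K\<close>, so the penalty of the minimizer
    exceeds the least possible one by at most \<open>K\<close>; multiplication by
    \<open>\<epsilon> n\<close> gives the rate.\<close>
  have q_le: "q n - 1 / vol \<le> \<epsilon> n * K" for n
  proof -
    have "q n / \<epsilon> n - 1 / (\<epsilon> n * vol) \<le> K"
      using cmp[OF Q0, of n] cost_real_nonneg[of "P n"] cost_real_le[OF Q0(1)] by linarith
    then have "\<epsilon> n * (q n / \<epsilon> n - 1 / (\<epsilon> n * vol)) \<le> \<epsilon> n * K" using \<epsilon>(1)[of n] by (intro mult_left_mono) auto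
    moreover have "\<epsilon> n * (q n / \<epsilon> n - 1 / (\<epsilon> n * vol)) = q n - 1 / vol"
      using \<epsilon>(1)[of n] reach_measure(3) by (simp add: right_diff_distrib)
    ultimately show ?thesis by simp
  qed
  have "(\<lambda>n. \<epsilon> n * K) \<longlonglongrightarrow> 0" using tendsto_mult_left_zero[OF \<epsilon>(2)] .
  then have q_lim: "(\<lambda>n. q n - 1 / vol) \<longlonglongrightarrow> 0"
    by (rule tendsto_sandwich[OF _ _ tendsto_const, rotated 2]) (use q_le q1 in auto)
  \<comment> \<open>This needs no compactness, so the whole sequence of laws converges, and for
    bounded Borel test functions.\<close>
  have conv: "(\<lambda>n. \<integral>y. \<phi> y \<partial>law (P n)) \<longlonglongrightarrow> (\<integral>y. \<phi> y \<partial>uniform_reach)"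
    if \<phi>: "\<phi> \<in> borel_measurable borel" "\<And>y. \<bar>\<phi> y\<bar> \<le> b" for \<phi> :: "real^'d \<Rightarrow> real" and b
  proof (rule LIMSEQ_I)
    fix \<eta> :: real assume \<eta>: "\<eta> > 0"
    have b: "b \<ge> 0" using \<phi>(2)[of undefined] by linarith
    \<comment> \<open>Chosen so that \<open>b * (vol / s)\<close> is below \<open>\<eta>\<close>;
      \<open>b + 1\<close> in place of \<open>b\<close> keeps \<open>s\<close> positive when
      \<open>b = 0\<close>.\<close>
    define s where "s = (b + 1) * vol / \<eta>"
    have s: "s > 0" "b * (vol / s) < \<eta>"
    proof -
      show "s > 0" using b \<eta> reach_measure(3) by (auto simp: s_def intro!: divide_pos_pos mult_pos_pos)
      have *: "vol / s = \<eta> / (b + 1)" using b \<eta> reach_measure(3) by (simp add: s_def)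
      show "b * (vol / s) < \<eta>" unfolding * using b \<eta> by (simp add: field_simps)
    qed
    have "(\<lambda>n. b * ((s * (q n - 1 / vol) + vol / s) / 2)) \<longlonglongrightarrow> b * ((s * 0 + vol / s) / 2)"
      by (intro tendsto_intros q_lim) simp
    moreover have "b * ((s * 0 + vol / s) / 2) < \<eta>"
    proof -
      have *: "b * ((s * 0 + vol / s) / 2) = b * (vol / s) / 2" by simp
      have "x / 2 < \<eta>" if "x < \<eta>" for x using that \<eta> by linarith
      from this[OF s(2)] show ?thesis by (simp only: *)
    qed
    ultimately have "\<forall>\<^sub>F n in sequentially. b * ((s * (q n - 1 / vol) + vol / s) / 2) < \<eta>"
      by (rule order_tendstoD(2))
    then obtain N where N: "\<And>n. n \<ge> N \<Longrightarrow> b * ((s * (q n - 1 / vol) + vol / s) / 2) < \<eta>"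
      by (auto simp: eventually_sequentially)
    show "\<exists>no. \<forall>n\<ge>no. norm ((\<integral>y. \<phi> y \<partial>law (P n)) - (\<integral>y. \<phi> y \<partial>uniform_reach)) < \<eta>"
    proof (intro exI[of _ N] allI impI)
      fix n assume "n \<ge> N"
      have "\<bar>(\<integral>y. \<phi> y \<partial>law (P n)) - (\<integral>y. \<phi> y \<partial>uniform_reach)\<bar> \<le> b * ((s * (q n - 1 / vol) + vol / s) / 2)"
        by (rule density_near_uniform(2)[OF reach_measure(1) reach_pos reach_measure(2) law_prob[OF P] ac q q0 \<phi> s(1)])
      with N[OF \<open>n \<ge> N\<close>] show "norm ((\<integral>y. \<phi> y \<partial>law (P n)) - (\<integral>y. \<phi> y \<partial>uniform_reach)) < \<eta>" by simp
    qed
  qed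
  show "narrow_conv euclidean (\<lambda>n. law (P n)) uniform_reach"
    unfolding narrow_conv_def
  proof (intro allI impI, elim conjE)
    fix \<phi> :: "real^'d \<Rightarrow> real" assume \<phi>: "continuous_map euclidean euclideanreal \<phi>" "bounded (\<phi> ` topspace euclidean)"
    obtain b where "\<And>y. \<bar>\<phi> y\<bar> \<le> b" using \<phi>(2) by (auto simp: bounded_iff)
    moreover have "\<phi> \<in> borel_measurable borel" using \<phi>(1) by (intro borel_measurable_continuous_onI) simp
    ultimately show "(\<lambda>n. \<integral>y. \<phi> y \<partial>law (P n)) \<longlonglongrightarrow> (\<integral>y. \<phi> y \<partial>uniform_reach)" by (rule conv[rotated])
  qed
  obtain r P' where r: "strict_mono r" and P': "P' \<in> prob_measures X" and nc: "narrow_conv X (P \<circ> r) P'"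
    and lsc: "cost P' \<le> liminf (\<lambda>n. cost (P (r n)))"
    and lim: "law_conv (P \<circ> r) P'"
    by (rule subsequence[of P]) (rule P, rule that)
  have law_P': "law P' = uniform_reach"
  proof (rule finite_borel_measure_eqI)
    show "finite_measure (law P')" "finite_measure uniform_reach"
      using law_prob(1)[OF P'] uniform_reach_prob(1) by (auto intro: prob_space.finite_measure)
    show "sets (law P') = sets borel" "sets uniform_reach = sets borel" using law_prob(2)[OF P'] by auto
    fix \<phi> :: "real^'d \<Rightarrow> real" and b assume \<phi>: "continuous_on UNIV \<phi>" "\<And>y. \<bar>\<phi> y\<bar> \<le> b"
    have m: "\<phi> \<in> borel_measurable borel" by (rule borel_measurable_continuous_onI[OF \<phi>(1)])
    have "(\<lambda>n. \<integral>y. \<phi> y \<partial>law (P (r n))) \<longlonglongrightarrow> (\<integral>y. \<phi> y \<partial>law P')"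
      unfolding o_apply[of P r, symmetric]
    proof (rule law_convD[OF lim m m \<phi>(2)])
      show "(\<lambda>n. \<phi> (y n)) \<longlonglongrightarrow> \<phi> y0" if "y \<longlonglongrightarrow> y0" for y y0
        by (rule continuous_on_tendsto_compose[OF \<phi>(1) that]) auto
    qed
    moreover have "(\<lambda>n. \<integral>y. \<phi> y \<partial>law (P (r n))) \<longlonglongrightarrow> (\<integral>y. \<phi> y \<partial>uniform_reach)"
      using LIMSEQ_subseq_LIMSEQ[OF conv[OF m \<phi>(2)] r] by (simp add: o_def)
    ultimately show "(\<integral>y. \<phi> y \<partial>law P') = (\<integral>y. \<phi> y \<partial>uniform_reach)" by (rule LIMSEQ_unique)
  qed
  have "is_arg_min (\<lambda>P. cost P + final_uniform reach (law P)) (\<lambda>Q. Q \<in> prob_measures X) P'"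
    unfolding is_arg_min_def
  proof (intro conjI P' notI, elim exE conjE)
    fix Q assume Q: "Q \<in> prob_measures X" "cost Q + final_uniform reach (law Q) < cost P' + final_uniform reach (law P')"
    show False
    proof (cases "law Q = uniform_reach")
      case True
      have "cost_real (P (r n)) \<le> cost_real Q" for n
      proof -
        \<comment> \<open>The minimizer pays at least the penalty of a competitor with uniform law,
          so its control cost is at most that of the competitor, for every \<open>n\<close>.\<close>
        have "1 / (\<epsilon> (r n) * vol) \<le> q (r n) / \<epsilon> (r n)"
          using divide_right_mono[OF q1[of "r n"], of "\<epsilon> (r n)"] \<epsilon>(1)[of "r n"] by (simp add: mult.commute)
        then show ?thesis using cmp[OF Q(1) True, of "r n"] by linarith
      qed
      then have "cost_real P' \<le> cost_real Q"
        using P P' lsc by (intro cost_real_limit_le[of "\<lambda>n. P (r n)" P' "\<lambda>_. cost_real Q"]) auto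
      then show False using Q True law_P' cost_real_nonneg[of Q]
        by (auto simp: final_uniform_def cost_eq P' ennreal_less_iff)
    next
      case False
      then show False using Q by (simp add: final_uniform_def)
    qed
  qed
  with r P' nc show "\<exists>P'\<in>prob_measures X. \<exists>r. strict_mono r \<and> narrow_conv X (P \<circ> r) P' \<and>
      is_arg_min (\<lambda>P. cost P + final_uniform reach (law P)) (\<lambda>Q. Q \<in> prob_measures X) P'" by blast
qed

end

end

section \<open>Vanishing mollification and many particles\<close>

locale mollified_transport = transport_problem X e E C g K + mollifier k
  for X :: "'a topology" and e and E :: "'a \<Rightarrow> real^'d" and C g K and k :: "real^'d \<Rightarrow> real"
begin

lemma law_conv_continuous:
  assumes "law_conv P P'" "continuous_on UNIV (\<phi> :: real^'d \<Rightarrow> real)" "\<And>y. \<bar>\<phi> y\<bar> \<le> b" "d \<longlonglongrightarrow> d0"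
  shows "(\<lambda>n. \<integral>y. smear (d n) \<phi> y \<partial>law (P n)) \<longlonglongrightarrow> (\<integral>y. smear d0 \<phi> y \<partial>law P')"
proof (rule law_convD[OF assms(1)])
  have m: "\<phi> \<in> borel_measurable borel" by (rule borel_measurable_continuous_onI[OF assms(2)])
  show "smear (d n) \<phi> \<in> borel_measurable borel" "smear d0 \<phi> \<in> borel_measurable borel" for n
    by (rule smear_measurable[OF m])+
  show "\<bar>smear (d n) \<phi> y\<bar> \<le> b" for n y by (rule smear_bound[OF m assms(3)])
  show "(\<lambda>n. smear (d n) \<phi> (y n)) \<longlonglongrightarrow> smear d0 \<phi> y0" if "y \<longlonglongrightarrow> y0" for y y0
    by (rule smear_tendsto[OF assms(2,3) that assms(4)])
qed

lemma bounded_support_square_integrable: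
  fixes \<phi> :: "real^'d \<Rightarrow> real"
  assumes "\<phi> \<in> borel_measurable borel" "\<And>y. \<bar>\<phi> y\<bar> \<le> b" "bounded {y. \<phi> y \<noteq> 0}"
  shows "integrable lborel (\<lambda>y. (\<phi> y)\<^sup>2)"
proof -
  obtain r where r: "\<And>y. \<phi> y \<noteq> 0 \<Longrightarrow> norm y \<le> r" using assms(3) by (auto simp: bounded_iff)
  have "integrable lborel (\<lambda>y. b\<^sup>2 * indicator (cball (0::real^'d) r) y)"
    by (intro integrable_mult_right integrable_real_indicator)
      (simp_all add: emeasure_lborel_cball_finite[unfolded infinity_ennreal_def])
  then show ?thesis
  proof (rule Bochner_Integration.integrable_bound)
    have "(\<phi> y)\<^sup>2 \<le> b\<^sup>2 * indicator (cball 0 r) y" for y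
    proof (cases "\<phi> y = 0")
      case False
      have "(\<phi> y)\<^sup>2 \<le> b\<^sup>2" using power_mono[OF assms(2)[of y] abs_ge_zero, of 2] by simp
      then show ?thesis using r[OF False] by simp
    qed simp
    then show "AE y in lborel. norm ((\<phi> y)\<^sup>2) \<le> norm (b\<^sup>2 * indicator (cball (0::real^'d) r) y)"
      by simp
  qed (use assms(1) in measurable)
qed

theorem delta_limit:
  assumes \<epsilon>: "\<epsilon> > 0" and \<delta>: "\<And>n. \<delta> n > 0" "\<delta> \<longlonglongrightarrow> 0"
    and min: "\<And>n. is_arg_min (\<lambda>P. cost P + final_eps_delta k \<epsilon> (\<delta> n) (law P)) (\<lambda>Q. Q \<in> prob_measures X) (P n)"
  shows "\<exists>P'\<in>prob_measures X. \<exists>r. strict_mono r \<and> narrow_conv X (P \<circ> r) P' \<and>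
      is_arg_min (\<lambda>P. cost P + final_eps \<epsilon> (law P)) (\<lambda>Q. Q \<in> prob_measures X) P'"
proof -
  have P: "P n \<in> prob_measures X" for n using min[of n] by (simp add: is_arg_min_def)
  obtain r P' where r: "strict_mono r" and P': "P' \<in> prob_measures X" and nc: "narrow_conv X (P \<circ> r) P'"
    and lsc: "cost P' \<le> liminf (\<lambda>n. cost (P (r n)))" and lim: "law_conv (P \<circ> r) P'"
    by (rule subsequence[of P]) (rule P, rule that)
  have "cost P' + final_eps \<epsilon> (law P') \<le> cost Q + final_eps \<epsilon> (law Q)" if Q: "Q \<in> prob_measures X" for Q
  proof (cases "final_eps \<epsilon> (law Q) = \<infinity>")
    case False
    then obtain v where v: "final_eps \<epsilon> (law Q) = ennreal v" "0 \<le> v" by (cases "final_eps \<epsilon> (law Q)") auto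
    \<comment> \<open>The limiting energy of the competitor \<open>Q\<close>. It bounds the energies
      of all minimizers, because mollification only lowers the penalty of \<open>Q\<close>.\<close>
    define V where "V = cost_real Q + v"
    have le: "cost_real (P n) + 1 / \<epsilon> * (\<integral>y. (mollify k (\<delta> n) (law (P n)) y)\<^sup>2 \<partial>lborel) \<le> V" for n
    proof -
      note l = law_prob(1,2)[OF P] law_prob(1,2)[OF Q]
      have "cost (P n) + final_eps_delta k \<epsilon> (\<delta> n) (law (P n)) \<le> cost Q + final_eps_delta k \<epsilon> (\<delta> n) (law Q)"
        by (rule arg_min_le(2)[OF min Q])
      also have "\<dots> \<le> cost Q + ennreal v"
        unfolding v(1)[symmetric] by (intro add_left_mono final_eps_delta_le_final_eps l \<delta> \<epsilon>)
      also have "\<dots> = ennreal V" using v(2) cost_real_nonneg[of Q] by (simp add: V_def cost_eq Q)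
      finally have "ennreal (cost_real (P n) + 1 / \<epsilon> * (\<integral>y. (mollify k (\<delta> n) (law (P n)) y)\<^sup>2 \<partial>lborel)) \<le> ennreal V"
        using cost_real_nonneg[of "P n"] \<epsilon> by (simp add: cost_eq P final_eps_delta_eq[OF l(1,2) \<delta>(1) \<epsilon>])
      moreover have "0 \<le> V" using v(2) cost_real_nonneg[of Q] by (simp add: V_def)
      ultimately show ?thesis by simp
    qed
    \<comment> \<open>The room that \<open>V\<close> leaves for the squared density norm of the
      limit once its control cost is paid.\<close>
    define W where "W = \<epsilon> * (V - cost_real P')"
    have bound: "2 * (\<integral>x. \<phi> x \<partial>law P') - (\<integral>x. (\<phi> x)\<^sup>2 \<partial>lborel) \<le> W"
      if \<phi>: "continuous_on UNIV \<phi>" "\<And>x. \<bar>\<phi> x\<bar> \<le> b" "bounded {x. \<phi> x \<noteq> 0}" for \<phi> :: "real^'d \<Rightarrow> real" and b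
    proof -
      have m: "\<phi> \<in> borel_measurable borel" by (rule borel_measurable_continuous_onI[OF \<phi>(1)])
      have sq: "integrable lborel (\<lambda>x. (\<phi> x)\<^sup>2)" by (rule bounded_support_square_integrable[OF m \<phi>(2,3)])
      \<comment> \<open>For fixed \<open>\<phi>\<close>, duality replaces the squared norm by an
        affine lower bound. The resulting upper bound on the control costs converges, and
        semicontinuity transfers it to \<open>P'\<close>.\<close>
      let ?u = "\<lambda>n. V - 1 / \<epsilon> * (2 * (\<integral>x. smear (\<delta> (r n)) \<phi> x \<partial>law ((P \<circ> r) n)) - (\<integral>x. (\<phi> x)\<^sup>2 \<partial>lborel))"
      have "cost_real P' \<le> V - 1 / \<epsilon> * (2 * (\<integral>x. smear 0 \<phi> x \<partial>law P') - (\<integral>x. (\<phi> x)\<^sup>2 \<partial>lborel))"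
      proof (rule cost_real_limit_le[OF _ P', of "P \<circ> r" ?u])
        show "(P \<circ> r) n \<in> prob_measures X" for n using P by simp
        show "cost P' \<le> liminf (\<lambda>n. cost ((P \<circ> r) n))" using lsc by simp
        have dr: "(\<lambda>n. \<delta> (r n)) \<longlonglongrightarrow> 0" using LIMSEQ_subseq_LIMSEQ[OF \<delta>(2) r] by (simp add: o_def)
        show "?u \<longlonglongrightarrow> V - 1 / \<epsilon> * (2 * (\<integral>x. smear 0 \<phi> x \<partial>law P') - (\<integral>x. (\<phi> x)\<^sup>2 \<partial>lborel))"
          by (intro tendsto_diff tendsto_mult tendsto_const law_conv_continuous[OF lim \<phi>(1,2) dr])
        fix n
        have "1 / \<epsilon> * (2 * (\<integral>x. smear (\<delta> (r n)) \<phi> x \<partial>law (P (r n))) - (\<integral>x. (\<phi> x)\<^sup>2 \<partial>lborel))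
            \<le> 1 / \<epsilon> * (\<integral>y. (mollify k (\<delta> (r n)) (law (P (r n))) y)\<^sup>2 \<partial>lborel)"
          using \<epsilon> by (intro mult_left_mono quadratic_duality[OF law_prob(1,2)[OF P] \<delta>(1) m \<phi>(2) sq]) auto
        then show "cost_real ((P \<circ> r) n) \<le> ?u n" using le[of "r n"] by (simp del: of_nat_Suc)
      qed
      then have "1 / \<epsilon> * (2 * (\<integral>x. \<phi> x \<partial>law P') - (\<integral>x. (\<phi> x)\<^sup>2 \<partial>lborel)) \<le> V - cost_real P'"
        by (simp add: smear_0[abs_def])
      from mult_left_mono[OF this, of \<epsilon>] show ?thesis using \<epsilon> by (simp add: W_def)
    qed
    have L2: "absolutely_continuous lborel (law P')"
      "(\<integral>\<^sup>+x. (RN_deriv lborel (law P') x)\<^sup>2 \<partial>lborel) \<le> ennreal W"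
      by (rule L2_density_of_quadratic_bound[OF law_prob(1,2)[OF P']], rule bound, assumption+)+
    \<comment> \<open>Testing with zero. Nonnegativity matters since \<open>ennreal\<close> sends
      negative numbers to 0.\<close>
    have W: "W \<ge> 0" using bound[of "\<lambda>_. 0" 0] by simp
    have "final_eps \<epsilon> (law P') \<le> ennreal (1 / \<epsilon>) * ennreal W"
      using L2 by (simp add: final_eps_def mult_left_mono)
    also have "\<dots> = ennreal (V - cost_real P')"
      using \<epsilon> W by (simp add: ennreal_mult[symmetric] W_def)
    finally have "cost P' + final_eps \<epsilon> (law P') \<le> ennreal (cost_real P') + ennreal (V - cost_real P')"
      unfolding cost_eq[OF P'] by (rule add_left_mono)
    also have "\<dots> = ennreal V"
    proof -
      have "0 \<le> V - cost_real P'" using W \<epsilon> by (simp add: W_def zero_le_mult_iff)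
      then show ?thesis using cost_real_nonneg[of P'] by (simp add: ennreal_plus[symmetric] del: ennreal_plus)
    qed
    also have "\<dots> = cost Q + final_eps \<epsilon> (law Q)"
      using v cost_real_nonneg[of Q] by (simp add: V_def cost_eq Q)
    finally show ?thesis .
  qed simp
  then have "is_arg_min (\<lambda>P. cost P + final_eps \<epsilon> (law P)) (\<lambda>Q. Q \<in> prob_measures X) P'"
    using P' by (auto simp: is_arg_min_def not_less)
  with r P' nc show ?thesis by blast
qed

section \<open>Empirical measures and the limit in (iii)\<close>

lemma empirical_facts:
  fixes f :: "'a \<Rightarrow> real"
  assumes N: "N \<ge> 1" and p: "\<And>i. i \<in> {1..N} \<Longrightarrow> p i \<in> topspace X"
  shows "empirical X N p \<in> prob_measures X"
    "f \<in> borel_measurable (borel_of X) \<Longrightarrow> (\<integral>z. f z \<partial>empirical X N p) = (\<Sum>i=1..N. f (p i)) / real N"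
proof -
  have m: "p \<in> measurable (uniform_count_measure {1..N}) (borel_of X)"
    using p by (auto simp: measurable_def space_uniform_count_measure sets_uniform_count_measure space_borel_of)
  have "prob_space (uniform_count_measure {1..N})" using N by (intro prob_space_uniform_count_measure) auto
  then show "empirical X N p \<in> prob_measures X"
    unfolding empirical_def using m by (rule prob_measures_distr)
  assume f: "f \<in> borel_measurable (borel_of X)"
  show "(\<integral>z. f z \<partial>empirical X N p) = (\<Sum>i=1..N. f (p i)) / real N"
    unfolding empirical_def by (subst integral_distr[OF m f]) (simp add: integral_uniform_count_measure)
qed

definition particle_energy :: "real \<Rightarrow> real \<Rightarrow> nat \<Rightarrow> (nat \<Rightarrow> 'a) \<Rightarrow> real" where
  "particle_energy \<epsilon> \<delta> N p = (1 / real N) * (\<Sum>i=1..N. e (p i)) +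
     (1 / (\<epsilon> * (real N)\<^sup>2)) * (\<Sum>i=1..N. \<Sum>j=1..N. interaction_kernel k \<delta> (E (p i) - E (p j)))"

lemma ms_prod_integrable: "\<delta> > 0 \<Longrightarrow> integrable lborel (\<lambda>y. ms \<delta> (y - x) * ms \<delta> (y - z))"
proof -
  assume \<delta>: "\<delta> > 0"
  obtain B where B: "B > 0" "\<And>y. ms \<delta> y \<le> B" by (rule ms_bounded[OF \<delta>]) blast
  show ?thesis
    by (rule ms_mult_integrable[OF \<delta>, where b = B]) (use B ms_nonneg[OF \<delta>] in auto)
qed

text \<open>Replacing the \<open>i\<close>-th particle by an arbitrary one cannot decrease the energy. Summing
  over \<open>i\<close> gives an inequality that is affine in the law of the new particle.\<close>

lemma particle_minimizer_inequality:
  assumes \<epsilon>: "\<epsilon> > 0" and \<delta>: "\<delta> > 0" and N: "N \<ge> 1"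
    and min: "is_arg_min (particle_energy \<epsilon> \<delta> N) (\<lambda>p. \<forall>i\<in>{1..N}. p i \<in> topspace X) p"
    and z: "z \<in> topspace X"
  defines "S \<equiv> \<lambda>y. \<Sum>j=1..N. ms \<delta> (y - E (p j))"
  shows "(\<Sum>i=1..N. e (p i)) / real N + 2 / (\<epsilon> * (real N)\<^sup>2) * (\<integral>y. (S y)\<^sup>2 \<partial>lborel)
     \<le> e z + 2 / (\<epsilon> * real N) * (\<integral>y. S y * ms \<delta> (y - E z) \<partial>lborel) + 2 / (\<epsilon> * real N) * interaction_kernel k \<delta> 0"
proof -
  define A where "A = (\<lambda>w y. ms \<delta> (y - E w))"
  define K0 where "K0 = interaction_kernel k \<delta> 0"
  have A_int: "integrable lborel (\<lambda>y. A v y * A w y)" for v w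
    unfolding A_def by (rule ms_prod_integrable[OF \<delta>])
  have A_K: "(\<integral>y. A v y * A w y \<partial>lborel) = interaction_kernel k \<delta> (E v - E w)" for v w
    unfolding A_def by (rule interaction_kernel_diff[symmetric])
  have A_nonneg: "0 \<le> A v y" for v y by (simp add: A_def ms_nonneg[OF \<delta>])
  have sums: "integrable lborel (\<lambda>y. (\<Sum>i=1..N. A (q i) y) * (\<Sum>j=1..N. A (q' j) y))"
    "(\<integral>y. (\<Sum>i=1..N. A (q i) y) * (\<Sum>j=1..N. A (q' j) y) \<partial>lborel)
      = (\<Sum>i=1..N. \<Sum>j=1..N. interaction_kernel k \<delta> (E (q i) - E (q' j)))" for q q'
    unfolding sum_product using A_int by (auto simp: A_K)
  \<comment> \<open>By the two-point formula for the kernel the double sum is the square integral of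
    the sum of the bumps \<open>A (q i)\<close>; the interaction is a convex quadratic form in
    it.\<close>
  have J: "particle_energy \<epsilon> \<delta> N q = (\<Sum>i=1..N. e (q i)) / real N + (\<integral>y. (\<Sum>i=1..N. A (q i) y)\<^sup>2 \<partial>lborel) / (\<epsilon> * (real N)\<^sup>2)" for q
    using sums(2)[of q q] by (simp add: particle_energy_def power2_eq_square)
  have S_eq: "S y = (\<Sum>j=1..N. A (p j) y)" for y by (simp add: S_def A_def)
  have S_int: "integrable lborel (\<lambda>y. (S y)\<^sup>2)"
    using sums(1)[of p p] by (simp add: S_eq[abs_def] power2_eq_square)
  have SA_int: "integrable lborel (\<lambda>y. S y * A w y)" for w
    unfolding S_eq sum_distrib_right using A_int by (intro Bochner_Integration.integrable_sum) auto
  have step: "0 \<le> (e z - e (p i)) / real N + (2 * (\<integral>y. S y * A z y \<partial>lborel) - 2 * (\<integral>y. S y * A (p i) y \<partial>lborel) + 2 * K0) / (\<epsilon> * (real N)\<^sup>2)"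
    if i: "i \<in> {1..N}" for i
  proof -
    have "\<forall>j\<in>{1..N}. (p(i := z)) j \<in> topspace X" using min z by (auto simp: is_arg_min_def)
    then have "\<not> particle_energy \<epsilon> \<delta> N (p(i := z)) < particle_energy \<epsilon> \<delta> N p"
      using min unfolding is_arg_min_def by blast
    then have le: "particle_energy \<epsilon> \<delta> N p \<le> particle_energy \<epsilon> \<delta> N (p(i := z))" by simp
    have upd: "(\<Sum>j=1..N. h ((p(i := z)) j)) = (\<Sum>j=1..N. h (p j)) + (h z - h (p i))" for h :: "'a \<Rightarrow> real"
    proof -
      have "(\<Sum>j=1..N. h ((p(i := z)) j)) = h z + (\<Sum>j\<in>{1..N} - {i}. h (p j))"
        using i by (subst sum.remove[of _ i]) (auto intro!: sum.cong)
      moreover have "(\<Sum>j=1..N. h (p j)) = h (p i) + (\<Sum>j\<in>{1..N} - {i}. h (p j))"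
        using i by (subst sum.remove[of _ i]) auto
      ultimately show ?thesis by simp
    qed
    have Su: "(\<Sum>j=1..N. A ((p(i := z)) j) y) = S y + (A z y - A (p i) y)" for y
      unfolding S_eq by (rule upd)
    \<comment> \<open>The two squared bumps contribute \<open>K0\<close> each. The mixed term of the
      new and the removed particle has a favourable sign and is dropped, which leaves an expression
      affine in the bump of \<open>z\<close>.\<close>
    have sq: "(\<integral>y. (S y + (A z y - A (p i) y))\<^sup>2 \<partial>lborel)
        \<le> (\<integral>y. (S y)\<^sup>2 \<partial>lborel) + (2 * (\<integral>y. S y * A z y \<partial>lborel) - 2 * (\<integral>y. S y * A (p i) y \<partial>lborel) + 2 * K0)"
    proof -
      have "(\<lambda>y. (S y + (A z y - A (p i) y))\<^sup>2) = (\<lambda>y. (S y)\<^sup>2 + 2 * (S y * A z y) - 2 * (S y * A (p i) y)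
          + A z y * A z y - 2 * (A z y * A (p i) y) + A (p i) y * A (p i) y)"
        by (simp add: power2_eq_square algebra_simps fun_eq_iff)
      then have "(\<integral>y. (S y + (A z y - A (p i) y))\<^sup>2 \<partial>lborel) = (\<integral>y. (S y)\<^sup>2 \<partial>lborel) + 2 * (\<integral>y. S y * A z y \<partial>lborel)
          - 2 * (\<integral>y. S y * A (p i) y \<partial>lborel) + K0 - 2 * (\<integral>y. A z y * A (p i) y \<partial>lborel) + K0"
        using S_int SA_int A_int A_K[of z z] A_K[of "p i" "p i"] by (simp add: K0_def)
      moreover have "0 \<le> (\<integral>y. A z y * A (p i) y \<partial>lborel)"
        using A_nonneg by (intro integral_nonneg_AE) auto
      ultimately show ?thesis by simp
    qed
    have "particle_energy \<epsilon> \<delta> N p = (\<Sum>i=1..N. e (p i)) / real N + (\<integral>y. (S y)\<^sup>2 \<partial>lborel) / (\<epsilon> * (real N)\<^sup>2)"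
      unfolding J S_eq ..
    moreover have "particle_energy \<epsilon> \<delta> N (p(i := z)) = ((\<Sum>j=1..N. e (p j)) + (e z - e (p i))) / real N
        + (\<integral>y. (S y + (A z y - A (p i) y))\<^sup>2 \<partial>lborel) / (\<epsilon> * (real N)\<^sup>2)"
      unfolding J Su upd[of e] ..
    moreover note divide_right_mono[OF sq, of "\<epsilon> * (real N)\<^sup>2"]
    ultimately have "(\<Sum>i=1..N. e (p i)) / real N + (\<integral>y. (S y)\<^sup>2 \<partial>lborel) / (\<epsilon> * (real N)\<^sup>2)
      \<le> ((\<Sum>j=1..N. e (p j)) + (e z - e (p i))) / real N + ((\<integral>y. (S y)\<^sup>2 \<partial>lborel)
        + (2 * (\<integral>y. S y * A z y \<partial>lborel) - 2 * (\<integral>y. S y * A (p i) y \<partial>lborel) + 2 * K0)) / (\<epsilon> * (real N)\<^sup>2)"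
      using le \<epsilon> by simp
    then show ?thesis by (simp add: add_divide_distrib)
  qed
  have "0 \<le> (\<Sum>i=1..N. (e z - e (p i)) / real N + (2 * (\<integral>y. S y * A z y \<partial>lborel) - 2 * (\<integral>y. S y * A (p i) y \<partial>lborel) + 2 * K0) / (\<epsilon> * (real N)\<^sup>2))"
    by (rule sum_nonneg) (rule step)
  also have "\<dots> = (\<Sum>i=1..N. e z - e (p i)) / real N
      + (\<Sum>i=1..N. 2 * (\<integral>y. S y * A z y \<partial>lborel) - 2 * (\<integral>y. S y * A (p i) y \<partial>lborel) + 2 * K0) / (\<epsilon> * (real N)\<^sup>2)"
    by (simp only: sum_divide_distrib sum.distrib[symmetric])
  also have "(\<Sum>i=1..N. e z - e (p i)) = real N * e z - (\<Sum>i=1..N. e (p i))" by (simp add: sum_subtractf)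
  also have "(\<Sum>i=1..N. 2 * (\<integral>y. S y * A z y \<partial>lborel) - 2 * (\<integral>y. S y * A (p i) y \<partial>lborel) + 2 * K0)
      = 2 * real N * (\<integral>y. S y * A z y \<partial>lborel) - 2 * (\<Sum>i=1..N. \<integral>y. S y * A (p i) y \<partial>lborel) + 2 * real N * K0"
    by (simp add: sum.distrib sum_subtractf sum_distrib_left)
  \<comment> \<open>The bumps of the removed particles add up to \<open>S\<close> itself, so the
    linear terms reproduce the square integral, with the factor 2 of a derivative.\<close>
  also have "(\<Sum>i=1..N. \<integral>y. S y * A (p i) y \<partial>lborel) = (\<integral>y. (S y)\<^sup>2 \<partial>lborel)"
  proof -
    have "(\<lambda>y. \<Sum>i=1..N. S y * A (p i) y) = (\<lambda>y. (S y)\<^sup>2)"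
      by (simp only: sum_distrib_left[symmetric] S_eq[symmetric] power2_eq_square)
    moreover have "(\<Sum>i=1..N. \<integral>y. S y * A (p i) y \<partial>lborel) = (\<integral>y. (\<Sum>i=1..N. S y * A (p i) y) \<partial>lborel)"
      using SA_int by (intro Bochner_Integration.integral_sum[symmetric])
    ultimately show ?thesis by simp
  qed
  finally have "0 \<le> (real N * e z - (\<Sum>i=1..N. e (p i))) / real N
      + (2 * real N * (\<integral>y. S y * A z y \<partial>lborel) - 2 * (\<integral>y. (S y)\<^sup>2 \<partial>lborel) + 2 * real N * K0) / (\<epsilon> * (real N)\<^sup>2)" .
  also have "\<dots> = e z - (\<Sum>i=1..N. e (p i)) / real N + 2 / (\<epsilon> * real N) * (\<integral>y. S y * A z y \<partial>lborel)
      - 2 / (\<epsilon> * (real N)\<^sup>2) * (\<integral>y. (S y)\<^sup>2 \<partial>lborel) + 2 / (\<epsilon> * real N) * K0"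
    using N \<epsilon> by (simp add: field_simps power2_eq_square)
  finally show ?thesis by (simp add: A_def K0_def)
qed

theorem particle_limit:
  assumes \<epsilon>: "\<epsilon> > 0" and \<delta>: "\<delta> > 0"
    and min: "\<And>N. N \<ge> 1 \<Longrightarrow> is_arg_min (particle_energy \<epsilon> \<delta> N) (\<lambda>p. \<forall>i\<in>{1..N}. p i \<in> topspace X) (p N)"
  shows "\<exists>P'\<in>prob_measures X. \<exists>r. strict_mono r \<and> narrow_conv X (\<lambda>n. empirical X (r n) (p (r n))) P' \<and>
      is_arg_min (\<lambda>P. cost P + final_eps_delta k \<epsilon> \<delta> (law P)) (\<lambda>Q. Q \<in> prob_measures X) P'"
proof -
  \<comment> \<open>The shift excludes \<open>N = 0\<close>, for which there is no empirical
    probability measure.\<close>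
  define P where "P = (\<lambda>n. empirical X (Suc n) (p (Suc n)))"
  have pX: "p (Suc n) i \<in> topspace X" if "i \<in> {1..Suc n}" for n i
    using min[of "Suc n"] that by (simp add: is_arg_min_def)
  have P: "P n \<in> prob_measures X"
    and P_int: "(\<integral>z. f z \<partial>P n) = (\<Sum>i=1..Suc n. f (p (Suc n) i)) / real (Suc n)"
    if "f \<in> borel_measurable (borel_of X)" for n and f :: "'a \<Rightarrow> real"
    unfolding P_def using that by (intro empirical_facts pX; simp)+
  have P: "P n \<in> prob_measures X" for n
    by (rule P[of "\<lambda>_. 0"]) simp
  \<comment> \<open>The normalized form of the bump sum: \<open>S\<close> is
    \<open>real (Suc n)\<close> times this mollified empirical law.\<close>
  define G where "G = (\<lambda>n. mollify k \<delta> (law (P n)))"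
  have G_eq: "(\<Sum>j=1..Suc n. ms \<delta> (y - E (p (Suc n) j))) = real (Suc n) * G n y" for n y
  proof -
    have "G n y = (\<integral>z. ms \<delta> (y - E z) \<partial>P n)"
      unfolding G_def mollify_def by (rule integral_law[OF P]) measurable
    also have "\<dots> = (\<Sum>j=1..Suc n. ms \<delta> (y - E (p (Suc n) j))) / real (Suc n)"
      by (rule P_int) (use E_meas in measurable)
    finally show ?thesis by (simp del: of_nat_Suc)
  qed
  have cost_P: "cost_real (P n) = (\<Sum>i=1..Suc n. e (p (Suc n) i)) / real (Suc n)" for n
    unfolding cost_real_def by (rule P_int[OF e_meas])
  define K0 where "K0 = interaction_kernel k \<delta> 0"
  have G_meas: "G n \<in> borel_measurable borel" and G_sq: "integrable lborel (\<lambda>y. (G n y)\<^sup>2)" for n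
    unfolding G_def using mollify_measurable[OF law_prob(1,2)[OF P] \<delta>]
      mollify_square_integrable[OF law_prob(1,2)[OF P] \<delta>] by auto
  have compare: "cost_real (P n) + 1 / \<epsilon> * (\<integral>y. (G n y)\<^sup>2 \<partial>lborel)
      \<le> cost_real Q + 1 / \<epsilon> * (\<integral>y. (mollify k \<delta> (law Q) y)\<^sup>2 \<partial>lborel) + 2 / (\<epsilon> * real (Suc n)) * K0"
    if Q: "Q \<in> prob_measures X" for Q n
  proof -
    interpret Q: prob_space Q by (rule prob_measuresD(1)[OF Q])
    obtain B where B: "B > 0" "\<And>y. \<bar>G n y\<bar> \<le> B"
      unfolding G_def by (rule mollify_bounded[OF law_prob(1,2)[OF P] \<delta>]) blast
    let ?c = "cost_real (P n) + 2 / \<epsilon> * (\<integral>y. (G n y)\<^sup>2 \<partial>lborel)"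
    let ?h = "\<lambda>z. e z + 2 / \<epsilon> * smear \<delta> (G n) (E z) + 2 / (\<epsilon> * real (Suc n)) * K0"
    have pt: "?c \<le> ?h z" if z: "z \<in> topspace X" for z
    proof -
      note particle_minimizer_inequality[OF \<epsilon> \<delta> _ min z, of "Suc n"]
      then have "cost_real (P n) + 2 / (\<epsilon> * (real (Suc n))\<^sup>2) * (\<integral>y. (real (Suc n) * G n y)\<^sup>2 \<partial>lborel)
        \<le> e z + 2 / (\<epsilon> * real (Suc n)) * (\<integral>y. (real (Suc n) * G n y) * ms \<delta> (y - E z) \<partial>lborel)
          + 2 / (\<epsilon> * real (Suc n)) * K0"
        unfolding G_eq cost_P K0_def by simp
      moreover have "(\<integral>y. (real (Suc n) * G n y)\<^sup>2 \<partial>lborel) = (real (Suc n))\<^sup>2 * (\<integral>y. (G n y)\<^sup>2 \<partial>lborel)"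
        by (simp add: power_mult_distrib del: of_nat_Suc)
      moreover have "(\<integral>y. (real (Suc n) * G n y) * ms \<delta> (y - E z) \<partial>lborel) = real (Suc n) * smear \<delta> (G n) (E z)"
        by (simp add: smear_eq[OF \<delta> G_meas] mult.assoc del: of_nat_Suc)
      ultimately show ?thesis using \<epsilon> by (simp del: of_nat_Suc)
    qed
    have smear_E: "(\<lambda>z. smear \<delta> (G n) (E z)) \<in> borel_measurable Q"
      by (rule measurable_compose[OF measurable_P[OF Q E_meas] smear_measurable[OF G_meas]])
    have smear_int: "integrable Q (\<lambda>z. smear \<delta> (G n) (E z))"
      using smear_bound[OF G_meas B(2)] by (intro Q.integrable_const_bound[where B = B] smear_E) auto
    have h_int: "integrable Q ?h" using smear_int e_integrable[OF Q] by simp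
    have "?c = (\<integral>z. ?c \<partial>Q)" by (simp add: Q.prob_space)
    also have "\<dots> \<le> (\<integral>z. ?h z \<partial>Q)"
      using pt prob_measuresD(3)[OF Q] by (intro integral_mono h_int) auto
    also have "\<dots> = cost_real Q + 2 / \<epsilon> * (\<integral>z. smear \<delta> (G n) (E z) \<partial>Q) + 2 / (\<epsilon> * real (Suc n)) * K0"
      using smear_int e_integrable[OF Q] by (simp add: cost_real_def Q.prob_space del: of_nat_Suc)
    also have "(\<integral>z. smear \<delta> (G n) (E z) \<partial>Q) = (\<integral>x. smear \<delta> (G n) x \<partial>law Q)"
      by (rule integral_law[OF Q smear_measurable[OF G_meas], symmetric])
    finally have 1: "?c \<le> cost_real Q + 2 / \<epsilon> * (\<integral>x. smear \<delta> (G n) x \<partial>law Q) + 2 / (\<epsilon> * real (Suc n)) * K0" .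
    \<comment> \<open>Convexity: this inequality turns the integrated optimality condition, whose
      terms carry the factor 2, into a comparison of energies by cancelling one copy of the square
      integral of \<open>G n\<close>.\<close>
    have "2 * (\<integral>x. smear \<delta> (G n) x \<partial>law Q) - (\<integral>y. (G n y)\<^sup>2 \<partial>lborel) \<le> (\<integral>y. (mollify k \<delta> (law Q) y)\<^sup>2 \<partial>lborel)"
      by (rule quadratic_duality[OF law_prob(1,2)[OF Q] \<delta> G_meas B(2) G_sq])
    from mult_left_mono[OF this, of "1 / \<epsilon>"] \<epsilon>
    have "1 / \<epsilon> * (2 * (\<integral>x. smear \<delta> (G n) x \<partial>law Q)) - 1 / \<epsilon> * (\<integral>y. (G n y)\<^sup>2 \<partial>lborel)
        \<le> 1 / \<epsilon> * (\<integral>y. (mollify k \<delta> (law Q) y)\<^sup>2 \<partial>lborel)"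
      by (simp add: right_diff_distrib)
    with 1 show ?thesis by (simp del: of_nat_Suc)
  qed
  obtain r P' where r: "strict_mono r" and P': "P' \<in> prob_measures X" and nc: "narrow_conv X (P \<circ> r) P'"
    and lsc: "cost P' \<le> liminf (\<lambda>n. cost (P (r n)))" and lim: "law_conv (P \<circ> r) P'"
    by (rule subsequence[of P]) (rule P, rule that)
  \<comment> \<open>The mollified limit law is the test function for which duality becomes an
    equality in the limit; no convergence of the squared norms is needed.\<close>
  define H where "H = mollify k \<delta> (law P')"
  note l' = law_prob(1,2)[OF P'] \<delta>
  obtain B where B: "B > 0" "\<And>y. \<bar>H y\<bar> \<le> B"
    unfolding H_def by (rule mollify_bounded[OF l']) blast
  have H_cont: "continuous_on UNIV H" unfolding H_def by (rule mollify_continuous[OF l'])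
  have H_meas: "H \<in> borel_measurable borel" by (rule borel_measurable_continuous_onI[OF H_cont])
  have H_sq: "integrable lborel (\<lambda>y. (H y)\<^sup>2)" unfolding H_def by (rule mollify_square_integrable[OF l'])
  have H_self: "(\<integral>x. smear \<delta> H x \<partial>law P') = (\<integral>y. (H y)\<^sup>2 \<partial>lborel)"
    using integral_mollify(2)[OF l' H_meas B(2)] by (simp add: H_def power2_eq_square)
  have "cost P' + final_eps_delta k \<epsilon> \<delta> (law P') \<le> cost Q + final_eps_delta k \<epsilon> \<delta> (law Q)"
    if Q: "Q \<in> prob_measures X" for Q
  proof -
    define V where "V = cost_real Q + 1 / \<epsilon> * (\<integral>y. (mollify k \<delta> (law Q) y)\<^sup>2 \<partial>lborel)"
    let ?u = "\<lambda>n. V + 2 / \<epsilon> * K0 * inverse (real (Suc (r n)))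
      - 1 / \<epsilon> * (2 * (\<integral>x. smear \<delta> H x \<partial>law ((P \<circ> r) n)) - (\<integral>y. (H y)\<^sup>2 \<partial>lborel))"
    have "cost_real P' \<le> V + 2 / \<epsilon> * K0 * 0 - 1 / \<epsilon> * (2 * (\<integral>x. smear \<delta> H x \<partial>law P') - (\<integral>y. (H y)\<^sup>2 \<partial>lborel))"
    proof (rule cost_real_limit_le[OF _ P', of "P \<circ> r" ?u])
      show "(P \<circ> r) n \<in> prob_measures X" for n using P by simp
      show "cost P' \<le> liminf (\<lambda>n. cost ((P \<circ> r) n))" using lsc by simp
      have "(\<lambda>n. inverse (real (Suc (r n)))) \<longlonglongrightarrow> 0"
        using LIMSEQ_subseq_LIMSEQ[OF LIMSEQ_inverse_real_of_nat r] by (simp add: o_def)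
      then show "?u \<longlonglongrightarrow> V + 2 / \<epsilon> * K0 * 0 - 1 / \<epsilon> * (2 * (\<integral>x. smear \<delta> H x \<partial>law P') - (\<integral>y. (H y)\<^sup>2 \<partial>lborel))"
        by (intro tendsto_diff tendsto_add tendsto_mult tendsto_const law_conv_continuous[OF lim H_cont B(2) tendsto_const])
      fix n
      have "1 / \<epsilon> * (2 * (\<integral>x. smear \<delta> H x \<partial>law (P (r n))) - (\<integral>y. (H y)\<^sup>2 \<partial>lborel)) \<le> 1 / \<epsilon> * (\<integral>y. (G (r n) y)\<^sup>2 \<partial>lborel)"
        unfolding G_def using \<epsilon> by (intro mult_left_mono quadratic_duality[OF law_prob(1,2)[OF P] \<delta> H_meas B(2) H_sq]) auto
      moreover have "2 / (\<epsilon> * real (Suc (r n))) * K0 = 2 / \<epsilon> * K0 * inverse (real (Suc (r n)))"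
        by (simp add: divide_inverse)
      ultimately show "cost_real ((P \<circ> r) n) \<le> ?u n"
        using compare[OF Q, of "r n"] unfolding V_def o_def by linarith
    qed
    then have le: "cost_real P' + 1 / \<epsilon> * (\<integral>y. (H y)\<^sup>2 \<partial>lborel) \<le> V" by (simp add: H_self)
    have "cost P' + final_eps_delta k \<epsilon> \<delta> (law P') = ennreal (cost_real P' + 1 / \<epsilon> * (\<integral>y. (H y)\<^sup>2 \<partial>lborel))"
      using \<epsilon> cost_real_nonneg[of P'] by (simp add: cost_eq P' final_eps_delta_eq[OF l' \<epsilon>] H_def)
    also have "\<dots> \<le> ennreal V" using le by (rule ennreal_leI)
    also have "\<dots> = cost Q + final_eps_delta k \<epsilon> \<delta> (law Q)"
      using \<epsilon> cost_real_nonneg[of Q] by (simp add: V_def cost_eq Q final_eps_delta_eq[OF law_prob(1,2)[OF Q] \<delta> \<epsilon>])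
    finally show ?thesis .
  qed
  then have "is_arg_min (\<lambda>P. cost P + final_eps_delta k \<epsilon> \<delta> (law P)) (\<lambda>Q. Q \<in> prob_measures X) P'"
    using P' by (auto simp: is_arg_min_def not_less)
  \<comment> \<open>Undoes the shift: the particle numbers along the subsequence are
    \<open>Suc (r n)\<close>.\<close>
  moreover have "strict_mono (\<lambda>n. Suc (r n))" using r by (simp add: strict_mono_def)
  moreover have "narrow_conv X (\<lambda>n. empirical X (Suc (r n)) (p (Suc (r n)))) P'"
    using nc by (simp add: P_def o_def)
  ultimately show ?thesis using P' by (intro bexI[of _ P'] exI[of _ "\<lambda>n. Suc (r n)"]) auto
qed

end

theorem mainTheorem1:
  fixes T :: real
    and f0 :: "real^'d \<Rightarrow> real^'d"
    and f :: "'m::finite \<Rightarrow> real^'d \<Rightarrow> real^'d"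
    and U :: "(real^'m) set"
    and \<Omega> :: "(real^'d) set"
    and k :: "real^'d \<Rightarrow> real"
  assumes T: "T > 0"
    and A1_smooth: "Ck 1 f0" "\<And>i. Ck 1 (f i)"
    and A1_growth: "\<exists>C>0. \<forall>x. norm (f0 x) \<le> C * (1 + norm x) \<and>
                             (\<forall>i. norm (f i x) \<le> C * (1 + norm x))"
    and A2_Omega: "\<Omega> \<noteq> {}" "compact \<Omega>"
    and A2_U: "U \<noteq> {}" "compact U" "convex U"
    and A3: "0 < emeasure lborel (reachable_set T f0 f U \<Omega>)"
            "emeasure lborel (reachable_set T f0 f U \<Omega>) < \<infinity>"
    and k: "sym_pos_mollifier k"
  shows "(\<forall>\<epsilon> P. (\<forall>n. \<epsilon> n > 0) \<and> \<epsilon> \<longlonglongrightarrow> 0 \<and>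
            (\<forall>n. is_arg_min (ROT_eps_energy T f0 f (\<epsilon> n)) (\<lambda>Q. Q \<in> prob_measures (state_control_top T U \<Omega>)) (P n))
          \<longrightarrow> (\<exists>P'\<in>prob_measures (state_control_top T U \<Omega>). \<exists>r. strict_mono r \<and> narrow_conv (state_control_top T U \<Omega>) (P \<circ> r) P' \<and>
                 is_arg_min (ROT_energy T f0 f U \<Omega>) (\<lambda>Q. Q \<in> prob_measures (state_control_top T U \<Omega>)) P') \<and>
              narrow_conv euclidean (\<lambda>n. endpoint_law T f0 f (P n))
                (uniform_measure lborel (reachable_set T f0 f U \<Omega>)))
       \<and> (\<forall>\<epsilon>>0. \<forall>\<delta> P. (\<forall>n. \<delta> n > 0) \<and> \<delta> \<longlonglongrightarrow> 0 \<and>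
            (\<forall>n. is_arg_min (ROT_eps_delta_energy T f0 f k \<epsilon> (\<delta> n))
                   (\<lambda>Q. Q \<in> prob_measures (state_control_top T U \<Omega>)) (P n))
          \<longrightarrow> (\<exists>P'\<in>prob_measures (state_control_top T U \<Omega>). \<exists>r. strict_mono r \<and> narrow_conv (state_control_top T U \<Omega>) (P \<circ> r) P' \<and>
                 is_arg_min (ROT_eps_energy T f0 f \<epsilon>) (\<lambda>Q. Q \<in> prob_measures (state_control_top T U \<Omega>)) P'))
       \<and> (\<forall>\<epsilon>>0. \<forall>\<delta>>0. \<forall>p.
            (\<forall>N\<ge>1. is_arg_min (particles_energy T f0 f k \<epsilon> \<delta> N)
                     (admissible_particles T U \<Omega> N) (p N))
          \<longrightarrow> (\<exists>P'\<in>prob_measures (state_control_top T U \<Omega>). \<exists>r. strict_mono r \<and>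
                 narrow_conv (state_control_top T U \<Omega>) (\<lambda>n. empirical (state_control_top T U \<Omega>) (r n) (p (r n))) P' \<and>
                 is_arg_min (ROT_eps_delta_energy T f0 f k \<epsilon> \<delta>)
                   (\<lambda>Q. Q \<in> prob_measures (state_control_top T U \<Omega>)) P'))"
proof -
  interpret cs: control_system T f0 f U \<Omega>
    by unfold_locales (use T A1_smooth A1_growth A2_Omega A2_U in auto)
  define X where "X = state_control_top T U \<Omega>"
  obtain C :: "real set" and g where C: "compact C" "continuous_map (top_of_set C) X g" "g ` C = topspace X"
    unfolding X_def by (rule cs.state_top_parametrization)
  obtain K where K: "\<And>\<phi>. \<phi> \<in> controls T U \<Longrightarrow> energy T \<phi> \<le> K" by (rule cs.energy_bound) blast
  \<comment> \<open>From here on the control system enters only through its end-point map and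
    energy; the three claims are instances of the abstract limit theorems.\<close>
  interpret mt: mollified_transport X "\<lambda>z. energy T (snd z)" "endpoint T f0 f" C g K k
  proof (unfold_locales)
    show "Hausdorff_space X" unfolding X_def by (rule cs.Hausdorff_state_top)
    show "continuous_map X euclidean (endpoint T f0 f)" unfolding X_def by (rule cs.endpoint_continuous)
    show "(\<lambda>z. energy T (snd z)) \<in> borel_measurable (borel_of X)" unfolding X_def by (rule cs.energy_measurable)
    show "energy T (snd z) \<le> K" if "z \<in> topspace X" for z
      using that by (intro K) (auto simp: X_def topspace_state_control_top)
    show "ennreal (energy T (snd l)) \<le> liminf (\<lambda>n. ennreal (energy T (snd (z n))))"
      if "\<And>n. z n \<in> topspace X" "limitin X z l sequentially" for z l
      using that unfolding X_def by (rule cs.energy_lsc)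
  qed (use C k cs.energy_nonneg in auto)
  have reach: "reachable_set T f0 f U \<Omega> = mt.reach"
    unfolding reachable_set_def mt.reach_def by (auto simp: X_def topspace_state_control_top image_iff)
  have law: "endpoint_law T f0 f P = mt.law P" for P
    by (simp add: endpoint_law_def mt.law_def)
  have cost: "control_cost T P = mt.cost P" for P :: "((real^'d) \<times> (real \<Rightarrow> real^'m) set) measure"
    unfolding control_cost_def mt.cost_def by (simp only: case_prod_unfold)
  have particles: "particles_energy T f0 f k \<epsilon> \<delta> N = mt.particle_energy \<epsilon> \<delta> N" for \<epsilon> \<delta> N
    by (simp add: fun_eq_iff particles_energy_def mt.particle_energy_def)
  have admissible: "admissible_particles T U \<Omega> N = (\<lambda>p. \<forall>i\<in>{1..N}. p i \<in> topspace X)" for N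
    by (simp add: fun_eq_iff admissible_particles_def X_def topspace_state_control_top)
  have pos: "0 < emeasure lborel mt.reach" using A3(1) by (simp only: reach)
  note energies = ROT_energy_def[abs_def] ROT_eps_energy_def[abs_def] ROT_eps_delta_energy_def[abs_def]
  show ?thesis
    unfolding X_def[symmetric] energies reach law cost particles admissible
  proof (intro conjI allI impI, goal_cases)
    case (1 \<epsilon> P)
    then show ?case using mt.eps_limit(1)[OF pos, of \<epsilon> P] by blast
  next
    case (2 \<epsilon> P)
    then show ?case using mt.eps_limit(2)[OF pos, of \<epsilon> P] by blast
  next
    case (3 \<epsilon> \<delta> P)
    then show ?case using mt.delta_limit[of \<epsilon> \<delta> P] by blast
  next
    case (4 \<epsilon> \<delta> p)
    then show ?case using mt.particle_limit[of \<epsilon> \<delta> p] by blast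
  qed
qed

end
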